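(* Let $\mathcal X: y^m=f(x)$ be a Kummer curve over $\mathbb F_q$ and let $Q_1,\dots,Q_n$ be pairwise distinct totally ramified places of $\mathbb F_q(\mathcal X)/\mathbb F_q(x)$ lying over $P_1,\dots,P_n$, all as described in the context. Assume $2\le n\le q$. Let $(\alpha_1,\dots,\alpha_n)\in\mathbb Z^n$ and consider the divisor $D_\alpha=\sum_{k=1}^n\alpha_kQ_k$. Then the dimension $\ell(D_\alpha)$ over $\mathbb F_q$ of the Riemann-Roch space $\mathcal L(D_\alpha)$ is $$\ell(D_\alpha)=\max\left\{0,\,1+\sum_{k=1}^{n}\left\lfloor\frac{\alpha_k}{m}\right\rfloor\right\}+\sum_{i=1}^{m-1}\max\left\{0,\,n-\beta(i)+\sum_{k=1}^{n}\left\lfloor\frac{\alpha_k-t_k(i)}{m}\right\rfloor\right\}.$$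
   Context: Let $\mathbb F_q$ be the finite field with $q$ elements, $m\ge 2$ an integer with $\operatorname{char}(\mathbb F_q)\nmid m$, and $f(x)\in\mathbb F_q[x]$ a polynomial with $\deg f\ge 2$, all of whose roots lie in $\mathbb F_q$, and which is not a $d$-th power of an element of $\mathbb F_q(x)$ for any divisor $d\ge 2$ of $m$. Let $\mathcal X$ be the curve $y^m=f(x)$, with function field $\mathbb F_q(\mathcal X)=\mathbb F_q(x,y)$, whose genus $g(\mathcal X)$ is assumed to be at least $1$. Let $P_1,\dots,P_r$ be all the places of $\mathbb F_q(x)$ that are zeros or the pole of $f(x)$, and let $\lambda_k=\nu_{P_k}(f)$ be the valuation of $f$ at $P_k$ (so $\lambda_k=-\deg f$ if $P_k$ is the pole). For some $n\le r$, the places $P_1,\dots,P_n$ (possibly including the pole of $f$) are assumed totally ramified in $\mathbb F_q(\mathcal X)/\mathbb F_q(x)$, and $Q_k$ is the unique place of $\mathbb F_q(\mathcal X)$ over $P_k$, $1\le k\le n$. For $1\le i\le m-1$ put $$t_k(i)=(i\lambda_k)\bmod m\ \ (1\le k\le n),\qquad \beta(i)=\sum_{k=1}^{r}\left\lceil\frac{i\lambda_k}{m}\right\rceil-1,$$ where $b\bmod m$ is the smallest non-negative integer congruent to $b$ modulo $m$. For a divisor $G$, $\mathcal L(G)=\{z: (z)+G\ge 0\}\cup\{0\}$. *)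

theory Defs
  imports
    "HOL-Computational_Algebra.Computational_Algebra"
    "HOL-Algebra.Algebraic_Closure_Type"
    "HOL-Library.Poly_Mapping"
    "HOL-Library.Cardinality"
begin

text \<open>
  A function field with constant field \<^typ>\<open>'k\<close> is a field type \<^typ>\<open>'f\<close> together with an
  embedding \<open>\<iota>\<close> of \<^typ>\<open>'k\<close>. An extension of function fields is likewise given by an
  embedding \<open>\<phi>\<close>; its constant field embedding is then \<open>\<phi> \<circ> \<iota>\<close>. The rational function
  field over \<^typ>\<open>'k\<close> is \<^typ>\<open>'k poly fract\<close>, with \<open>rat_const\<close> as embedding.
\<close>

definition field_embedding :: "('k::field \<Rightarrow> 'f::field) \<Rightarrow> bool" where
  "field_embedding \<phi> \<longleftrightarrow>
     \<phi> 1 = 1 \<and> (\<forall>a b. \<phi> (a + b) = \<phi> a + \<phi> b) \<and> (\<forall>a b. \<phi> (a * b) = \<phi> a * \<phi> b)"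

definition is_subfield :: "'f::field set \<Rightarrow> bool" where
  "is_subfield S \<longleftrightarrow> 1 \<in> S \<and> (\<forall>a\<in>S. \<forall>b\<in>S. a - b \<in> S \<and> a * b \<in> S) \<and> (\<forall>a\<in>S. inverse a \<in> S)"

definition generated_subfield :: "'f::field set \<Rightarrow> 'f set" where
  "generated_subfield A = \<Inter>{S. is_subfield S \<and> A \<subseteq> S}"

definition extension_dim :: "('k::field \<Rightarrow> 'f::field) \<Rightarrow> 'f set \<Rightarrow> nat" where
  "extension_dim \<phi> V = vector_space.dim (\<lambda>c z. \<phi> c * z) V"

definition rat_const :: "'k::field \<Rightarrow> 'k poly fract" where
  "rat_const c = to_fract [:c:]"


section \<open>Places and valuations\<close>

definition valuation_ring :: "('k::field \<Rightarrow> 'f::field) \<Rightarrow> 'f set \<Rightarrow> bool" where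
  "valuation_ring \<iota> R \<longleftrightarrow>
     range \<iota> \<subset> R \<and> R \<subset> UNIV \<and>
     (\<forall>a\<in>R. \<forall>b\<in>R. a - b \<in> R \<and> a * b \<in> R) \<and>
     (\<forall>z. z \<in> R \<or> inverse z \<in> R)"

definition ring_units :: "'f::field set \<Rightarrow> 'f set" where
  "ring_units R = {u \<in> R. \<exists>w\<in>R. u * w = 1}"

text \<open>A place is the maximal ideal of a valuation ring, i.e. its set of non-units.\<close>

definition places :: "('k::field \<Rightarrow> 'f::field) \<Rightarrow> 'f set set" where
  "places \<iota> = {R - ring_units R | R. valuation_ring \<iota> R}"

text \<open>The valuation ring is recovered from its place. Zero is listed separately because
  \<^term>\<open>inverse 0 = (0 :: 'f::field)\<close> lies in every place.\<close>

definition place_ring :: "'f::field set \<Rightarrow> 'f set" where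
  "place_ring P = {z. z = 0 \<or> inverse z \<notin> P}"

definition uniformizer :: "'f::field set \<Rightarrow> 'f \<Rightarrow> bool" where
  "uniformizer P t \<longleftrightarrow> P = (\<lambda>w. t * w) ` place_ring P"

text \<open>The normalized valuation at \<open>P\<close> of a nonzero element. At \<open>0\<close>, where it should be
  infinite, the value is unspecified, and uses of \<open>val\<close> exclude this case.\<close>

definition val :: "'f::field set \<Rightarrow> 'f \<Rightarrow> int" where
  "val P z = (THE n. \<exists>t u. uniformizer P t \<and> u \<in> ring_units (place_ring P) \<and> z = t powi n * u)"


section \<open>Ramification\<close>

definition lies_over :: "('e::field \<Rightarrow> 'f::field) \<Rightarrow> 'f set \<Rightarrow> 'e set \<Rightarrow> bool" where
  "lies_over \<phi> Q P \<longleftrightarrow> \<phi> ` P \<subseteq> Q"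

definition ramification_index :: "('e::field \<Rightarrow> 'f::field) \<Rightarrow> 'f set \<Rightarrow> 'e set \<Rightarrow> nat" where
  "ramification_index \<phi> Q P = (THE e. \<forall>z. z \<noteq> 0 \<longrightarrow> val Q (\<phi> z) = int e * val P z)"

definition totally_ramified ::
  "('k::field \<Rightarrow> 'e::field) \<Rightarrow> ('e \<Rightarrow> 'f::field) \<Rightarrow> 'e set \<Rightarrow> bool" where
  "totally_ramified \<iota> \<phi> P \<longleftrightarrow>
     (\<exists>!Q. Q \<in> places (\<phi> \<circ> \<iota>) \<and> lies_over \<phi> Q P) \<and>
     (\<forall>Q\<in>places (\<phi> \<circ> \<iota>). lies_over \<phi> Q P \<longrightarrow>
        ramification_index \<phi> Q P = extension_dim \<phi> UNIV)"


section \<open>Divisors, Riemann--Roch spaces and the genus\<close>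

text \<open>Divisors are finitely supported integer-valued functions whose support consists of places.\<close>

definition divisors :: "('k::field \<Rightarrow> 'f::field) \<Rightarrow> ('f set \<Rightarrow>\<^sub>0 int) set" where
  "divisors \<iota> = {G. Poly_Mapping.keys G \<subseteq> places \<iota>}"

definition riemann_roch_space :: "('k::field \<Rightarrow> 'f::field) \<Rightarrow> ('f set \<Rightarrow>\<^sub>0 int) \<Rightarrow> 'f set" where
  "riemann_roch_space \<iota> G =
     {z. z \<noteq> 0 \<and> (\<forall>P\<in>places \<iota>. val P z + Poly_Mapping.lookup G P \<ge> 0)} \<union> {0}"

definition ell :: "('k::field \<Rightarrow> 'f::field) \<Rightarrow> ('f set \<Rightarrow>\<^sub>0 int) \<Rightarrow> nat" where
  "ell \<iota> G = extension_dim \<iota> (riemann_roch_space \<iota> G)"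

text \<open>The degree of \<open>P\<close> is the dimension over the constants of the residue field
  \<open>place_ring P / P\<close>: the size of a set \<open>B\<close> of representatives of a basis, that is, every
  element of \<open>place_ring P\<close> is congruent modulo \<open>P\<close> to exactly one linear combination of \<open>B\<close>.\<close>

definition place_degree :: "('k::field \<Rightarrow> 'f::field) \<Rightarrow> 'f set \<Rightarrow> nat" where
  "place_degree \<iota> P = (THE d. \<exists>B. finite B \<and> card B = d \<and> B \<subseteq> place_ring P \<and>
     (\<forall>z\<in>place_ring P. \<exists>!c. (\<forall>b. b \<notin> B \<longrightarrow> c b = 0) \<and> z - (\<Sum>b\<in>B. \<iota> (c b) * b) \<in> P))"

definition divisor_degree :: "('k::field \<Rightarrow> 'f::field) \<Rightarrow> ('f set \<Rightarrow>\<^sub>0 int) \<Rightarrow> int" where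
  "divisor_degree \<iota> G =
     (\<Sum>P\<in>Poly_Mapping.keys G. Poly_Mapping.lookup G P * int (place_degree \<iota> P))"

text \<open>The genus is the maximum of \<open>deg G - \<ell>(G) + 1\<close> over all divisors \<open>G\<close>.\<close>

definition genus :: "('k::field \<Rightarrow> 'f::field) \<Rightarrow> int" where
  "genus \<iota> = (GREATEST g. \<exists>G\<in>divisors \<iota>. g = divisor_degree \<iota> G - int (ell \<iota> G) + 1)"


section \<open>The numerical data of a Kummer curve\<close>

definition kummer_t :: "nat \<Rightarrow> (nat \<Rightarrow> int) \<Rightarrow> nat \<Rightarrow> nat \<Rightarrow> int" where
  "kummer_t m lam k i = (int i * lam k) mod int m"

definition kummer_beta :: "nat \<Rightarrow> nat \<Rightarrow> (nat \<Rightarrow> int) \<Rightarrow> nat \<Rightarrow> int" where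
  "kummer_beta m r lam i = (\<Sum>k=1..r. \<lceil>real_of_int (int i * lam k) / real m\<rceil>) - 1"

end

theory Submission
  imports Defs "HOL-Number_Theory.Residues"
begin

text \<open>
  Let \<open>K\<close> be the rational function field and \<open>F\<close> the function field of the curve. The powers \<open>w ^ i\<close> with
  \<open>i < m\<close> of \<open>w = 1 / y\<close> form a basis of \<open>F\<close> over \<open>K\<close>, and the theorem says that the Riemann--Roch space
  decomposes along this basis: an element \<open>\<Sum>i<m. c i * w ^ i\<close> lies in it if and only if each of its terms
  does (lemma \<open>riemann_roch_coords\<close>). For a single term the condition is that \<open>c i\<close> lies in the Riemann--Roch
  space of a divisor of \<open>K\<close>, which has the order \<open>(\<alpha> k - i * lam k) div m\<close> at \<open>P k\<close> for \<open>k \<le> n\<close>, the order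
  \<open>(- i * lam k) div m\<close> at \<open>P k\<close> for the other \<open>k\<close>, and no further places in its support. All
  these places have degree one, since \<open>f\<close> splits, so that the dimension is \<open>max 0 (1 + degree)\<close> (lemma
  \<open>riemann_roch_rational_function_field\<close>). Rewriting the degree gives the summands of the formula.

  The terms can be separated for two different reasons. At a totally ramified place the order of \<open>f\<close>
  is coprime to \<open>m\<close>, so terms of different index have values in different classes modulo \<open>m\<close>, and the value of
  the sum is the least one. At any other place \<open>P\<close> of \<open>K\<close> the divisor has order zero at all places
  above, so the sum \<open>z\<close> is regular at all of them. By Chevalley's extension theorem
  (\<open>ex_valuation_subring_avoiding\<close>) \<open>z\<close> is then integral over the ring of \<open>P\<close>, and the coordinates of all powers
  \<open>z ^ l\<close> have bounded denominators. If \<open>l\<close> is a power of the characteristic congruent to 1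
  modulo \<open>m\<close>, these coordinates are the \<open>l\<close>-th powers of those of \<open>z\<close> up to powers of \<open>f\<close>, and letting \<open>l\<close>
  grow shows that each term of \<open>z\<close> is regular (\<open>coords_of_regular_element\<close>).

  That the order of \<open>f\<close> at a totally ramified place is coprime to \<open>m\<close>, and that the degree of \<open>F\<close> over \<open>K\<close> is
  \<open>m\<close>, comes from \<open>f\<close> not being a proper power, by an approximation argument in the same spirit
  (\<open>kummer_gcd_eq_1\<close>, \<open>kummer_degree\<close>).

  The function \<open>val\<close> is meaningful only at places that have a uniformizer. For \<open>K\<close> this follows from the
  classification of its places (\<open>rational_function_field_places\<close>), and for \<open>F\<close> from the fact that some power of
  each element has the value of an element of \<open>K\<close> (\<open>place_above\<close>).
\<close>

section \<open>Discrete places\<close>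

text \<open>As \<^const>\<open>val\<close> is a definite description, it behaves like a valuation only at suitable places.\<close>

locale discrete_place =
  fixes P :: "'f::field set"
  assumes val_mult: "a \<noteq> 0 \<Longrightarrow> b \<noteq> 0 \<Longrightarrow> val P (a * b) = val P a + val P b"
    and val_add: "a \<noteq> 0 \<Longrightarrow> b \<noteq> 0 \<Longrightarrow> a + b \<noteq> 0 \<Longrightarrow> min (val P a) (val P b) \<le> val P (a + b)"
    and mem_place_iff: "z \<in> P \<longleftrightarrow> z = 0 \<or> val P z > 0"
    and ex_val_1: "\<exists>t. t \<noteq> 0 \<and> val P t = 1"

text \<open>The values of an integer-valued valuation \<^term>\<open>V\<close> form a subgroup of the integers, generated
  by its least positive element \<^term>\<open>d\<close>; dividing by \<^term>\<open>d\<close> gives the normalized valuation.\<close>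

lemma discrete_placeI:
  fixes V :: "'f::field \<Rightarrow> int"
  assumes V_mult: "\<And>a b. a \<noteq> 0 \<Longrightarrow> b \<noteq> 0 \<Longrightarrow> V (a * b) = V a + V b"
    and V_add: "\<And>a b. a \<noteq> 0 \<Longrightarrow> b \<noteq> 0 \<Longrightarrow> a + b \<noteq> 0 \<Longrightarrow> min (V a) (V b) \<le> V (a + b)"
    and nontrivial: "z0 \<noteq> 0" "V z0 \<noteq> 0"
    and P: "P = {z. z = 0 \<or> V z > 0}"
  obtains d where "d > 0" "\<And>z. z \<noteq> 0 \<Longrightarrow> V z = d * val P z" "discrete_place P"
proof -
  have V_1: "V 1 = 0" using V_mult[of 1 1] by simp
  have V_inverse: "V (inverse z) = - V z" if "z \<noteq> 0" for z
    using V_mult[of z "inverse z"] that V_1 by simp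
  have V_power: "V (z ^ n) = int n * V z" if "z \<noteq> 0" for z n
    by (induction n) (use that V_1 V_mult in \<open>auto simp: algebra_simps\<close>)
  have V_powi: "V (z powi n) = n * V z" if "z \<noteq> 0" for z n
    using that by (cases "n \<ge> 0") (auto simp: power_int_def V_power V_inverse)
  define S where "S = {n::nat. n > 0 \<and> (\<exists>z. z \<noteq> 0 \<and> V z = int n)}"
  define d where "d = int (LEAST n. n \<in> S)"
  have "nat \<bar>V z0\<bar> \<in> S"
  proof (cases "V z0 > 0")
    case True
    then show ?thesis unfolding S_def using nontrivial by auto
  next
    case False
    then show ?thesis unfolding S_def using nontrivial V_inverse[of z0]
      by (auto intro!: exI[of _ "inverse z0"])
  qed
  then have "(LEAST n. n \<in> S) \<in> S" by (rule LeastI)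
  then obtain t where d_pos: "d > 0" and t: "t \<noteq> 0" "V t = d"
    unfolding S_def d_def by auto
  have d_least: "d \<le> V z" if "z \<noteq> 0" "V z > 0" for z
  proof -
    have "nat (V z) \<in> S" unfolding S_def using that by auto
    then have "(LEAST n. n \<in> S) \<le> nat (V z)" by (rule Least_le)
    then show ?thesis unfolding d_def using that by linarith
  qed
  have V_div: "V z = d * (V z div d)" if "z \<noteq> 0" for z
  proof -
    let ?w = "z * t powi (- (V z div d))"
    have w: "?w \<noteq> 0" using that t by simp
    have "V ?w = V z mod d"
      using that t by (simp add: V_mult V_powi minus_div_mult_eq_mod)
    moreover have "V z mod d < d" "V z mod d \<ge> 0" using d_pos by auto
    ultimately have "V z mod d = 0" using d_least[OF w] by linarith
    then show ?thesis using mult_div_mod_eq[of d "V z"] by linarith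
  qed
  have ring: "place_ring P = {z. z = 0 \<or> V z \<ge> 0}"
    unfolding place_ring_def P using V_inverse by force
  have uniformizer: "uniformizer P s \<longleftrightarrow> s \<noteq> 0 \<and> V s = d" for s
  proof
    assume s: "uniformizer P s"
    then have img: "P = (\<lambda>w. s * w) ` place_ring P" unfolding uniformizer_def .
    have "t \<in> P" using t d_pos by (simp add: P)
    then obtain w where w: "t = s * w" "w \<in> place_ring P" using img by blast
    have "1 \<in> place_ring P" by (simp add: ring V_1)
    then have "s * 1 \<in> P" using img by blast
    moreover have "s \<noteq> 0" "w \<noteq> 0" using w t by auto
    ultimately have "V s > 0" by (simp add: P)
    moreover have "V t = V s + V w" "V w \<ge> 0"
      using w V_mult \<open>s \<noteq> 0\<close> \<open>w \<noteq> 0\<close> by (auto simp: ring)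
    ultimately show "s \<noteq> 0 \<and> V s = d" using d_least[of s] t \<open>s \<noteq> 0\<close> by simp
  next
    assume s: "s \<noteq> 0 \<and> V s = d"
    have "z \<in> (\<lambda>w. s * w) ` place_ring P" if "z \<in> P" for z
    proof (cases "z = 0")
      case True
      then show ?thesis by (auto simp: ring intro!: image_eqI[of _ _ 0])
    next
      case False
      then have "V z \<ge> d" using that d_least by (simp add: P)
      then have "V (z * inverse s) \<ge> 0" using False s by (simp add: V_mult V_inverse)
      then show ?thesis using s by (intro image_eqI[of _ _ "z * inverse s"]) (auto simp: ring)
    qed
    moreover have "s * w \<in> P" if "w \<in> place_ring P" for w
      using that s d_pos V_mult[of s w] by (cases "w = 0") (auto simp: ring[unfolded P] P)
    ultimately show "uniformizer P s" unfolding uniformizer_def by auto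
  qed
  have unit: "u \<noteq> 0 \<and> V u = 0" if u: "u \<in> ring_units (place_ring P)" for u
  proof -
    obtain w where w: "u * w = 1" "w \<in> place_ring P" "u \<in> place_ring P"
      using u unfolding ring_units_def by auto
    then have "u \<noteq> 0" "w \<noteq> 0" by auto
    then show ?thesis using w V_mult[of u w] V_1 by (auto simp: ring)
  qed
  have unitI: "u \<in> ring_units (place_ring P)" if "u \<noteq> 0" "V u = 0" for u
    unfolding ring_units_def ring using that V_inverse
    by (auto intro!: exI[of _ "inverse u"])
  have val: "val P z = V z div d" if z: "z \<noteq> 0" for z
    unfolding val_def
  proof (rule the_equality)
    have "V (z * t powi (- (V z div d))) = 0"
      using z t V_div[OF z] by (simp add: V_mult V_powi mult.commute)
    then have "z * t powi (- (V z div d)) \<in> ring_units (place_ring P)"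
      using z t by (intro unitI) auto
    moreover have "z = t powi (V z div d) * (z * t powi (- (V z div d)))"
      using t by (simp add: power_int_minus)
    ultimately show "\<exists>t u. uniformizer P t \<and> u \<in> ring_units (place_ring P) \<and>
        z = t powi (V z div d) * u"
      using t uniformizer by blast
  next
    fix n assume "\<exists>t u. uniformizer P t \<and> u \<in> ring_units (place_ring P) \<and> z = t powi n * u"
    then obtain s u where s: "s \<noteq> 0" "V s = d" and u: "u \<noteq> 0" "V u = 0" and "z = s powi n * u"
      using uniformizer unit by blast
    then have "V z = n * d" by (simp add: V_mult V_powi)
    then show "n = V z div d" using d_pos by simp
  qed
  then have V_val: "V z = d * val P z" if "z \<noteq> 0" for z using V_div that by simp
  have "discrete_place P"
  proof
    show "val P (a * b) = val P a + val P b" if "a \<noteq> 0" "b \<noteq> 0" for a b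
    proof -
      have "d * val P (a * b) = d * (val P a + val P b)"
        using V_val[of a] V_val[of b] V_val[of "a * b"] V_mult[of a b] that
        by (simp add: distrib_left)
      then show ?thesis using d_pos by simp
    qed
    show "min (val P a) (val P b) \<le> val P (a + b)" if "a \<noteq> 0" "b \<noteq> 0" "a + b \<noteq> 0" for a b
    proof -
      have "d * min (val P a) (val P b) \<le> d * val P (a + b)"
        using V_val[of a] V_val[of b] V_val[of "a + b"] V_add[of a b] that d_pos
        by (auto simp: min_def split: if_splits)
      then show ?thesis using d_pos by simp
    qed
    show "z \<in> P \<longleftrightarrow> z = 0 \<or> val P z > 0" for z
      using V_val[of z] d_pos unfolding P by (cases "z = 0") (auto simp: zero_less_mult_iff)
    show "\<exists>t. t \<noteq> 0 \<and> val P t = 1"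
      using t V_val[of t] d_pos by auto
  qed
  then show ?thesis using that d_pos V_val by blast
qed

context discrete_place
begin

lemma val_1: "val P 1 = 0"
  using val_mult[of 1 1] by simp

lemma val_inverse: "z \<noteq> 0 \<Longrightarrow> val P (inverse z) = - val P z"
  using val_mult[of z "inverse z"] val_1 by simp

lemma val_divide: "a \<noteq> 0 \<Longrightarrow> b \<noteq> 0 \<Longrightarrow> val P (a / b) = val P a - val P b"
  by (simp add: divide_inverse val_mult val_inverse)

lemma val_power: "z \<noteq> 0 \<Longrightarrow> val P (z ^ n) = int n * val P z"
  by (induction n) (auto simp: val_1 val_mult algebra_simps)

lemma val_powi: "z \<noteq> 0 \<Longrightarrow> val P (z powi n) = n * val P z"
  by (cases "n \<ge> 0") (auto simp: power_int_def val_power val_inverse)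

lemma val_prod: "finite A \<Longrightarrow> (\<And>i. i \<in> A \<Longrightarrow> z i \<noteq> 0) \<Longrightarrow> val P (prod z A) = (\<Sum>i\<in>A. val P (z i))"
  by (induction A rule: finite_induct) (auto simp: val_1 val_mult)

lemma val_minus: "val P (- z) = val P z"
proof (cases "z = 0")
  case False
  have "2 * val P (- 1) = val P ((- 1) ^ 2)" by (subst val_power) auto
  then have "val P (- 1) = 0" by (simp add: val_1)
  then show ?thesis using val_mult[of "- 1" z] False by simp
qed simp

lemma mem_place_ring_iff: "z \<in> place_ring P \<longleftrightarrow> z = 0 \<or> val P z \<ge> 0"
  unfolding place_ring_def using val_inverse[of z] by (auto simp: mem_place_iff)

lemma val_add_ge: "(a \<noteq> 0 \<Longrightarrow> c \<le> val P a) \<Longrightarrow> (b \<noteq> 0 \<Longrightarrow> c \<le> val P b) \<Longrightarrow> a + b \<noteq> 0 \<Longrightarrow> c \<le> val P (a + b)"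
  using val_add[of a b] by (cases "a = 0"; cases "b = 0") auto

lemma val_sum_ge:
  "finite I \<Longrightarrow> (\<And>i. i \<in> I \<Longrightarrow> z i \<noteq> 0 \<Longrightarrow> c \<le> val P (z i)) \<Longrightarrow> sum z I \<noteq> 0 \<Longrightarrow> c \<le> val P (sum z I)"
  by (induction I rule: finite_induct) (auto intro: val_add_ge)

lemma val_add_less:
  assumes "a \<noteq> 0" "b \<noteq> 0" "val P a < val P b"
  shows "a + b \<noteq> 0" "val P (a + b) = val P a"
proof -
  show nz: "a + b \<noteq> 0"
    using assms val_minus[of b] by (auto simp: add_eq_0_iff)
  have "min (val P (a + b)) (val P (- b)) \<le> val P (a + b + - b)"
    by (rule val_add) (use assms nz in auto)
  moreover have "min (val P a) (val P b) \<le> val P (a + b)"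
    by (rule val_add) (use assms nz in auto)
  ultimately show "val P (a + b) = val P a" using assms val_minus[of b] by auto
qed

lemma val_sum_distinct:
  assumes "finite I" "I \<noteq> {}" "\<And>i. i \<in> I \<Longrightarrow> z i \<noteq> 0" "inj_on (\<lambda>i. val P (z i)) I"
  shows "sum z I \<noteq> 0 \<and> (\<forall>i\<in>I. val P (sum z I) \<le> val P (z i)) \<and> (\<exists>j\<in>I. val P (sum z I) = val P (z j))"
  using assms
proof (induction I rule: finite_ne_induct)
  case (singleton x)
  then show ?case by simp
next
  case (insert x I)
  then have IH: "sum z I \<noteq> 0" "\<forall>i\<in>I. val P (sum z I) \<le> val P (z i)"
    "\<exists>j\<in>I. val P (sum z I) = val P (z j)" by auto
  have zx: "z x \<noteq> 0" using insert by auto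
  have "val P (z x) \<noteq> val P (sum z I)" using IH(3) insert.prems insert.hyps by (auto simp: inj_on_def)
  then consider "val P (z x) < val P (sum z I)" | "val P (sum z I) < val P (z x)" by linarith
  then show ?case
  proof cases
    case 1
    then show ?thesis using val_add_less[OF zx IH(1) 1] IH insert.hyps by fastforce
  next
    case 2
    then show ?thesis using val_add_less[OF IH(1) zx 2] IH insert.hyps by (fastforce simp: add.commute)
  qed
qed

end

section \<open>Valuation rings and their places\<close>

locale subring_of_field =
  fixes A :: "'f::field set"
  assumes one: "1 \<in> A"
    and diff: "a \<in> A \<Longrightarrow> b \<in> A \<Longrightarrow> a - b \<in> A"
    and mult: "a \<in> A \<Longrightarrow> b \<in> A \<Longrightarrow> a * b \<in> A"
begin

lemma zero: "0 \<in> A" using diff[OF one one] by simp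
lemma minus: "a \<in> A \<Longrightarrow> - a \<in> A" using diff[OF zero] by simp
lemma add: "a \<in> A \<Longrightarrow> b \<in> A \<Longrightarrow> a + b \<in> A" using diff[of a "- b"] minus by simp
lemma power: "a \<in> A \<Longrightarrow> a ^ n \<in> A" by (induction n) (auto intro: mult one)
lemma sum: "(\<And>i. i \<in> I \<Longrightarrow> z i \<in> A) \<Longrightarrow> sum z I \<in> A"
  by (induction I rule: infinite_finite_induct) (auto intro: zero add)

end

locale valuation_subring =
  fixes R :: "'f::field set"
  assumes diff: "a \<in> R \<Longrightarrow> b \<in> R \<Longrightarrow> a - b \<in> R"
    and mult: "a \<in> R \<Longrightarrow> b \<in> R \<Longrightarrow> a * b \<in> R"
    and total: "z \<in> R \<or> inverse z \<in> R"

sublocale valuation_subring \<subseteq> subring_of_field R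
  using total[of 1] by unfold_locales (auto intro: diff mult)

context valuation_subring
begin

lemma ring_units_iff: "u \<in> ring_units R \<longleftrightarrow> u \<noteq> 0 \<and> u \<in> R \<and> inverse u \<in> R"
proof -
  have "w = inverse u" if "u * w = 1" for w using that by (simp add: inverse_unique)
  then show ?thesis unfolding ring_units_def by (auto intro!: bexI[of _ "inverse u"])
qed

lemma mem_nonunits_iff: "z \<in> R - ring_units R \<longleftrightarrow> z = 0 \<or> inverse z \<notin> R"
  using total[of z] zero by (auto simp: ring_units_iff)

lemma place_ring_nonunits: "place_ring (R - ring_units R) = R"
proof -
  have "z \<in> place_ring (R - ring_units R) \<longleftrightarrow> z \<in> R" for z
    unfolding place_ring_def mem_Collect_eq mem_nonunits_iff using zero by auto
  then show ?thesis by auto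
qed

lemma powerD: assumes "n > 0" and zn: "z ^ n \<in> R" shows "z \<in> R"
proof (rule ccontr)
  assume z: "z \<notin> R"
  then have "inverse z \<in> R" "z \<noteq> 0" using total zero by auto
  then have "z ^ n * inverse z ^ (n - 1) \<in> R" using mult[OF zn power] by blast
  moreover have "z ^ n * inverse z ^ (n - 1) = z"
    using assms(1) \<open>z \<noteq> 0\<close> by (cases n) (simp_all add: power_inverse)
  ultimately show False using z by simp
qed

end

lemma valuation_ring_iff:
  "valuation_ring \<iota> R \<longleftrightarrow> valuation_subring R \<and> range \<iota> \<subset> R \<and> R \<noteq> UNIV"
  unfolding valuation_ring_def valuation_subring_def by auto

lemma placesI:
  assumes "valuation_ring \<iota> R" "\<And>z. z \<in> P \<longleftrightarrow> z = 0 \<or> inverse z \<notin> R"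
  shows "P \<in> places \<iota>" "place_ring P = R"
proof -
  interpret valuation_subring R using assms(1) by (simp add: valuation_ring_iff)
  have P: "P = R - ring_units R" using assms(2) mem_nonunits_iff by auto
  show "P \<in> places \<iota>" using assms(1) P unfolding places_def by auto
  show "place_ring P = R" unfolding P by (rule place_ring_nonunits)
qed

lemma placesD:
  assumes "P \<in> places \<iota>"
  shows "valuation_ring \<iota> (place_ring P)" "valuation_subring (place_ring P)"
    and "z \<in> P \<longleftrightarrow> z = 0 \<or> inverse z \<notin> place_ring P"
proof -
  obtain R where R: "valuation_ring \<iota> R" "P = R - ring_units R"
    using assms unfolding places_def by auto
  interpret valuation_subring R using R(1) by (simp add: valuation_ring_iff)
  have PR: "place_ring P = R" unfolding R(2) by (rule place_ring_nonunits)
  then show "valuation_ring \<iota> (place_ring P)" using R by simp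
  then show "valuation_subring (place_ring P)" by (simp add: valuation_ring_iff)
  show "z \<in> P \<longleftrightarrow> z = 0 \<or> inverse z \<notin> place_ring P"
    unfolding PR by (subst R(2)) (rule mem_nonunits_iff)
qed

text \<open>The ring of a discrete place is a maximal subring: dividing any element by a large power of one of
  negative value gives an element of the ring.\<close>

lemma (in discrete_place) place_ring_maximal:
  assumes sub: "place_ring P \<subseteq> R" and R: "valuation_subring R" "R \<noteq> UNIV"
  shows "R = place_ring P"
proof (rule ccontr)
  interpret R: valuation_subring R by fact
  assume "R \<noteq> place_ring P"
  then obtain z where z: "z \<in> R" "z \<notin> place_ring P" using sub by auto
  then have z0: "z \<noteq> 0" "val P z < 0" by (auto simp: mem_place_ring_iff)
  have "w \<in> R" for w
  proof (cases "w = 0")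
    case False
    define n where "n = nat \<bar>val P w\<bar>"
    have "val P (w / z ^ n) = val P w - int n * val P z"
      using False z0 by (simp add: val_divide val_power)
    also have "\<dots> \<ge> val P w + int n"
      using z0 mult_left_mono[of "val P z" "- 1" "int n"] by simp
    finally have "w / z ^ n \<in> place_ring P" by (auto simp: n_def mem_place_ring_iff)
    then have "w / z ^ n \<in> R" using sub by auto
    then have "w / z ^ n * z ^ n \<in> R" using z R.power R.mult by blast
    then show ?thesis using z0 by simp
  qed (simp add: R.zero)
  then show False using R by auto
qed

lemma place_eqI:
  assumes "P \<in> places \<iota>" "P' \<in> places \<iota>'" "place_ring P = place_ring P'"
  shows "P = P'"
proof -
  have "z \<in> P \<longleftrightarrow> z \<in> P'" for z
    by (simp add: placesD(3)[OF assms(1), of z] placesD(3)[OF assms(2), of z] assms(3))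
  then show ?thesis by auto
qed

lemma place_mult:
  assumes P: "P \<in> places \<iota>" and z: "z \<in> P" and a: "a \<in> place_ring P"
  shows "z * a \<in> P"
proof (rule ccontr)
  interpret R: valuation_subring "place_ring P" by (rule placesD(2)[OF P])
  assume "z * a \<notin> P"
  then have *: "z * a \<noteq> 0" "inverse (z * a) \<in> place_ring P" using placesD(3)[OF P] by auto
  then have "inverse (z * a) * a \<in> place_ring P" using a R.mult by blast
  moreover have "inverse (z * a) * a = inverse z" using * by (simp add: mult.assoc)
  ultimately have "inverse z \<in> place_ring P" by metis
  then show False using z * placesD(3)[OF P, of z] by auto
qed

lemma place_diff:
  assumes P: "P \<in> places \<iota>" and z: "z \<in> P" and w: "w \<in> P"
  shows "z - w \<in> P"
proof -
  interpret R: valuation_subring "place_ring P" by (rule placesD(2)[OF P])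
  have minus: "- x \<in> P" if "x \<in> P" for x
    using place_mult[OF P that R.minus[OF R.one]] by simp
  have "z / w \<in> place_ring P \<or> w / z \<in> place_ring P" using R.total[of "z / w"] by simp
  then show ?thesis
  proof
    assume *: "z / w \<in> place_ring P"
    show ?thesis
    proof (cases "w = 0")
      case False
      have "w * (z / w - 1) \<in> P" by (rule place_mult[OF P w R.diff[OF * R.one]])
      then show ?thesis using False by (simp add: right_diff_distrib)
    qed (use z in simp)
  next
    assume *: "w / z \<in> place_ring P"
    show ?thesis
    proof (cases "z = 0")
      case False
      have "z * (1 - w / z) \<in> P" by (rule place_mult[OF P z R.diff[OF R.one *]])
      then show ?thesis using False by (simp add: right_diff_distrib)
    qed (use minus[OF w] in simp)
  qed
qed

lemma one_not_in_place:
  assumes P: "P \<in> places \<iota>"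
  shows "1 \<notin> P"
proof -
  interpret R: valuation_subring "place_ring P" by (rule placesD(2)[OF P])
  show ?thesis using placesD(3)[OF P, of 1] R.one by simp
qed

text \<open>The ultrametric inequality follows from the ring: if \<^term>\<open>a\<close> has the smaller value, then
  \<open>b / a\<close> and hence \<open>1 + b / a\<close> lie in it.\<close>

lemma discrete_place_of_ring_values:
  fixes V :: "'f::field \<Rightarrow> int"
  assumes P: "P \<in> places \<iota>"
    and V_mult: "\<And>a b. a \<noteq> 0 \<Longrightarrow> b \<noteq> 0 \<Longrightarrow> V (a * b) = V a + V b"
    and ring: "\<And>z. z \<noteq> 0 \<Longrightarrow> V z \<ge> 0 \<longleftrightarrow> z \<in> place_ring P"
    and nontrivial: "z0 \<noteq> 0" "V z0 \<noteq> 0"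
  obtains d where "d > 0" "\<And>z. z \<noteq> 0 \<Longrightarrow> V z = d * val P z" "discrete_place P"
proof -
  interpret R: valuation_subring "place_ring P" by (rule placesD(2)[OF P])
  have V_inverse: "V (inverse z) = - V z" if "z \<noteq> 0" for z
    using V_mult[of z "inverse z"] V_mult[of 1 1] that by simp
  have V_add1: "V a \<le> V (a + b)" if "a \<noteq> 0" "b \<noteq> 0" "a + b \<noteq> 0" "V a \<le> V b" for a b
  proof -
    have "V (b * inverse a) \<ge> 0" using that by (simp add: V_mult V_inverse)
    then have "1 + b * inverse a \<in> place_ring P" using that ring[of "b * inverse a"] by (simp add: R.add R.one)
    moreover have "(a + b) * inverse a = 1 + b * inverse a" using that by (simp add: field_simps)
    moreover have "(a + b) * inverse a \<noteq> 0" using that by simp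
    ultimately have "V ((a + b) * inverse a) \<ge> 0" using ring[of "(a + b) * inverse a"] by metis
    then show ?thesis using that by (simp add: V_mult V_inverse)
  qed
  have V_add: "min (V a) (V b) \<le> V (a + b)" if "a \<noteq> 0" "b \<noteq> 0" "a + b \<noteq> 0" for a b
    using V_add1[of a b] V_add1[of b a] that by (auto simp: min_def add.commute)
  have "z \<in> P \<longleftrightarrow> z = 0 \<or> V z > 0" for z
    using placesD(3)[OF P, of z] ring[of "inverse z"] V_inverse[of z] by (cases "z = 0") auto
  then have PV: "P = {z. z = 0 \<or> V z > 0}" by auto
  show ?thesis by (rule discrete_placeI[OF V_mult V_add nontrivial PV]) (auto intro: that)
qed

text \<open>This is how the places of the rational function field are seen to be discrete: \<^term>\<open>t\<close> will be an
  irreducible polynomial, or the inverse of the variable.\<close>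

lemma discrete_place_of_prime:
  assumes P: "P \<in> places \<iota>" and t: "t \<in> P" "t \<noteq> 0"
    and decomp: "\<forall>z. z \<noteq> 0 \<longrightarrow> (\<exists>k u. u \<in> ring_units (place_ring P) \<and> z = t powi k * u)"
  shows "discrete_place P"
    and "u \<in> ring_units (place_ring P) \<Longrightarrow> val P (t powi k * u) = k"
proof -
  interpret R: valuation_subring "place_ring P" by (rule placesD(2)[OF P])
  let ?R = "place_ring P" let ?U = "ring_units ?R"
  have t': "t \<in> ?R" "inverse t \<notin> ?R"
    using t placesD(3)[OF P, of t] R.total[of t] by auto
  have pow: "k \<ge> 0" if "t powi k * u \<in> ?R" "u \<in> ?U" for k u
  proof (rule ccontr)
    assume "\<not> k \<ge> 0"
    have "(t powi k * u) * inverse u * t ^ nat (- k - 1) \<in> ?R"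
      using that t' R.mult[OF R.mult[OF that(1)] R.power] by (simp add: R.ring_units_iff)
    also have "(t powi k * u) * inverse u * t ^ nat (- k - 1) = t powi k * t powi (- k - 1)"
      using that(2) \<open>\<not> k \<ge> 0\<close> by (simp add: R.ring_units_iff power_int_def)
    also have "\<dots> = inverse t" using t by (simp flip: power_int_add)
    finally show False using t' by simp
  qed
  have uniq: "k = l" if "t powi k * u = t powi l * w" "u \<in> ?U" "w \<in> ?U" for k l u w
  proof -
    have uw: "inverse u \<in> ?R" "w \<in> ?R" "u \<noteq> 0" "u \<in> ?R" "inverse w \<in> ?R" "w \<noteq> 0"
      using that by (auto simp: R.ring_units_iff)
    then have U: "w * inverse u \<in> ?U" "u * inverse w \<in> ?U"
      by (auto simp: R.ring_units_iff intro: R.mult)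
    have "t powi (k - l) = w * inverse u" "t powi (l - k) = u * inverse w"
      using that t uw by (simp_all add: power_int_diff field_simps)
    then have "t powi (k - l) * 1 \<in> ?R" "t powi (l - k) * 1 \<in> ?R" using U by (auto simp: R.ring_units_iff)
    moreover have "1 \<in> ?U" by (simp add: R.ring_units_iff R.one)
    ultimately show "k = l" using pow[of "k - l" 1] pow[of "l - k" 1] by simp
  qed
  define V where "V z = (THE k. \<exists>u\<in>?U. z = t powi k * u)" for z
  have V: "V (t powi k * u) = k" if "u \<in> ?U" for k u
    unfolding V_def using that uniq by (intro the_equality) blast+
  have Vex: "\<exists>u\<in>?U. z = t powi (V z) * u" if "z \<noteq> 0" for z
    using decomp that V by metis
  have ring: "V z \<ge> 0 \<longleftrightarrow> z \<in> ?R" if z: "z \<noteq> 0" for z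
  proof -
    obtain u where u: "u \<in> ?U" "z = t powi (V z) * u" using Vex z by blast
    show ?thesis
    proof
      assume "V z \<ge> 0"
      then have "t ^ nat (V z) * u \<in> ?R" using u t' by (intro R.mult R.power) (auto simp: R.ring_units_iff)
      then show "z \<in> ?R" using u \<open>V z \<ge> 0\<close> by (simp add: power_int_def)
    qed (use u pow in metis)
  qed
  have V_mult: "V (a * b) = V a + V b" if ab: "a \<noteq> 0" "b \<noteq> 0" for a b
  proof -
    obtain u w where u: "u \<in> ?U" "a = t powi (V a) * u" and w: "w \<in> ?U" "b = t powi (V b) * w"
      using Vex ab by blast
    have "a * b = t powi (V a + V b) * (u * w)"
      using t by (subst u(2), subst w(2)) (simp add: power_int_add)
    moreover have "u * w \<in> ?U" using u w by (auto simp: R.ring_units_iff intro: R.mult)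
    ultimately show ?thesis using V by simp
  qed
  have one: "1 \<in> ?U" by (simp add: R.ring_units_iff R.one)
  have Vt: "V t = 1" using V[OF one, of 1] by simp
  obtain d where d: "d > 0" "\<And>z. z \<noteq> 0 \<Longrightarrow> V z = d * val P z" and "discrete_place P"
    using discrete_place_of_ring_values[OF P V_mult ring t(2)] Vt by auto
  show "discrete_place P" by fact
  have "d = 1" using d(2)[of t] Vt t d(1) by (simp add: pos_zmult_eq_1_iff)
  show "val P (t powi k * u) = k" if "u \<in> ring_units (place_ring P)"
    using d(2)[of "t powi k * u"] \<open>d = 1\<close> V[OF that] t that by (simp add: R.ring_units_iff)
qed

section \<open>The places of the rational function field\<close>

abbreviation ratX :: "'k::field poly fract" where "ratX \<equiv> to_fract [:0, 1:]"

definition finite_place :: "'k::field poly \<Rightarrow> 'k poly fract set" where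
  "finite_place p = {to_fract a / to_fract b | a b. p dvd a \<and> \<not> p dvd b}"

definition infinite_place :: "'k::field poly fract set" where
  "infinite_place = {to_fract a / to_fract b | a b. b \<noteq> 0 \<and> (a = 0 \<or> degree a < degree b)}"

lemma finite_placeI: "p dvd a \<Longrightarrow> \<not> p dvd b \<Longrightarrow> to_fract a / to_fract b \<in> finite_place p"
  unfolding finite_place_def by blast

lemma infinite_placeI:
  "b \<noteq> 0 \<Longrightarrow> a = 0 \<or> degree a < degree b \<Longrightarrow> to_fract a / to_fract b \<in> infinite_place"
  unfolding infinite_place_def by blast

lemma fract_cases:
  obtains a b where "b \<noteq> 0" "z = to_fract a / to_fract (b :: 'k::field poly)"
  by (cases z) (auto simp: Fract_conv_to_fract)

lemma to_fract_divide_eq_iff: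
  assumes "b \<noteq> 0" "d \<noteq> 0"
  shows "to_fract a / to_fract b = to_fract c / to_fract d \<longleftrightarrow> a * d = c * b"
proof -
  have "to_fract a / to_fract b = to_fract c / to_fract d \<longleftrightarrow> to_fract (a * d) = to_fract (c * b)"
    using assms by (simp add: frac_eq_eq)
  then show ?thesis by (simp only: to_fract_eq_iff)
qed

lemma to_fract_power: "to_fract (a ^ n) = to_fract a ^ n"
  by (induction n) auto

lemma irreducible_poly_degree: "irreducible p \<Longrightarrow> degree p > 0" for p :: "'k::field poly"
  using is_unit_iff_degree[of p] by (auto simp: irreducible_def)

lemma poly_prime_power_decomposition:
  fixes p a :: "'k::field poly"
  assumes "irreducible p" "a \<noteq> 0"
  shows "\<exists>i b. a = p ^ i * b \<and> \<not> p dvd b"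
  using assms(2)
proof (induction "degree a" arbitrary: a rule: less_induct)
  case less
  show ?case
  proof (cases "p dvd a")
    case True
    then obtain b where b: "a = p * b" by auto
    then have "degree b < degree a" "b \<noteq> 0"
      using less.prems irreducible_poly_degree[OF assms(1)] by (auto simp: degree_mult_eq)
    then obtain i c where "b = p ^ i * c" "\<not> p dvd c" using less.hyps by blast
    then show ?thesis using b by (intro exI[of _ "Suc i"] exI[of _ c]) auto
  next
    case False
    then show ?thesis by (intro exI[of _ 0] exI[of _ a]) auto
  qed
qed

lemma finite_place:
  fixes p :: "'k::field poly"
  assumes p: "irreducible p"
  shows "finite_place p \<in> places rat_const"
    and "z \<in> place_ring (finite_place p) \<longleftrightarrow> (\<exists>a b. \<not> p dvd b \<and> z = to_fract a / to_fract b)"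
proof -
  have prime: "prime_elem p" using p by (rule field_poly_irreducible_imp_prime)
  have nz: "p \<noteq> 0" "degree p > 0" using irreducible_poly_degree[OF p] by auto
  define R where "R = {to_fract a / to_fract b | a b. \<not> p dvd b}"
  have RI: "to_fract a / to_fract b \<in> R" if "\<not> p dvd b" for a b using that unfolding R_def by blast
  have inv: "inverse z \<notin> R \<longleftrightarrow> z \<in> finite_place p \<and> z \<noteq> 0" for z
  proof (cases z rule: fract_cases)
    case (1 a b)
    show ?thesis
    proof (cases "a = 0")
      case True
      then show ?thesis using 1 RI[of 1 0] nz by (simp add: prime_elem_imp_nonzero prime prime_elem_not_unit)
    next
      case False
      obtain i a' where a: "a = p ^ i * a'" "\<not> p dvd a'" using poly_prime_power_decomposition[OF p False] by blast
      obtain j b' where b: "b = p ^ j * b'" "\<not> p dvd b'" using poly_prime_power_decomposition[OF p 1(1)] by blast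
      have nz': "a' \<noteq> 0" "b' \<noteq> 0" using a b by auto
      have inR: "inverse z \<in> R" if "i \<le> j"
      proof -
        have "b * a' = p ^ (j - i) * b' * a"
          using a b that by (simp add: algebra_simps flip: power_add)
        then have "inverse z = to_fract (p ^ (j - i) * b') / to_fract a'"
          using 1 False nz' to_fract_divide_eq_iff[OF False nz'(1), of b "p ^ (j - i) * b'"] by simp
        then show ?thesis using RI a by metis
      qed
      have inP: "z \<in> finite_place p" if "i > j"
      proof -
        have "a * b' = p ^ (i - j) * a' * b"
          using a b that by (simp add: algebra_simps flip: power_add)
        then have "z = to_fract (p ^ (i - j) * a') / to_fract b'"
          using 1 to_fract_divide_eq_iff[OF 1(1) nz'(2), of a "p ^ (i - j) * a'"] by simp
        moreover have "p dvd p ^ (i - j) * a'" using that by (simp add: dvd_mult2)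
        ultimately show ?thesis using finite_placeI b by metis
      qed
      have "\<not> (inverse z \<in> R \<and> z \<in> finite_place p)"
      proof
        assume "inverse z \<in> R \<and> z \<in> finite_place p"
        then obtain c d c' d' where *: "inverse z = to_fract c / to_fract d" "\<not> p dvd d"
            "z = to_fract c' / to_fract d'" "p dvd c'" "\<not> p dvd d'"
          unfolding R_def finite_place_def by blast
        have nz2: "c' \<noteq> 0" "d' \<noteq> 0" "d \<noteq> 0" using * 1 False by auto
        have "to_fract d' / to_fract c' = to_fract c / to_fract d" using * by (metis inverse_divide)
        then have "d' * d = c * c'" using to_fract_divide_eq_iff[OF nz2(1,3)] by blast
        then have "p dvd d' * d" using * by simp
        then show False using * prime by (simp add: prime_elem_dvd_mult_iff)
      qed
      then show ?thesis using inR inP 1 False by (cases "i \<le> j") auto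
    qed
  qed
  have "valuation_ring rat_const R"
    unfolding valuation_ring_def
  proof (intro conjI ballI allI)
    fix x y assume "x \<in> R" "y \<in> R"
    then obtain a b c d where *: "x = to_fract a / to_fract b" "\<not> p dvd b" "y = to_fract c / to_fract d" "\<not> p dvd d"
      unfolding R_def by blast
    have nd: "\<not> p dvd b * d" using * prime by (simp add: prime_elem_dvd_mult_iff)
    have bd: "b \<noteq> 0" "d \<noteq> 0" using * by auto
    have "x - y = to_fract (a * d - c * b) / to_fract (b * d)"
      using * bd by (simp add: diff_frac_eq)
    then show "x - y \<in> R" using RI[OF nd] by metis
    have "x * y = to_fract (a * c) / to_fract (b * d)" using * by simp
    then show "x * y \<in> R" using RI[OF nd] by metis
  next
    fix z show "z \<in> R \<or> inverse z \<in> R"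
    proof (cases "inverse z \<in> R")
      case False
      then have "z \<in> finite_place p" using inv by blast
      then show ?thesis unfolding finite_place_def R_def by blast
    qed simp
  next
    have one: "\<not> p dvd 1" using nz by (simp add: prime prime_elem_not_unit)
    have "rat_const c \<in> R" for c using RI[OF one, of "[:c:]"] by (simp add: rat_const_def)
    moreover have "to_fract p \<in> R" using RI[OF one, of p] by simp
    moreover have "to_fract p \<noteq> rat_const c" for c
      using nz by (auto simp: rat_const_def)
    ultimately show "range rat_const \<subset> R" by blast
    have "inverse (to_fract p) \<notin> R"
    proof -
      have "to_fract p / to_fract 1 \<in> finite_place p" using finite_placeI[OF dvd_refl one] .
      then show ?thesis using inv[of "to_fract p"] nz by simp
    qed
    then show "R \<subset> UNIV" by blast
  qed
  moreover have "z \<in> finite_place p \<longleftrightarrow> z = 0 \<or> inverse z \<notin> R" for z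
  proof -
    have "\<not> p dvd 1" using prime by (simp add: prime_elem_not_unit)
    then have "0 \<in> finite_place p" using finite_placeI[of p 0 1] by simp
    then show ?thesis using inv[of z] by auto
  qed
  ultimately have *: "finite_place p \<in> places rat_const" "place_ring (finite_place p) = R"
    using placesI by blast+
  show "finite_place p \<in> places rat_const" by (fact *)
  show "z \<in> place_ring (finite_place p) \<longleftrightarrow> (\<exists>a b. \<not> p dvd b \<and> z = to_fract a / to_fract b)"
    unfolding *(2) R_def by blast
qed

lemma val_finite_place:
  fixes p :: "'k::field poly"
  assumes p: "irreducible p"
  shows "discrete_place (finite_place p)"
    and "val (finite_place p) (to_fract p) = 1"
    and "\<not> p dvd a \<Longrightarrow> val (finite_place p) (to_fract a) = 0"
proof -
  let ?R = "place_ring (finite_place p)"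
  interpret R: valuation_subring ?R by (rule placesD(2)[OF finite_place(1)[OF p]])
  have prime: "prime_elem p" using p by (rule field_poly_irreducible_imp_prime)
  have one: "\<not> p dvd 1" using prime by (simp add: prime_elem_not_unit)
  have RI: "to_fract a / to_fract b \<in> ?R" if "\<not> p dvd b" for a b
    using that finite_place(2)[OF p] by blast
  have unit: "to_fract a / to_fract b \<in> ring_units ?R" if "\<not> p dvd a" "\<not> p dvd b" for a b
    using RI[OF that(1), of b] RI[OF that(2), of a] that by (auto simp: R.ring_units_iff)
  have tP: "to_fract p \<in> finite_place p"
    using finite_placeI[OF dvd_refl one] by simp
  have t0: "to_fract p \<noteq> 0" using prime by auto
  have decomp: "\<forall>z. z \<noteq> 0 \<longrightarrow> (\<exists>k u. u \<in> ring_units ?R \<and> z = to_fract p powi k * u)"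
  proof (intro allI impI)
    fix z :: "'k poly fract" assume z: "z \<noteq> 0"
    show "\<exists>k u. u \<in> ring_units ?R \<and> z = to_fract p powi k * u"
    proof (cases z rule: fract_cases)
    case (1 a b)
    then have "a \<noteq> 0" using z by auto
    obtain i a' where a: "a = p ^ i * a'" "\<not> p dvd a'" using poly_prime_power_decomposition[OF p \<open>a \<noteq> 0\<close>] by blast
    obtain j b' where b: "b = p ^ j * b'" "\<not> p dvd b'" using poly_prime_power_decomposition[OF p 1(1)] by blast
    have "z = to_fract p powi (int i - int j) * (to_fract a' / to_fract b')"
      using a b 1 t0 by (simp add: power_int_diff to_fract_power)
    then show ?thesis using unit a b by blast
    qed
  qed
  note * = discrete_place_of_prime[OF finite_place(1)[OF p] tP t0, OF decomp]
  show "discrete_place (finite_place p)" by (rule *(1))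
  show "val (finite_place p) (to_fract p) = 1" using *(2)[OF unit[OF one one], of 1] by simp
  show "val (finite_place p) (to_fract a) = 0" if "\<not> p dvd a" using *(2)[OF unit[OF that one], of 0] by simp
qed

lemma infinite_place:
  shows "(infinite_place :: 'k::field poly fract set) \<in> places rat_const"
    and "z \<in> place_ring infinite_place \<longleftrightarrow>
      (\<exists>a b. b \<noteq> 0 \<and> degree a \<le> degree b \<and> z = to_fract a / to_fract (b :: 'k poly))"
proof -
  define R where "R = {to_fract a / to_fract b | a b :: 'k poly. b \<noteq> 0 \<and> degree a \<le> degree b}"
  have RI: "to_fract a / to_fract b \<in> R" if "b \<noteq> 0" "degree a \<le> degree b" for a b
    using that unfolding R_def by blast
  have inv: "z = 0 \<or> inverse z \<notin> R \<longleftrightarrow> z \<in> infinite_place" for z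
  proof (cases z rule: fract_cases)
    case (1 a b)
    show ?thesis
    proof (cases "a = 0")
      case True
      then show ?thesis using 1 infinite_placeI[of 1 0] by simp
    next
      case False
      have "inverse z \<notin> R \<longleftrightarrow> z \<in> infinite_place"
      proof
        assume "inverse z \<notin> R"
        then have "\<not> degree b \<le> degree a" using RI[of a b] 1 False by auto
        then show "z \<in> infinite_place" using 1 infinite_placeI[of b a] by simp
      next
        assume "z \<in> infinite_place"
        then obtain c d where cd1: "z = to_fract c / to_fract d" "d \<noteq> 0" "c = 0 \<or> degree c < degree d"
          unfolding infinite_place_def by blast
        moreover have "z \<noteq> 0" using 1 False by simp
        ultimately have cd: "z = to_fract c / to_fract d" "d \<noteq> 0" "c \<noteq> 0" "degree c < degree d"
          by auto
        show "inverse z \<notin> R"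
        proof
          assume "inverse z \<in> R"
          then obtain c' d' where cd': "inverse z = to_fract c' / to_fract d'" "d' \<noteq> 0" "degree c' \<le> degree d'"
            unfolding R_def by auto
          have "to_fract d / to_fract c = to_fract c' / to_fract d'" using cd cd' by (metis inverse_divide)
          then have eq: "d * d' = c' * c" using to_fract_divide_eq_iff[OF cd(3) cd'(2)] by blast
          then have "c' \<noteq> 0" using cd cd' by auto
          then have "degree d + degree d' = degree c' + degree c"
            using arg_cong[OF eq, of degree] cd cd' by (simp add: degree_mult_eq)
          then show False using cd cd' by simp
        qed
      qed
      then show ?thesis using 1 False by simp
    qed
  qed
  have "valuation_ring rat_const R"
    unfolding valuation_ring_def
  proof (intro conjI ballI allI)
    fix x y assume "x \<in> R" "y \<in> R"
    then obtain a b c d where *: "x = to_fract a / to_fract b" "b \<noteq> 0" "degree a \<le> degree b"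
        "y = to_fract c / to_fract d" "d \<noteq> 0" "degree c \<le> degree d"
      unfolding R_def by auto
    have "degree (a * d) \<le> degree b + degree d" "degree (c * b) \<le> degree b + degree d"
      "degree (a * c) \<le> degree b + degree d"
      using * degree_mult_le[of a d] degree_mult_le[of c b] degree_mult_le[of a c] by linarith+
    then have deg: "degree (a * d - c * b) \<le> degree (b * d)" "degree (a * c) \<le> degree (b * d)"
      using * by (auto simp: degree_mult_eq intro: degree_diff_le)
    have "x - y = to_fract (a * d - c * b) / to_fract (b * d)"
      using * by (simp add: diff_frac_eq)
    then show "x - y \<in> R" using RI[OF _ deg(1)] * by simp
    have "x * y = to_fract (a * c) / to_fract (b * d)" using * by simp
    then show "x * y \<in> R" using RI[OF _ deg(2)] * by simp
  next
    fix z show "z \<in> R \<or> inverse z \<in> R"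
    proof (cases "inverse z \<in> R")
      case False
      then have "z \<in> infinite_place" using inv by blast
      then show ?thesis unfolding infinite_place_def R_def by fastforce
    qed simp
  next
    have "rat_const c \<in> R" for c using RI[of 1 "[:c:]"] by (simp add: rat_const_def)
    moreover have "inverse ratX \<in> R" using RI[of "[:0, 1:]" 1] by (simp add: divide_inverse)
    moreover have "inverse ratX \<noteq> rat_const c" for c :: 'k
    proof
      assume "inverse ratX = rat_const c"
      then have "to_fract 1 / ratX = to_fract [:c:] / to_fract (1 :: 'k poly)"
        by (simp add: rat_const_def divide_inverse)
      then show False by (subst (asm) to_fract_divide_eq_iff) (auto simp: one_pCons)
    qed
    ultimately show "range rat_const \<subset> R" by blast
    have "inverse ratX \<in> (infinite_place :: 'k poly fract set)"
      using infinite_placeI[of "[:0, 1:]" 1] by (simp add: divide_inverse)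
    then have "ratX \<notin> R" using inv[of "inverse ratX"] by simp
    then show "R \<subset> UNIV" by blast
  qed
  then have *: "(infinite_place :: 'k poly fract set) \<in> places rat_const" "place_ring infinite_place = R"
    using placesI[of rat_const R infinite_place] inv by blast+
  show "(infinite_place :: 'k poly fract set) \<in> places rat_const" by (fact *)
  show "z \<in> place_ring infinite_place \<longleftrightarrow>
      (\<exists>a b. b \<noteq> 0 \<and> degree a \<le> degree b \<and> z = to_fract a / to_fract (b :: 'k poly))"
    unfolding *(2) R_def by blast
qed

lemma val_infinite_place:
  shows "discrete_place (infinite_place :: 'k::field poly fract set)"
    and "a \<noteq> 0 \<Longrightarrow> val infinite_place (to_fract (a :: 'k poly)) = - int (degree a)"
proof -
  let ?P = "infinite_place :: 'k poly fract set"
  let ?R = "place_ring ?P"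
  interpret R: valuation_subring ?R by (rule placesD(2)[OF infinite_place(1)])
  have unit: "to_fract a / to_fract b \<in> ring_units ?R" if "a \<noteq> 0" "b \<noteq> 0" "degree a = degree b" for a b :: "'k poly"
  proof -
    have "to_fract a / to_fract b \<in> ?R" "to_fract b / to_fract a \<in> ?R"
      using infinite_place(2)[of "to_fract a / to_fract b"] infinite_place(2)[of "to_fract b / to_fract a"]
        that by (metis order_refl)+
    then show ?thesis using that by (auto simp: R.ring_units_iff)
  qed
  have tP: "inverse ratX \<in> ?P"
    using infinite_placeI[of "[:0, 1:]" 1] by (simp add: divide_inverse)
  have t0: "inverse ratX \<noteq> (0 :: 'k poly fract)" by simp
  have decomp1: "\<exists>u. u \<in> ring_units ?R \<and>
      to_fract a / to_fract b = inverse ratX powi (int (degree b) - int (degree a)) * u"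
    if "a \<noteq> 0" "b \<noteq> 0" for a b :: "'k poly"
  proof (intro exI conjI)
    let ?X = "[:0, 1:] :: 'k poly"
    show "to_fract (a * ?X ^ degree b) / to_fract (b * ?X ^ degree a) \<in> ring_units ?R"
      using that by (intro unit) (auto simp: degree_mult_eq degree_power_eq)
    show "to_fract a / to_fract b = inverse ratX powi (int (degree b) - int (degree a)) *
        (to_fract (a * ?X ^ degree b) / to_fract (b * ?X ^ degree a))"
      using that by (simp add: power_int_diff to_fract_power field_simps)
  qed
  have decomp: "\<forall>z. z \<noteq> 0 \<longrightarrow> (\<exists>k u. u \<in> ring_units ?R \<and> z = inverse ratX powi k * u)"
  proof (intro allI impI)
    fix z :: "'k poly fract" assume z: "z \<noteq> 0"
    show "\<exists>k u. u \<in> ring_units ?R \<and> z = inverse ratX powi k * u"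
    proof (cases z rule: fract_cases)
    case (1 a b)
    then have "a \<noteq> 0" using z by auto
    then show ?thesis using decomp1[OF _ 1(1)] 1 by blast
    qed
  qed
  note * = discrete_place_of_prime[OF infinite_place(1) tP t0 decomp]
  show "discrete_place ?P" by (rule *(1))
  show "val ?P (to_fract a) = - int (degree a)" if a: "a \<noteq> 0" for a
  proof -
    obtain u where "u \<in> ring_units ?R"
        "to_fract a / to_fract 1 = inverse ratX powi (int (degree (1 :: 'k poly)) - int (degree a)) * u"
      using decomp1[OF a, of 1] by auto
    then show ?thesis using *(2)[of u "- int (degree a)"] by simp
  qed
qed

text \<open>If \<^term>\<open>ratX\<close> is regular, then so are all polynomials, and those in the place are the multiples of
  one of least degree. Otherwise \<open>1 / ratX\<close> lies in the place, and a polynomial of degree \<open>n\<close>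
  divided by \<open>ratX ^ n\<close> is congruent to its leading coefficient. Either way the ring contains the
  ring of a known discrete place, which is maximal.\<close>

lemma rational_function_field_places:
  fixes P :: "'k::field poly fract set"
  assumes P: "P \<in> places rat_const"
  shows "P = infinite_place \<or> (\<exists>p. irreducible p \<and> P = finite_place p)"
proof -
  let ?R = "place_ring P"
  interpret R: valuation_subring ?R by (rule placesD(2)[OF P])
  have ring: "valuation_ring rat_const ?R" by (rule placesD(1)[OF P])
  have neq: "?R \<noteq> UNIV" using ring by (simp add: valuation_ring_iff)
  have const: "rat_const c \<in> ?R" for c using ring by (auto simp: valuation_ring_iff)
  note mem = placesD(3)[OF P]
  have poly_in: "to_fract g \<in> ?R" if X: "ratX \<in> ?R" for g
  proof (induction g)
    case 0
    then show ?case by (simp add: R.zero)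
  next
    case (pCons a g)
    have "pCons a g = [:a:] + [:0, 1:] * g" by simp
    then have "to_fract (pCons a g) = rat_const a + ratX * to_fract g"
      unfolding rat_const_def by (metis to_fract_add to_fract_mult)
    then show ?case using pCons X const by (simp add: R.add R.mult)
  qed
  show ?thesis
  proof (cases "ratX \<in> ?R")
    case True
    note poly_in = poly_in[OF True]
    define I where "I g \<longleftrightarrow> g \<noteq> 0 \<and> to_fract g \<in> P" for g :: "'k poly"
    have "\<exists>g. I g"
    proof (rule ccontr)
      assume no: "\<nexists>g. I g"
      have "z \<in> ?R" for z
      proof (cases z rule: fract_cases)
        case (1 a b)
        then have "inverse (to_fract b) \<in> ?R" using no mem[of "to_fract b"] by (auto simp: I_def)
        then show ?thesis using 1 poly_in by (simp add: divide_inverse R.mult)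
      qed
      then show False using neq by auto
    qed
    then obtain p where p: "I p" "\<And>g. I g \<Longrightarrow> degree p \<le> degree g"
      using ex_has_least_nat[of I _ degree] by metis
    have p0: "p \<noteq> 0" and pP: "inverse (to_fract p) \<notin> ?R" using p mem[of "to_fract p"] by (auto simp: I_def)
    have dvdI: "p dvd g" if g: "to_fract g \<in> P" for g
    proof (rule ccontr)
      assume ndvd: "\<not> p dvd g"
      then have r0: "g mod p \<noteq> 0" by (simp add: mod_eq_0_iff_dvd)
      have "to_fract g - to_fract p * to_fract (g div p) \<in> P"
        using p(1) poly_in by (intro place_diff[OF P g] place_mult[OF P]) (auto simp: I_def)
      then have "to_fract (g mod p) \<in> P"
        unfolding minus_mult_div_eq_mod[symmetric] by simp
      then have "degree p \<le> degree (g mod p)" using p(2) r0 by (simp add: I_def)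
      moreover have "degree (g mod p) < degree p" using degree_mod_less[OF p0, of g] r0 by simp
      ultimately show False by simp
    qed
    have "irreducible p"
    proof (rule irreducibleI)
      show "p \<noteq> 0" by (fact p0)
      show "\<not> p dvd 1"
      proof
        assume "p dvd 1"
        then obtain g where "1 = p * g" by auto
        then have "to_fract p * to_fract g = 1" by (metis to_fract_1 to_fract_mult)
        then have "to_fract g = inverse (to_fract p)" by (simp add: inverse_unique)
        then show False using pP poly_in[of g] by simp
      qed
    next
      fix a b assume ab: "p = a * b"
      have "to_fract a \<in> P \<or> to_fract b \<in> P"
      proof (rule ccontr)
        assume "\<not> ?thesis"
        then have "inverse (to_fract a) * inverse (to_fract b) \<in> ?R"
          using mem[of "to_fract a"] mem[of "to_fract b"] by (auto intro: R.mult)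
        then show False using pP ab by simp
      qed
      then have "p dvd a \<or> p dvd b" using dvdI by blast
      then show "a dvd 1 \<or> b dvd 1"
        using ab p0 by (metis dvd_mult_cancel_left dvd_mult_cancel_right mult.right_neutral mult.left_neutral)
    qed
    moreover have "place_ring (finite_place p) \<subseteq> ?R"
    proof
      fix z assume "z \<in> place_ring (finite_place p)"
      then obtain a b where ab: "\<not> p dvd b" "z = to_fract a / to_fract b"
        using finite_place(2)[OF \<open>irreducible p\<close>] by blast
      then have "to_fract b \<notin> P" using dvdI by blast
      then have "inverse (to_fract b) \<in> ?R" using mem by blast
      then show "z \<in> ?R" using ab poly_in by (simp add: divide_inverse R.mult)
    qed
    ultimately have "P = finite_place p"
      using discrete_place.place_ring_maximal[OF val_finite_place(1) _ R.valuation_subring_axioms neq]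
        place_eqI[OF P finite_place(1)] by metis
    then show ?thesis using \<open>irreducible p\<close> by blast
  next
    case False
    let ?T = "inverse ratX :: 'k poly fract"
    have T: "?T \<in> ?R" using R.total[of ratX] False by blast
    have poly_T: "\<exists>w\<in>?R. to_fract g * ?T ^ n = rat_const (coeff g n) + ?T * w" if "degree g \<le> n" for g n
      using that
    proof (induction g arbitrary: n)
      case 0
      then show ?case by (auto intro!: bexI[of _ 0] R.zero simp: rat_const_def)
    next
      case (pCons a g)
      have eq: "to_fract (pCons a g) = rat_const a + ratX * to_fract g"
      proof -
        have "pCons a g = [:a:] + [:0, 1:] * g" by simp
        then show ?thesis unfolding rat_const_def by (metis to_fract_add to_fract_mult)
      qed
      show ?case
      proof (cases n)
        case 0
        then have "g = 0" using pCons.prems by (cases "g = 0") auto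
        then show ?thesis using eq 0 by (auto intro!: bexI[of _ 0] R.zero)
      next
        case (Suc k)
        then have "degree g \<le> k" using pCons.prems by (cases "g = 0") auto
        then obtain w where w: "w \<in> ?R" "to_fract g * ?T ^ k = rat_const (coeff g k) + ?T * w"
          using pCons.IH by blast
        have "to_fract (pCons a g) * ?T ^ n = ?T * (rat_const a * ?T ^ k) + (ratX * ?T) * (to_fract g * ?T ^ k)"
          unfolding eq Suc by (simp add: algebra_simps)
        also have "\<dots> = rat_const (coeff (pCons a g) n) + ?T * (rat_const a * ?T ^ k + w)"
          using w Suc by (simp add: algebra_simps)
        finally show ?thesis
          using R.add[OF R.mult[OF const[of a] R.power[OF T, of k]] w(1)] by blast
      qed
    qed
    have "place_ring infinite_place \<subseteq> ?R"
    proof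
      fix z assume "z \<in> place_ring (infinite_place :: 'k poly fract set)"
      then obtain a b where ab: "b \<noteq> 0" "degree a \<le> degree b" "z = to_fract a / to_fract b"
        using infinite_place(2) by blast
      let ?n = "degree b"
      obtain w where w: "w \<in> ?R" "to_fract a * ?T ^ ?n = rat_const (coeff a ?n) + ?T * w"
        using poly_T ab by blast
      obtain v where v: "v \<in> ?R" "to_fract b * ?T ^ ?n = rat_const (coeff b ?n) + ?T * v"
        using poly_T by blast
      let ?c = "rat_const (inverse (coeff b ?n))"
      have c: "?c * rat_const (coeff b ?n) = 1" using ab
        by (simp add: rat_const_def flip: to_fract_mult) (simp flip: one_pCons)
      let ?u = "1 + ?T * v * ?c"
      have u: "?u = to_fract b * ?T ^ ?n * ?c" using v c by (simp add: algebra_simps)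
      then have u0: "?u \<noteq> 0" using ab by (auto simp: rat_const_def)
      have "inverse ?u \<in> ?R"
      proof (rule ccontr)
        assume nu: "inverse ?u \<notin> ?R"
        then have "?u \<in> P" using mem by blast
        moreover have "?T * (v * ?c) \<in> P"
          using mem[of ?T] False v const by (intro place_mult[OF P] R.mult) auto
        ultimately have "?u - ?T * (v * ?c) \<in> P" by (rule place_diff[OF P])
        then show False using one_not_in_place[OF P] by (simp add: mult.assoc)
      qed
      then have "(rat_const (coeff a ?n) + ?T * w) * ?c * inverse ?u \<in> ?R"
        using w T const by (intro R.mult R.add)
      moreover have "(rat_const (coeff a ?n) + ?T * w) * ?c * inverse ?u = z"
      proof -
        have "?c \<noteq> 0" using c by auto
        moreover have "x * t * c * inverse (y * t * c) = x / y" if "c \<noteq> 0" "t \<noteq> 0" for x y t c :: "'k poly fract"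
          using that by (simp add: divide_simps)
        moreover have "?T ^ ?n \<noteq> 0" by simp
        ultimately show ?thesis unfolding u w(2)[symmetric] ab(3) by blast
      qed
      ultimately show "z \<in> ?R" by simp
    qed
    then have "P = infinite_place"
      using discrete_place.place_ring_maximal[OF val_infinite_place(1) _ R.valuation_subring_axioms neq]
        place_eqI[OF P infinite_place(1)] by metis
    then show ?thesis by blast
  qed
qed

lemma discrete_place_rational_function_field:
  "P \<in> places (rat_const :: 'k::field \<Rightarrow> _) \<Longrightarrow> discrete_place P"
  using rational_function_field_places val_finite_place(1) val_infinite_place(1) by blast

abbreviation linear_place :: "'k::field \<Rightarrow> 'k poly fract set" where
  "linear_place c \<equiv> finite_place [:- c, 1:]"

lemma linear_place_residue:
  assumes "z \<in> place_ring (linear_place c)"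
  shows "\<exists>k. z - rat_const k \<in> linear_place c"
proof -
  have irr: "irreducible [:- c, 1:]" by (rule irreducible_linear_field_poly) simp
  obtain a b where ab: "\<not> [:- c, 1:] dvd b" "z = to_fract a / to_fract b"
    using assms finite_place(2)[OF irr] by blast
  then have b: "poly b c \<noteq> 0" "b \<noteq> 0" by (auto simp: poly_eq_0_iff_dvd)
  let ?k = "poly a c / poly b c"
  have "[:- c, 1:] dvd a - smult ?k b"
    using b by (simp flip: poly_eq_0_iff_dvd)
  then have "to_fract (a - smult ?k b) / to_fract b \<in> linear_place c" using ab finite_placeI by blast
  moreover have "to_fract (smult ?k b) = rat_const ?k * to_fract b"
    unfolding rat_const_def by (simp flip: to_fract_mult)
  then have "to_fract (a - smult ?k b) / to_fract b = z - rat_const ?k"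
    using ab b by (simp add: diff_divide_distrib)
  ultimately show ?thesis by metis
qed

lemma infinite_place_residue:
  assumes "z \<in> place_ring infinite_place"
  shows "\<exists>k. z - rat_const k \<in> infinite_place"
proof -
  obtain a b where ab: "b \<noteq> 0" "degree a \<le> degree b" "z = to_fract a / to_fract b"
    using assms infinite_place(2) by blast
  let ?k = "coeff a (degree b) / lead_coeff b"
  let ?g = "a - smult ?k b"
  have "degree ?g \<le> degree b" using ab by (intro degree_diff_le) auto
  moreover have "coeff ?g (degree b) = 0" using ab by simp
  ultimately have "?g = 0 \<or> degree ?g < degree b"
    by (metis eq_zero_or_degree_less)
  then have "to_fract ?g / to_fract b \<in> infinite_place" using ab by (intro infinite_placeI)
  moreover have "to_fract (smult ?k b) = rat_const ?k * to_fract b"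
    unfolding rat_const_def by (simp flip: to_fract_mult)
  then have "to_fract ?g / to_fract b = z - rat_const ?k"
    using ab by (simp add: diff_divide_distrib)
  ultimately show ?thesis by metis
qed

lemma ex_irreducible_divisor:
  fixes b :: "'k::field poly"
  assumes "b \<noteq> 0" "degree b > 0"
  shows "\<exists>p. irreducible p \<and> p dvd b"
  using assms
proof (induction "degree b" arbitrary: b rule: less_induct)
  case less
  show ?case
  proof (cases "irreducible b")
    case False
    then obtain c d where cd: "b = c * d" "\<not> c dvd 1" "\<not> d dvd 1"
      using less.prems by (auto simp: irreducible_def is_unit_iff_degree)
    then have "c \<noteq> 0" "d \<noteq> 0" using less.prems by auto
    then have "degree c > 0" "degree d > 0" using cd by (auto simp: is_unit_iff_degree)
    then have "degree c < degree b" using cd \<open>c \<noteq> 0\<close> \<open>d \<noteq> 0\<close> by (simp add: degree_mult_eq)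
    then show ?thesis using less.hyps[of c] \<open>c \<noteq> 0\<close> \<open>degree c > 0\<close> cd by (meson dvd_mult2)
  qed auto
qed

text \<open>A denominator of minimal degree is prime to the numerator, so a nonconstant one would give a pole
  at each of its irreducible divisors.\<close>

lemma integral_at_finite_places_imp_poly:
  fixes z :: "'k::field poly fract"
  assumes "\<And>p. irreducible p \<Longrightarrow> z \<in> place_ring (finite_place p)"
  shows "\<exists>g. z = to_fract g"
proof -
  define D where "D b \<longleftrightarrow> b \<noteq> 0 \<and> (\<exists>a. z = to_fract a / to_fract b)" for b :: "'k poly"
  have "\<exists>b. D b" by (cases z rule: fract_cases) (auto simp: D_def)
  then obtain b where b: "D b" "\<And>c. D c \<Longrightarrow> degree b \<le> degree c"
    using ex_has_least_nat[of D _ degree] by metis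
  then obtain a where b0: "b \<noteq> 0" and a: "z = to_fract a / to_fract b" by (auto simp: D_def)
  have "degree b = 0"
  proof (rule ccontr)
    assume "degree b \<noteq> 0"
    then obtain p where p: "irreducible p" "p dvd b" using ex_irreducible_divisor b0 by blast
    obtain c d where cd: "\<not> p dvd d" "z = to_fract c / to_fract d"
      using assms[OF p(1)] finite_place(2)[OF p(1)] by blast
    then have "d \<noteq> 0" by auto
    then have eq: "a * d = c * b" using cd a b0 to_fract_divide_eq_iff by metis
    then have "p dvd a * d" using p by simp
    then have "p dvd a"
      using cd field_poly_irreducible_imp_prime[OF p(1)] by (simp add: prime_elem_dvd_mult_iff)
    then obtain a' b' where ab': "a = p * a'" "b = p * b'" using p(2) by (elim dvdE)
    then have "b' \<noteq> 0" "p \<noteq> 0" using b0 by auto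
    then have "z = to_fract a' / to_fract b'" using a ab' by simp
    then have "degree b \<le> degree b'" using b(2) \<open>b' \<noteq> 0\<close> by (auto simp: D_def)
    then show False using ab' \<open>b' \<noteq> 0\<close> \<open>p \<noteq> 0\<close> irreducible_poly_degree[OF p(1)] by (simp add: degree_mult_eq)
  qed
  then obtain c where c: "b = [:c:]" by (auto elim: degree_eq_zeroE)
  have "z = to_fract (smult (inverse c) a)"
  proof -
    have "a = smult (inverse c) a * b" using c b0 by simp
    then have "to_fract a = to_fract (smult (inverse c) a) * to_fract b" by (metis to_fract_mult)
    then show ?thesis using a b0 by (simp add: divide_eq_eq)
  qed
  then show ?thesis by blast
qed

lemma finite_place_eqI:
  fixes p q :: "'k::field poly"
  assumes p: "irreducible p" and q: "irreducible q" and dvd: "p dvd q"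
  shows "finite_place p = finite_place q"
proof -
  obtain r where r: "q = p * r" using dvd by auto
  have "\<not> p dvd 1" using p by (auto simp: irreducible_def)
  then have "r dvd 1" using q r by (auto simp: irreducible_def)
  then have "p dvd b \<longleftrightarrow> q dvd b" for b unfolding r by (simp add: mult_unit_dvd_iff)
  then show ?thesis unfolding finite_place_def by simp
qed

lemma val_linear_place:
  fixes c d :: "'k::field"
  shows "val (linear_place c) (to_fract [:- d, 1:]) = (if c = d then 1 else 0)"
proof -
  have irr: "irreducible [:- c, 1:]" by (rule irreducible_linear_field_poly) simp
  have "\<not> [:- c, 1:] dvd [:- d, 1:]" if "c \<noteq> d"
    using that by (simp flip: poly_eq_0_iff_dvd)
  then show ?thesis using val_finite_place(2,3)[OF irr] by auto
qed

text \<open>On the projective line every divisor supported on rational places is equivalent to a multiple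
  of the place at infinity, whose Riemann--Roch space consists of polynomials of bounded degree.\<close>

lemma riemann_roch_rational_function_field:
  fixes E :: "'k::field poly fract set \<Rightarrow> int"
  assumes C: "finite C"
    and E: "\<And>P. P \<in> places rat_const \<Longrightarrow> P \<noteq> infinite_place \<Longrightarrow> P \<notin> linear_place ` C \<Longrightarrow> E P = 0"
  shows "\<exists>h. h \<noteq> 0 \<and> (\<forall>z. (\<forall>P\<in>places rat_const. z = 0 \<or> val P z + E P \<ge> 0) \<longleftrightarrow>
    (\<exists>g. z = h * to_fract g \<and> (g = 0 \<or> int (degree g) \<le> E infinite_place + (\<Sum>c\<in>C. E (linear_place c)))))"
proof -
  define L where "L c = to_fract [:- c, 1:]" for c :: 'k
  have L0: "L c \<noteq> 0" for c by (simp add: L_def)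
  \<comment> \<open>chosen so that its divisor is minus the finite part of \<^term>\<open>E\<close>\<close>
  define h where "h = (\<Prod>c\<in>C. L c powi (- E (linear_place c)))"
  have h0: "h \<noteq> 0" using C L0 by (simp add: h_def)
  have val_h: "val P h = (\<Sum>c\<in>C. - E (linear_place c) * val P (L c))" if "discrete_place P" for P
  proof -
    have "val P h = (\<Sum>c\<in>C. val P (L c powi (- E (linear_place c))))"
      unfolding h_def using L0 by (intro discrete_place.val_prod[OF that C]) simp
    then show ?thesis using discrete_place.val_powi[OF that L0] by simp
  qed
  have val_h_inf: "val infinite_place h = (\<Sum>c\<in>C. E (linear_place c))"
    by (simp add: val_h[OF val_infinite_place(1)] L_def val_infinite_place(2))
  have val_h_fin: "val (finite_place p) h = - E (finite_place p)" if p: "irreducible p" for p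
  proof (cases "finite_place p \<in> linear_place ` C")
    case True
    then obtain c where c: "c \<in> C" "finite_place p = linear_place c" by blast
    have irr: "irreducible [:- c, 1:]" by (rule irreducible_linear_field_poly) simp
    have "val (linear_place c) h = (\<Sum>d\<in>C. if c = d then - E (linear_place d) else 0)"
      unfolding val_h[OF val_finite_place(1)[OF irr]] L_def val_linear_place
      by (intro sum.cong) auto
    also have "\<dots> = - E (linear_place c)" using c C by (simp add: sum.delta)
    finally show ?thesis using c by simp
  next
    case False
    have inf: "finite_place p \<noteq> infinite_place"
    proof
      assume eq: "finite_place p = infinite_place"
      have "val infinite_place (to_fract p) < 0"
        using irreducible_poly_degree[OF p] val_infinite_place(2)[of p] by fastforce
      then show False using val_finite_place(2)[OF p] eq by simp
    qed
    have "val (finite_place p) (L c) = 0" if c: "c \<in> C" for c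
    proof (rule ccontr)
      have irr: "irreducible [:- c, 1:]" by (rule irreducible_linear_field_poly) simp
      assume "val (finite_place p) (L c) \<noteq> 0"
      then have "p dvd [:- c, 1:]" using val_finite_place(3)[OF p] by (auto simp: L_def)
      then have "finite_place p = linear_place c" by (rule finite_place_eqI[OF p irr])
      then show False using c False by blast
    qed
    then have "val (finite_place p) h = 0" by (simp add: val_h[OF val_finite_place(1)[OF p]])
    moreover have "E (finite_place p) = 0" using E finite_place(1)[OF p] inf False by blast
    ultimately show ?thesis by simp
  qed
  show ?thesis
  proof (intro exI[of _ h] conjI allI h0 iffI)
    fix z assume z: "\<forall>P\<in>places rat_const. z = 0 \<or> val P z + E P \<ge> 0"
    show "\<exists>g. z = h * to_fract g \<and> (g = 0 \<or> int (degree g) \<le> E infinite_place + (\<Sum>c\<in>C. E (linear_place c)))"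
    proof (cases "z = 0")
      case False
      have "z / h \<in> place_ring (finite_place p)" if p: "irreducible p" for p
      proof -
        interpret P: discrete_place "finite_place p" by (rule val_finite_place(1)[OF p])
        show ?thesis using z False h0 finite_place(1)[OF p] val_h_fin[OF p]
          by (auto simp: P.mem_place_ring_iff P.val_divide)
      qed
      then obtain g where g: "z / h = to_fract g" using integral_at_finite_places_imp_poly by blast
      then have zg: "z = h * to_fract g" using h0 by (simp add: field_simps)
      then have g0: "g \<noteq> 0" using False by auto
      have "val infinite_place z = val infinite_place h - int (degree g)"
        using zg h0 g0 discrete_place.val_mult[OF val_infinite_place(1), of h "to_fract g"]
        by (simp add: val_infinite_place(2))
      then show ?thesis using z zg False infinite_place(1) val_h_inf
        by (intro exI[of _ g]) fastforce
    qed (auto intro: exI[of _ 0])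
  next
    fix z assume "\<exists>g. z = h * to_fract g \<and> (g = 0 \<or> int (degree g) \<le> E infinite_place + (\<Sum>c\<in>C. E (linear_place c)))"
    then obtain g where g: "z = h * to_fract g" "g = 0 \<or> int (degree g) \<le> E infinite_place + (\<Sum>c\<in>C. E (linear_place c))"
      by blast
    show "\<forall>P\<in>places rat_const. z = 0 \<or> val P z + E P \<ge> 0"
    proof (intro ballI)
      fix P :: "'k poly fract set" assume P: "P \<in> places rat_const"
      interpret P: discrete_place P by (rule discrete_place_rational_function_field[OF P])
      show "z = 0 \<or> val P z + E P \<ge> 0"
      proof (cases "g = 0")
        case False
        then have val: "val P z = val P h + val P (to_fract g)" using g h0 by (simp add: P.val_mult)
        from rational_function_field_places[OF P] show ?thesis
        proof
          assume "P = infinite_place"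
          then show ?thesis using val val_h_inf val_infinite_place(2)[OF False] g False by auto
        next
          assume "\<exists>p. irreducible p \<and> P = finite_place p"
          then obtain p where p: "irreducible p" "P = finite_place p" by blast
          have "\<not> p dvd 1" using p by (auto simp: irreducible_def)
          then have "to_fract g / to_fract 1 \<in> place_ring P" using p finite_place(2)[OF p(1)] by blast
          then have "val P (to_fract g) \<ge> 0" using False by (simp add: P.mem_place_ring_iff)
          then show ?thesis using val val_h_fin[OF p(1)] p by simp
        qed
      qed (use g in auto)
    qed
  qed
qed

section \<open>Extension of valuation rings\<close>

context subring_of_field
begin

definition adjoin :: "'f \<Rightarrow> 'f set" where
  "adjoin x = {poly p x | p. \<forall>i. coeff p i \<in> A}"

lemma subring_adjoin: "subring_of_field (adjoin x)"
proof
  show "1 \<in> adjoin x"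
    unfolding adjoin_def by (auto intro!: exI[of _ "[:1:]"] simp: coeff_pCons one zero split: nat.split)
  fix a b assume "a \<in> adjoin x" "b \<in> adjoin x"
  then obtain p q where p: "a = poly p x" "\<forall>i. coeff p i \<in> A" and q: "b = poly q x" "\<forall>i. coeff q i \<in> A"
    unfolding adjoin_def by blast
  have "a - b = poly (p - q) x" "\<forall>i. coeff (p - q) i \<in> A" using p q by (auto intro: diff)
  then show "a - b \<in> adjoin x" unfolding adjoin_def by blast
  have "a * b = poly (p * q) x" "\<forall>i. coeff (p * q) i \<in> A" using p q by (auto simp: coeff_mult intro!: sum mult)
  then show "a * b \<in> adjoin x" unfolding adjoin_def by blast
qed

lemma subset_adjoin: "A \<subseteq> adjoin x"
proof
  fix a assume "a \<in> A"
  then have "\<forall>i. coeff [:a:] i \<in> A" by (auto simp: coeff_pCons zero split: nat.split)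
  moreover have "a = poly [:a:] x" by simp
  ultimately show "a \<in> adjoin x" unfolding adjoin_def by blast
qed

lemma mem_adjoin: "x \<in> adjoin x"
proof -
  have "\<forall>i. coeff [:0, 1:] i \<in> A" by (auto simp: coeff_pCons zero one split: nat.split)
  moreover have "x = poly [:0, 1:] x" by simp
  ultimately show ?thesis unfolding adjoin_def by blast
qed

end

text \<open>The reduction step of Chevalley's theorem. Both \<^term>\<open>p\<close> and \<^term>\<open>q\<close> have coefficients in an
  ideal whose elements differ from 1 by units; dividing the relation given by
  \<^term>\<open>q\<close> by \<open>1 - coeff q 0\<close> expresses the leading term of \<^term>\<open>p\<close> through lower powers.\<close>

lemma (in subring_of_field) chevalley_reduction:
  assumes units: "\<And>a. a \<in> A \<Longrightarrow> inverse (1 - s * a) \<in> A"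
    and s: "s \<in> A" "inverse s \<notin> A" and x: "x \<noteq> 0"
    and p: "\<forall>i. coeff p i \<in> (*) s ` A" "poly p x = 1"
    and q: "\<forall>i. coeff q i \<in> (*) s ` A" "poly q (inverse x) = 1"
    and deg: "degree q \<le> degree p"
  shows "\<exists>p'. (\<forall>i. coeff p' i \<in> (*) s ` A) \<and> poly p' x = 1 \<and> degree p' < degree p"
proof -
  let ?I = "(*) s ` A"
  have one_I: "1 \<notin> ?I"
  proof
    assume "1 \<in> ?I"
    then obtain a where "a \<in> A" "s * a = 1" by auto
    then show False using s by (simp add: inverse_unique)
  qed
  have I_diff: "a - b \<in> ?I" if "a \<in> ?I" "b \<in> ?I" for a b
    using that diff by (auto intro!: image_eqI[of _ _ "_ - _"] simp: right_diff_distrib)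
  have I_zero: "0 \<in> ?I" using zero by (auto intro!: image_eqI[of _ _ 0])
  have I_add: "a + b \<in> ?I" if "a \<in> ?I" "b \<in> ?I" for a b
    using I_diff[OF that(1) I_diff[OF I_zero that(2)]] by simp
  have I_mult: "a * b \<in> ?I" if "a \<in> A" "b \<in> ?I" for a b
    using that mult by (auto intro!: image_eqI[of _ _ "a * _"] simp: mult_ac)
  have I_sum: "sum z J \<in> ?I" if "\<And>i. i \<in> J \<Longrightarrow> z i \<in> ?I" for z and J :: "nat set"
    using that by (induction J rule: infinite_finite_induct) (auto intro: I_zero I_add)
  let ?n = "degree p" and ?k = "degree q"
  have n: "?n > 0"
  proof (rule ccontr)
    assume "\<not> ?n > 0"
    then obtain c where "p = [:c:]" by (auto elim: degree_eq_zeroE)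
    then have "c = 1" "coeff p 0 = c" using p by auto
    then show False using p(1) one_I by metis
  qed
  obtain a0 where a0: "a0 \<in> A" "coeff q 0 = s * a0" using q(1) by blast
  obtain an where an: "an \<in> A" "coeff p ?n = s * an" using p(1) by blast
  let ?w = "inverse (1 - coeff q 0)"
  have w: "?w \<in> A" using units a0 by simp
  have q0: "coeff q 0 \<noteq> 1" using one_I q(1) by metis
  have "(\<Sum>j\<le>?k. coeff q j * inverse x ^ j) = 1" using q(2) by (simp add: poly_altdef)
  then have "coeff q 0 + (\<Sum>j\<in>{1..?k}. coeff q j * inverse x ^ j) = 1"
    by (simp add: atMost_atLeast0 sum.atLeast_Suc_atMost)
  then have rel: "(\<Sum>j\<in>{1..?k}. coeff q j * inverse x ^ j) = 1 - coeff q 0" by (simp add: algebra_simps)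
  define h where "h = (\<Sum>j\<in>{1..?k}. monom (coeff p ?n * ?w * coeff q j) (?n - j))"
  have "poly h x = (\<Sum>j\<in>{1..?k}. coeff p ?n * ?w * coeff q j * x ^ (?n - j))"
    by (simp add: h_def poly_sum poly_monom)
  also have "\<dots> = (\<Sum>j\<in>{1..?k}. coeff p ?n * ?w * x ^ ?n * (coeff q j * inverse x ^ j))"
    using deg x by (intro sum.cong) (auto simp: power_diff power_inverse field_simps)
  also have "\<dots> = coeff p ?n * x ^ ?n"
    unfolding sum_distrib_left[symmetric] rel using q0 by simp
  finally have hx: "poly h x = coeff p ?n * x ^ ?n" .
  have h_coeff: "coeff h i \<in> ?I" for i
  proof -
    have "coeff p ?n \<in> A" using an s by (simp add: mult)
    then have "coeff p ?n * ?w * coeff q j \<in> ?I" for j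
      using q(1) w by (intro I_mult mult) auto
    then show ?thesis unfolding h_def by (auto simp: coeff_sum intro!: I_sum I_zero)
  qed
  have h_deg: "degree h < ?n"
    unfolding h_def using n by (intro degree_sum_less) (auto intro: le_less_trans[OF degree_monom_le])
  define p' where "p' = p - monom (coeff p ?n) ?n + h"
  have "poly p' x = 1" by (simp add: p'_def hx p(2) poly_monom)
  moreover have "coeff p' i \<in> ?I" for i
    unfolding p'_def using p(1) h_coeff by (auto intro!: I_add I_diff I_zero)
  moreover have "degree p' < ?n"
  proof -
    have "degree (p - monom (coeff p ?n) ?n) \<le> ?n"
      by (intro degree_diff_le degree_monom_le) simp
    moreover have "coeff (p - monom (coeff p ?n) ?n) ?n = 0" by simp
    ultimately have "degree (p - monom (coeff p ?n) ?n) < ?n"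
      using n by (metis degree_0 eq_zero_or_degree_less)
    then show ?thesis unfolding p'_def using h_deg by (intro degree_add_less)
  qed
  ultimately show ?thesis by blast
qed

text \<open>Chevalley's theorem: among the subrings containing \<^term>\<open>s\<close> in which \<^term>\<open>s\<close> stays
  a non-unit, a maximal one is a valuation ring.\<close>

theorem ex_valuation_subring_avoiding:
  fixes s :: "'f::field"
  assumes A: "subring_of_field A" and s: "s \<in> A" "inverse s \<notin> A"
  shows "\<exists>S. valuation_subring S \<and> A \<subseteq> S \<and> inverse s \<notin> S"
proof -
  define Fam where "Fam = {B. subring_of_field B \<and> A \<subseteq> B \<and> inverse s \<notin> B}"
  have "\<exists>M\<in>Fam. \<forall>B\<in>Fam. M \<subseteq> B \<longrightarrow> B = M"
  proof (rule subset_Zorn_nonempty)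
    show "Fam \<noteq> {}" using A s unfolding Fam_def by blast
    fix \<C> assume \<C>: "\<C> \<noteq> {}" "subset.chain Fam \<C>"
    then have sub: "\<C> \<subseteq> Fam" and lin: "\<And>B B'. B \<in> \<C> \<Longrightarrow> B' \<in> \<C> \<Longrightarrow> B \<subseteq> B' \<or> B' \<subseteq> B"
      by (auto simp: subset.chain_def)
    have "subring_of_field (\<Union>\<C>)"
    proof
      show "1 \<in> \<Union>\<C>" using \<C>(1) sub by (auto simp: Fam_def subring_of_field_def)
      fix a b assume "a \<in> \<Union>\<C>" "b \<in> \<Union>\<C>"
      then obtain B where B: "B \<in> \<C>" "a \<in> B" "b \<in> B" using lin by blast
      then have "subring_of_field B" using sub by (auto simp: Fam_def)
      then have "a - b \<in> B" "a * b \<in> B" using B by (auto simp: subring_of_field_def)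
      then show "a - b \<in> \<Union>\<C>" "a * b \<in> \<Union>\<C>" using B by auto
    qed
    moreover have "A \<subseteq> \<Union>\<C>" using \<C>(1) sub by (auto simp: Fam_def)
    moreover have "inverse s \<notin> \<Union>\<C>" using sub by (auto simp: Fam_def)
    ultimately show "\<Union>\<C> \<in> Fam" by (simp add: Fam_def)
  qed
  then obtain M where M0: "M \<in> Fam" and max0: "\<forall>B\<in>Fam. M \<subseteq> B \<longrightarrow> B = M" ..
  have M: "subring_of_field M" "A \<subseteq> M" "inverse s \<notin> M" using M0 by (simp_all add: Fam_def)
  have max: "B = M" if "subring_of_field B" "A \<subseteq> B" "inverse s \<notin> B" "M \<subseteq> B" for B
    using max0 that by (simp add: Fam_def)
  interpret M: subring_of_field M by (rule M(1))
  have sM: "s \<in> M" and s0: "s \<noteq> 0" using s M M.zero by auto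
  have adjoin: "x \<in> M" if "inverse s \<notin> M.adjoin x" for x
  proof -
    have "M.adjoin x = M"
      using M(2) M.subset_adjoin[of x] that by (intro max M.subring_adjoin) auto
    then show ?thesis using M.mem_adjoin[of x] by simp
  qed
  \<comment> \<open>if adjoining the inverse of \<open>1 - s * a\<close> inverted \<^term>\<open>s\<close>, a power of \<open>1 - s * a\<close> would be a
    multiple of \<^term>\<open>s\<close>, hence so would 1\<close>
  have units: "inverse (1 - s * a) \<in> M" if a: "a \<in> M" for a
  proof (rule adjoin, rule notI)
    let ?u = "1 - s * a"
    assume "inverse s \<in> M.adjoin (inverse ?u)"
    then obtain p where p: "inverse s = poly p (inverse ?u)" "\<forall>i. coeff p i \<in> M"
      unfolding M.adjoin_def by blast
    let ?n = "degree p"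
    have u0: "?u \<noteq> 0"
    proof
      assume "?u = 0"
      then have "inverse s = a" by (simp add: inverse_unique)
      then show False using a M by simp
    qed
    have "?u ^ ?n * inverse s = (\<Sum>i\<le>?n. coeff p i * ?u ^ (?n - i))"
      unfolding p(1) poly_altdef sum_distrib_left
      using u0 by (intro sum.cong) (auto simp: power_diff power_inverse field_simps)
    also have "\<dots> \<in> M" using p(2) a sM by (intro M.sum M.mult M.power M.diff M.one) auto
    finally have 1: "?u ^ ?n * inverse s \<in> M" .
    have "\<exists>c\<in>M. ?u ^ n = 1 - s * c" for n
    proof (induction n)
      case 0
      then show ?case using M.zero by (auto intro!: bexI[of _ 0])
    next
      case (Suc n)
      then obtain c where c: "c \<in> M" "?u ^ n = 1 - s * c" by blast
      have "?u ^ Suc n = 1 - s * (a + c - s * a * c)" 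
        unfolding power_Suc c(2) by (simp add: algebra_simps)
      then show ?case using a c sM by (intro bexI[of _ "a + c - s * a * c"]) (auto intro!: M.add M.diff M.mult)
    qed
    then obtain c where c: "c \<in> M" "?u ^ ?n = 1 - s * c" by blast
    have "?u ^ ?n * inverse s + c = inverse s"
      unfolding c(2) using s0 by (simp add: left_diff_distrib)
    then show False using M.add[OF 1 c(1)] M by simp
  qed
  have "x \<in> M \<or> inverse x \<in> M" for x
  proof (rule ccontr)
    assume no: "\<not> (x \<in> M \<or> inverse x \<in> M)"
    then have x0: "x \<noteq> 0" using M.zero by auto
    define J where "J x p \<longleftrightarrow> (\<forall>i. coeff p i \<in> (*) s ` M) \<and> poly p x = 1" for x p
    have J: "\<exists>p. J x p" if "x \<notin> M" for x
    proof -
      have "inverse s \<in> M.adjoin x" using adjoin that by blast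
      then obtain p where "inverse s = poly p x" "\<forall>i. coeff p i \<in> M" unfolding M.adjoin_def by blast
      then have "J x (smult s p)" using s0 by (auto simp: J_def simp flip: \<open>inverse s = poly p x\<close>)
      then show ?thesis by blast
    qed
    have minJ: "\<exists>p. J x p \<and> (\<forall>q. J x q \<longrightarrow> degree p \<le> degree q)" if "x \<notin> M" for x
      using J[OF that] ex_has_least_nat[of "J x" _ degree] by metis
    obtain p where p: "J x p" "\<And>q. J x q \<Longrightarrow> degree p \<le> degree q" using minJ no by blast
    obtain q where q: "J (inverse x) q" "\<And>p. J (inverse x) p \<Longrightarrow> degree q \<le> degree p" using minJ no by blast
    note reduction = M.chevalley_reduction[of s, OF units sM M(3)]
    show False
    proof (cases "degree q \<le> degree p")
      case True
      then show False using reduction[of x p q] x0 p q unfolding J_def by (meson leD)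
    next
      case False
      then show False using reduction[of "inverse x" q p] x0 p q unfolding J_def
        by (metis inverse_inverse_eq leD nat_le_linear nonzero_imp_inverse_nonzero)
    qed
  qed
  then have "valuation_subring M" by unfold_locales (auto intro: M.diff M.mult)
  then show ?thesis using M by blast
qed

section \<open>Finite extensions\<close>

locale field_hom =
  fixes \<phi> :: "'e::field \<Rightarrow> 'f::field"
  assumes field_embedding: "field_embedding \<phi>"
begin

lemma hom_1 [simp]: "\<phi> 1 = 1" and hom_add: "\<phi> (a + b) = \<phi> a + \<phi> b" and hom_mult: "\<phi> (a * b) = \<phi> a * \<phi> b"
  using field_embedding unfolding field_embedding_def by auto

lemma hom_0 [simp]: "\<phi> 0 = 0" using hom_add[of 0 0] by (metis add_cancel_right_right add_0)

lemma hom_minus: "\<phi> (- a) = - \<phi> a"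
  using hom_add[of a "- a"] by (simp add: eq_neg_iff_add_eq_0 add.commute)

lemma hom_diff: "\<phi> (a - b) = \<phi> a - \<phi> b"
  using hom_add[of a "- b"] by (simp add: hom_minus)

lemma hom_eq_0_iff [simp]: "\<phi> a = 0 \<longleftrightarrow> a = 0"
proof
  show "a = 0" if "\<phi> a = 0"
  proof (rule ccontr)
    assume "a \<noteq> 0"
    then show False using hom_mult[of a "inverse a"] that by simp
  qed
qed simp

lemma hom_eq_iff [simp]: "\<phi> a = \<phi> b \<longleftrightarrow> a = b"
  using hom_eq_0_iff[of "a - b"] by (simp add: hom_diff)

lemma hom_inverse: "\<phi> (inverse a) = inverse (\<phi> a)"
proof (cases "a = 0")
  case False
  then have "\<phi> a * \<phi> (inverse a) = 1" by (simp flip: hom_mult)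
  then show ?thesis by (metis inverse_unique)
qed simp

lemma hom_divide: "\<phi> (a / b) = \<phi> a / \<phi> b"
  by (simp add: divide_inverse hom_mult hom_inverse)

lemma hom_power: "\<phi> (a ^ n) = \<phi> a ^ n"
  by (induction n) (auto simp: hom_mult)

lemma hom_sum: "\<phi> (sum g A) = (\<Sum>i\<in>A. \<phi> (g i))"
  by (induction A rule: infinite_finite_induct) (auto simp: hom_add)

sublocale vs: vector_space "\<lambda>c z. \<phi> c * z"
  by unfold_locales (auto simp: algebra_simps hom_add hom_mult)

definition independent_family :: "('i \<Rightarrow> 'f) \<Rightarrow> 'i set \<Rightarrow> bool" where
  "independent_family w I \<longleftrightarrow> (\<forall>c. (\<Sum>i\<in>I. \<phi> (c i) * w i) = 0 \<longrightarrow> (\<forall>i\<in>I. c i = 0))"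

lemma independent_familyD:
  "independent_family w I \<Longrightarrow> (\<Sum>i\<in>I. \<phi> (c i) * w i) = 0 \<Longrightarrow> i \<in> I \<Longrightarrow> c i = 0"
  unfolding independent_family_def by blast

lemma independent_family_coords_eq:
  assumes "independent_family w I" "(\<Sum>i\<in>I. \<phi> (c i) * w i) = (\<Sum>i\<in>I. \<phi> (d i) * w i)" "i \<in> I"
  shows "c i = d i"
proof -
  have "(\<Sum>i\<in>I. \<phi> (c i - d i) * w i) = 0"
    using assms(2) by (simp add: hom_diff left_diff_distrib sum_subtractf)
  then have "c i - d i = 0" by (rule independent_familyD[OF assms(1) _ assms(3)])
  then show ?thesis by simp
qed

lemma independent_family_iff:
  assumes I: "finite I"
  shows "independent_family w I \<longleftrightarrow> inj_on w I \<and> vs.independent (w ` I)"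
proof
  assume ind: "independent_family w I"
  have inj: "inj_on w I"
  proof (rule inj_onI, rule ccontr)
    fix i j assume ij: "i \<in> I" "j \<in> I" "w i = w j" "i \<noteq> j"
    define c :: "'a \<Rightarrow> 'e" where "c k = (if k = i then 1 else if k = j then - 1 else 0)" for k
    have "(\<Sum>k\<in>I. \<phi> (c k) * w k) = (\<Sum>k\<in>{i, j}. \<phi> (c k) * w k)"
      using I ij by (intro sum.mono_neutral_right) (auto simp: c_def)
    also have "\<dots> = 0" using ij by (simp add: c_def hom_minus)
    finally show False using independent_familyD[OF ind, of c i] ij by (simp add: c_def)
  qed
  moreover have "vs.independent (w ` I)"
  proof (rule vs.independent_if_scalars_zero)
    show "finite (w ` I)" using I by simp
    fix u x assume u: "(\<Sum>x\<in>w ` I. \<phi> (u x) * x) = 0" "x \<in> w ` I"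
    then have "(\<Sum>i\<in>I. \<phi> (u (w i)) * w i) = 0" using inj by (simp add: sum.reindex)
    then show "u x = 0" using independent_familyD[OF ind, of "\<lambda>i. u (w i)"] u by auto
  qed
  ultimately show "inj_on w I \<and> vs.independent (w ` I)" by simp
next
  assume *: "inj_on w I \<and> vs.independent (w ` I)"
  show "independent_family w I"
    unfolding independent_family_def
  proof (intro allI impI ballI)
    fix c i assume c: "(\<Sum>i\<in>I. \<phi> (c i) * w i) = 0" "i \<in> I"
    have "(\<Sum>x\<in>w ` I. \<phi> (c (the_inv_into I w x)) * x) = (\<Sum>i\<in>I. \<phi> (c i) * w i)"
      using * by (simp add: sum.reindex the_inv_into_f_f)
    then have "c (the_inv_into I w (w i)) = 0"
      using * c I by (intro vs.independentD[of "w ` I" "w ` I" "\<lambda>x. c (the_inv_into I w x)"]) auto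
    then show "c i = 0" using * c by (simp add: the_inv_into_f_f)
  qed
qed

lemma span_family: "finite I \<Longrightarrow> (\<Sum>i\<in>I. \<phi> (c i) * w i) \<in> vs.span (w ` I)"
  by (intro vs.span_sum vs.span_scale vs.span_base) auto

lemma span_familyE:
  assumes I: "finite I" and z: "z \<in> vs.span (w ` I)"
  shows "\<exists>c. z = (\<Sum>i\<in>I. \<phi> (c i) * w i)"
proof -
  have "w ` I \<subseteq> range (\<lambda>c. \<Sum>i\<in>I. \<phi> (c i) * w i)"
  proof (rule image_subsetI)
    fix i assume i: "i \<in> I"
    have "w i = (\<Sum>k\<in>I. \<phi> (if k = i then 1 else 0) * w k)"
      using I i by (simp add: if_distrib[of \<phi>] if_distrib[of "\<lambda>x. x * _"] cong: if_cong)
    then show "w i \<in> range (\<lambda>c. \<Sum>i\<in>I. \<phi> (c i) * w i)" by (rule range_eqI[of _ _ "\<lambda>k. if k = i then 1 else 0"])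
  qed
  moreover have "vs.subspace (range (\<lambda>c. \<Sum>i\<in>I. \<phi> (c i) * w i))"
  proof (rule vs.subspaceI)
    show "0 \<in> range (\<lambda>c. \<Sum>i\<in>I. \<phi> (c i) * w i)" by (rule range_eqI[of _ _ "\<lambda>_. 0"]) simp
    fix x y assume "x \<in> range (\<lambda>c. \<Sum>i\<in>I. \<phi> (c i) * w i)"
    then obtain c where c: "x = (\<Sum>i\<in>I. \<phi> (c i) * w i)" by blast
    show "\<phi> k * x \<in> range (\<lambda>c. \<Sum>i\<in>I. \<phi> (c i) * w i)" for k
      unfolding c sum_distrib_left by (rule range_eqI[of _ _ "\<lambda>i. k * c i"]) (simp only: hom_mult mult.assoc)
    assume "y \<in> range (\<lambda>c. \<Sum>i\<in>I. \<phi> (c i) * w i)"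
    then obtain d where d: "y = (\<Sum>i\<in>I. \<phi> (d i) * w i)" by blast
    show "x + y \<in> range (\<lambda>c. \<Sum>i\<in>I. \<phi> (c i) * w i)"
      unfolding c d by (rule range_eqI[of _ _ "\<lambda>i. c i + d i"]) (simp only: hom_add sum.distrib distrib_right)
  qed
  ultimately have "vs.span (w ` I) \<subseteq> range (\<lambda>c. \<Sum>i\<in>I. \<phi> (c i) * w i)" by (rule vs.span_minimal)
  then have "z \<in> range (\<lambda>c. \<Sum>i\<in>I. \<phi> (c i) * w i)" using z by (rule subsetD)
  then show ?thesis by blast
qed

lemma extension_dim_eq_card:
  assumes I: "finite I" and ind: "independent_family w I" and V: "V = {\<Sum>i\<in>I. \<phi> (c i) * w i | c. True}"
  shows "extension_dim \<phi> V = card I"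
proof -
  have *: "inj_on w I" "vs.independent (w ` I)" using independent_family_iff[OF I] ind by auto
  have "w ` I \<subseteq> V"
  proof
    fix x assume "x \<in> w ` I"
    then obtain i where i: "i \<in> I" "x = w i" by blast
    have "w i = (\<Sum>k\<in>I. \<phi> (if k = i then 1 else 0) * w k)"
      using I i by (simp add: if_distrib[of \<phi>] if_distrib[of "\<lambda>x. x * _"] cong: if_cong)
    then show "x \<in> V" unfolding V i by (intro CollectI exI[of _ "\<lambda>k. if k = i then 1 else 0"]) simp
  qed
  moreover have "V \<subseteq> vs.span (w ` I)" unfolding V using span_family[OF I] by blast
  ultimately show ?thesis
    unfolding extension_dim_def using * by (intro vs.dim_unique) (auto simp: card_image)
qed

end

locale finite_extension = field_hom \<phi> for \<phi> :: "'e::field \<Rightarrow> 'f::field" +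
  fixes b :: "nat \<Rightarrow> 'f" and m :: nat
  assumes ex_coords: "\<exists>c. z = (\<Sum>i<m. \<phi> (c i) * b i)"
begin

lemma span_b: "vs.span (b ` {..<m}) = UNIV"
proof -
  have "z \<in> vs.span (b ` {..<m})" for z using ex_coords[of z] span_family[of "{..<m}" _ b] by auto
  then show ?thesis by blast
qed

lemma finite_dimensional: "\<exists>B. finite_dimensional_vector_space (\<lambda>c z. \<phi> c * z) B"
proof -
  obtain B where B: "B \<subseteq> UNIV" "vs.independent B" "UNIV \<subseteq> vs.span B"
    using vs.maximal_independent_subset[of UNIV] by blast
  then have "finite B" using vs.independent_span_bound[of "b ` {..<m}" B] span_b by auto
  then have "finite_dimensional_vector_space (\<lambda>c z. \<phi> c * z) B"
    using B by unfold_locales auto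
  then show ?thesis by blast
qed

lemma extension_dim_le: "extension_dim \<phi> UNIV \<le> m"
proof -
  have "vs.dim UNIV \<le> card (b ` {..<m})" using span_b by (intro vs.dim_le_card) auto
  also have "\<dots> \<le> m" using card_image_le[of "{..<m}" b] by simp
  finally show ?thesis by (simp add: extension_dim_def)
qed

lemma independent_family_card_le:
  assumes "finite I" "independent_family w I"
  shows "card I \<le> extension_dim \<phi> UNIV"
proof -
  obtain B where "finite_dimensional_vector_space (\<lambda>c z. \<phi> c * z) B" using finite_dimensional by blast
  then interpret fd: finite_dimensional_vector_space "\<lambda>c z. \<phi> c * z" B .
  have "inj_on w I" "vs.independent (w ` I)" using independent_family_iff assms by auto
  then have "card (w ` I) \<le> vs.dim UNIV" by (intro fd.independent_card_le_dim) auto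
  then show ?thesis using \<open>inj_on w I\<close> by (simp add: extension_dim_def card_image)
qed

lemma independent_family_spans:
  assumes I: "finite I" "independent_family w I" "card I = extension_dim \<phi> UNIV"
  shows "\<exists>c. z = (\<Sum>i\<in>I. \<phi> (c i) * w i)"
proof -
  obtain B where "finite_dimensional_vector_space (\<lambda>c z. \<phi> c * z) B" using finite_dimensional by blast
  then interpret fd: finite_dimensional_vector_space "\<lambda>c z. \<phi> c * z" B .
  have *: "inj_on w I" "vs.independent (w ` I)" using independent_family_iff I by auto
  then have "vs.dim UNIV \<le> card (w ` I)" using I by (simp add: card_image extension_dim_def)
  then have "UNIV \<subseteq> vs.span (w ` I)" using * by (intro fd.card_ge_dim_independent) auto
  then show ?thesis using span_familyE[OF I(1)] by blast
qed

lemma independent_spanning_family: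
  assumes "extension_dim \<phi> UNIV = m"
  shows "independent_family b {..<m}"
proof -
  obtain B where "finite_dimensional_vector_space (\<lambda>c z. \<phi> c * z) B" using finite_dimensional by blast
  then interpret fd: finite_dimensional_vector_space "\<lambda>c z. \<phi> c * z" B .
  have "m \<le> card (b ` {..<m})"
    using vs.dim_le_card[of UNIV "b ` {..<m}"] span_b assms by (simp add: extension_dim_def)
  then have card: "card (b ` {..<m}) = m" using card_image_le[of "{..<m}" b] by simp
  then have "inj_on b {..<m}" by (intro eq_card_imp_inj_on) auto
  moreover have "vs.independent (b ` {..<m})"
    using span_b card assms by (intro fd.card_le_dim_spanning[of _ UNIV]) (auto simp: extension_dim_def)
  ultimately show ?thesis by (simp add: independent_family_iff)
qed

lemma ex_algebraic_relation: "\<exists>c. (\<exists>i\<le>m. c i \<noteq> 0) \<and> (\<Sum>i\<le>m. \<phi> (c i) * z ^ i) = 0"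
proof (rule ccontr)
  assume "\<not> ?thesis"
  then have "independent_family (\<lambda>i. z ^ i) {..m}" unfolding independent_family_def by auto
  then have "card {..m} \<le> m" using independent_family_card_le[of "{..m}"] extension_dim_le by fastforce
  then show False by simp
qed

end

section \<open>Places in a finite extension\<close>

locale function_field_extension = finite_extension \<phi> b m
  for \<phi> :: "'e::field \<Rightarrow> 'f::field" and b m +
  fixes \<iota> :: "'k::field \<Rightarrow> 'e"
  assumes constants: "field_embedding \<iota>" "range \<iota> \<noteq> UNIV"
    and discrete: "P \<in> places \<iota> \<Longrightarrow> discrete_place P"
begin

text \<open>Some two nonzero terms of an algebraic relation of \<^term>\<open>z\<close> must have the same value, since a
  term of strictly smallest value could not cancel. So a power of \<^term>\<open>z\<close> has the value of an element
  of the ground field.\<close>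

lemma ex_power_value_in_ground_field:
  assumes Q: "Q \<in> places \<iota>'" and z: "z \<noteq> 0"
  shows "\<exists>k\<in>{1..m}. \<exists>c. c \<noteq> 0 \<and> z ^ k * \<phi> c \<in> ring_units (place_ring Q)"
proof -
  interpret R: valuation_subring "place_ring Q" by (rule placesD(2)[OF Q])
  obtain c where c: "\<exists>i\<le>m. c i \<noteq> 0" "(\<Sum>i\<le>m. \<phi> (c i) * z ^ i) = 0"
    using ex_algebraic_relation by blast
  define I where "I = {i. i \<le> m \<and> c i \<noteq> 0}"
  define T where "T i = \<phi> (c i) * z ^ i" for i
  have I: "finite I" "I \<noteq> {}" using c(1) by (auto simp: I_def)
  have T0: "T i \<noteq> 0" if "i \<in> I" for i using that z by (simp add: T_def I_def)
  have "J \<noteq> {} \<Longrightarrow> J \<subseteq> I \<Longrightarrow> \<exists>j\<in>J. \<forall>i\<in>J. T i / T j \<in> place_ring Q" if "finite J" for J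
    using that
  proof (induction J rule: finite_induct)
    case (insert x J)
    show ?case
    proof (cases "J = {}")
      case True
      then show ?thesis using T0 insert.prems R.one by simp
    next
      case False
      then obtain j where j: "j \<in> J" "\<forall>i\<in>J. T i / T j \<in> place_ring Q" using insert by auto
      have nz: "T j \<noteq> 0" "T x \<noteq> 0" using T0 j insert.prems by auto
      have "T x / T j \<in> place_ring Q \<or> T j / T x \<in> place_ring Q"
        using R.total[of "T x / T j"] by simp
      then show ?thesis
      proof
        assume "T x / T j \<in> place_ring Q"
        then show ?thesis using j by (intro bexI[of _ j]) auto
      next
        assume *: "T j / T x \<in> place_ring Q"
        have "T i / T x \<in> place_ring Q" if "i \<in> J" for i
        proof -
          have "T i / T j * (T j / T x) \<in> place_ring Q" using j * that by (intro R.mult) auto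
          then show ?thesis using nz by simp
        qed
        moreover have "T x / T x \<in> place_ring Q" using nz R.one by simp
        ultimately show ?thesis by (intro bexI[of _ x]) auto
      qed
    qed
  qed simp
  then obtain j where j: "j \<in> I" "\<forall>i\<in>I. T i / T j \<in> place_ring Q" using I by blast
  have sum0: "(\<Sum>i\<in>I. T i) = 0"
  proof -
    have "(\<Sum>i\<in>I. T i) = (\<Sum>i\<le>m. \<phi> (c i) * z ^ i)"
      unfolding T_def by (intro sum.mono_neutral_left) (auto simp: I_def)
    then show ?thesis using c by simp
  qed
  have "\<exists>i\<in>I. i \<noteq> j \<and> T i / T j \<notin> Q"
  proof (rule ccontr)
    assume no: "\<not> ?thesis"
    have "(\<Sum>i\<in>J. T i / T j) \<in> Q" if "finite J" "J \<subseteq> I - {j}" for J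
      using that
    proof (induction J rule: finite_induct)
      case empty
      show ?case using placesD(3)[OF Q, of 0] by simp
    next
      case (insert x J)
      have "T x / T j \<in> Q" using no insert.prems by auto
      then have "(\<Sum>i\<in>J. T i / T j) - (0 - T x / T j) \<in> Q"
        using insert placesD(3)[OF Q, of 0] by (intro place_diff[OF Q]) auto
      then show ?case using insert.hyps by (simp add: add.commute)
    qed
    then have *: "(\<Sum>i\<in>I - {j}. T i / T j) \<in> Q" using I by blast
    have "(\<Sum>i\<in>I. T i / T j) = 0" using sum0 by (simp flip: sum_divide_distrib)
    then have "1 + (\<Sum>i\<in>I - {j}. T i / T j) = 0" using I j T0 by (simp add: sum.remove)
    then have "(\<Sum>i\<in>I - {j}. T i / T j) = - 1" by (simp add: add_eq_0_iff)
    then have "- 1 \<in> Q" using * by simp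
    then have "0 - (- 1) \<in> Q" using placesD(3)[OF Q, of 0] by (intro place_diff[OF Q]) auto
    then show False using one_not_in_place[OF Q] by simp
  qed
  then obtain i where i: "i \<in> I" "i \<noteq> j" "T i / T j \<notin> Q" by blast
  then have inv: "inverse (T i / T j) \<in> place_ring Q" using placesD(3)[OF Q] by blast
  have nz: "c i \<noteq> 0" "c j \<noteq> 0" "i \<le> m" "j \<le> m" using i j by (auto simp: I_def)
  have u: "T i / T j \<in> ring_units (place_ring Q)" "T j / T i \<in> ring_units (place_ring Q)"
    using inv j i T0 by (auto simp: R.ring_units_iff)
  show ?thesis
  proof (cases "j < i")
    case True
    have "T i / T j = z ^ (i - j) * \<phi> (c i / c j)"
      using True z nz by (simp add: T_def hom_divide power_diff mult.commute)
    then show ?thesis using u nz True by (intro bexI[of _ "i - j"] exI[of _ "c i / c j"]) auto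
  next
    case False
    then have "i < j" using i by simp
    then have "T j / T i = z ^ (j - i) * \<phi> (c j / c i)"
      using z nz by (simp add: T_def hom_divide power_diff mult.commute)
    then show ?thesis using u nz \<open>i < j\<close> by (intro bexI[of _ "j - i"] exI[of _ "c j / c i"]) auto
  qed
qed

abbreviation places_above :: "'f set set" where
  "places_above \<equiv> places (\<phi> \<circ> \<iota>)"

lemma restricted_place:
  assumes Q: "Q \<in> places_above"
  shows "\<phi> -` Q \<in> places \<iota>" and "place_ring (\<phi> -` Q) = \<phi> -` place_ring Q"
proof -
  interpret R: valuation_subring "place_ring Q" by (rule placesD(2)[OF Q])
  let ?R = "\<phi> -` place_ring Q"
  interpret \<iota>: field_hom \<iota> by unfold_locales (rule constants)
  have QR: "range (\<phi> \<circ> \<iota>) \<subset> place_ring Q" "place_ring Q \<noteq> UNIV"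
    using placesD(1)[OF Q] by (auto simp: valuation_ring_iff)
  have sub: "valuation_subring ?R"
    by unfold_locales (auto simp: hom_diff hom_mult hom_inverse R.diff R.mult R.total)
  have const: "range \<iota> \<subseteq> ?R" using QR by auto
  \<comment> \<open>otherwise each element has a power in \<^term>\<open>place_ring Q\<close>, and so lies in it itself\<close>
  have neq: "?R \<noteq> UNIV"
  proof
    assume all: "?R = UNIV"
    have "z \<in> place_ring Q" for z
    proof (cases "z = 0")
      case False
      obtain k c where k: "k \<in> {1..m}" "c \<noteq> 0" "z ^ k * \<phi> c \<in> ring_units (place_ring Q)"
        using ex_power_value_in_ground_field[OF Q False] by blast
      have "inverse c \<in> ?R" using all by simp
      then have "z ^ k * \<phi> c * \<phi> (inverse c) \<in> place_ring Q"
        using k(3) R.ring_units_iff by (intro R.mult[of "z ^ k * \<phi> c"]) auto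
      then have "z ^ k \<in> place_ring Q" using k(2) by (simp add: hom_inverse mult.assoc)
      then show ?thesis using R.powerD[of k z] k by simp
    qed (simp add: R.zero)
    then show False using QR by auto
  qed
  have "range \<iota> \<noteq> ?R"
  proof
    assume eq: "range \<iota> = ?R"
    have "z \<in> range \<iota>" for z
    proof -
      have "z \<in> ?R \<or> inverse z \<in> ?R" using sub by (auto simp: valuation_subring_def)
      then have "z \<in> range \<iota> \<or> inverse z \<in> range \<iota>" using eq by simp
      moreover have "z = \<iota> (inverse a)" if "inverse z = \<iota> a" for a
        using that \<iota>.hom_inverse[of a] by (metis inverse_inverse_eq)
      ultimately show ?thesis by blast
    qed
    then show False using constants by auto
  qed
  then have "valuation_ring \<iota> ?R" using sub const neq by (auto simp: valuation_ring_iff)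
  moreover have "z \<in> \<phi> -` Q \<longleftrightarrow> z = 0 \<or> inverse z \<notin> ?R" for z
    using placesD(3)[OF Q, of "\<phi> z"] by (simp add: hom_inverse)
  ultimately show "\<phi> -` Q \<in> places \<iota>" "place_ring (\<phi> -` Q) = ?R"
    by (rule placesI[of \<iota> ?R]; assumption)+
qed

text \<open>The ring of the restricted place is a discrete valuation ring, so a larger proper one equals it.\<close>

lemma lies_over_iff:
  assumes Q: "Q \<in> places_above" and P: "P \<in> places \<iota>"
  shows "lies_over \<phi> Q P \<longleftrightarrow> P = \<phi> -` Q"
proof
  assume "lies_over \<phi> Q P"
  then have sub: "P \<subseteq> \<phi> -` Q" by (auto simp: lies_over_def)
  let ?P' = "\<phi> -` Q"
  note P' = restricted_place(1)[OF Q]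
  have "place_ring ?P' \<subseteq> place_ring P"
    using sub unfolding place_ring_def by auto
  then have "place_ring P = place_ring ?P'"
    using discrete_place.place_ring_maximal[OF discrete[OF P'] _ placesD(2)[OF P]] placesD(1)[OF P]
    by (simp add: valuation_ring_iff)
  then show "P = \<phi> -` Q" by (rule place_eqI[OF P P'])
qed (auto simp: lies_over_def)

text \<open>Up to the constant factor \<^term>\<open>fact m :: nat\<close>, a place above is given by the values of elements
  of the ground field.\<close>

lemma place_above:
  assumes Q: "Q \<in> places_above"
  shows "discrete_place Q"
    and "\<exists>e>0. \<forall>z. z \<noteq> 0 \<longrightarrow> val Q (\<phi> z) = int e * val (\<phi> -` Q) z"
proof -
  interpret R: valuation_subring "place_ring Q" by (rule placesD(2)[OF Q])
  let ?P = "\<phi> -` Q" let ?S = "place_ring Q" let ?U = "ring_units ?S"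
  interpret P: discrete_place ?P by (rule discrete[OF restricted_place(1)[OF Q]])
  note PS = restricted_place(2)[OF Q]
  define M where "M = (fact m :: nat)"
  have M: "M > 0" by (simp add: M_def)
  have U_mult: "a * b \<in> ?U" if "a \<in> ?U" "b \<in> ?U" for a b
    using that by (auto simp: R.ring_units_iff intro: R.mult)
  have U_power: "a ^ n \<in> ?U" if "a \<in> ?U" for a n
    using that by (auto simp: R.ring_units_iff intro: R.power simp flip: power_inverse)
  have U_inverse: "inverse a \<in> ?U" if "a \<in> ?U" for a
    using that by (auto simp: R.ring_units_iff)
  have "\<exists>c. c \<noteq> 0 \<and> z ^ M * \<phi> c \<in> ?U" if z: "z \<noteq> 0" for z
  proof -
    obtain k c where k: "k \<in> {1..m}" "c \<noteq> 0" "z ^ k * \<phi> c \<in> ?U"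
      using ex_power_value_in_ground_field[OF Q z] by blast
    then have "k dvd M" unfolding M_def by (intro dvd_fact) auto
    then obtain l where "M = k * l" by auto
    then have "(z ^ k * \<phi> c) ^ l = z ^ M * \<phi> (c ^ l)"
      by (simp add: power_mult_distrib hom_power flip: power_mult)
    then have "z ^ M * \<phi> (c ^ l) \<in> ?U" using U_power[OF k(3), of l] by simp
    moreover have "c ^ l \<noteq> 0" using k by simp
    ultimately show ?thesis by blast
  qed
  then have "\<forall>z. \<exists>c. z \<noteq> 0 \<longrightarrow> c \<noteq> 0 \<and> z ^ M * \<phi> c \<in> ?U" by blast
  then obtain g where g: "\<And>z. z \<noteq> 0 \<Longrightarrow> g z \<noteq> 0" "\<And>z. z \<noteq> 0 \<Longrightarrow> z ^ M * \<phi> (g z) \<in> ?U" by metis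
  \<comment> \<open>\<^term>\<open>z ^ M\<close> has the value of \<open>\<phi> (inverse (g z))\<close>\<close>
  define V where "V z = - val ?P (g z)" for z
  have V: "V z = - val ?P c" if c: "c \<noteq> 0" "z ^ M * \<phi> c \<in> ?U" and z: "z \<noteq> 0" for z c
  proof -
    have "z ^ M * \<phi> c * inverse (z ^ M * \<phi> (g z)) \<in> ?U" using c g z U_mult U_inverse by blast
    also have "z ^ M * \<phi> c * inverse (z ^ M * \<phi> (g z)) = \<phi> (c / g z)"
      using z by (simp add: hom_mult hom_inverse divide_inverse)
    finally have "c / g z \<in> place_ring ?P" "inverse (c / g z) \<in> place_ring ?P"
      unfolding PS vimage_eq hom_inverse by (simp_all add: R.ring_units_iff)
    then have "val ?P (c / g z) \<ge> 0" "val ?P (inverse (c / g z)) \<ge> 0"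
      using c(1) g(1)[OF z] by (auto simp: P.mem_place_ring_iff)
    then have "val ?P (c / g z) = 0" using c(1) g(1)[OF z] P.val_inverse[of "c / g z"] by simp
    then show ?thesis using c(1) g(1)[OF z] P.val_divide[of c "g z"] by (simp add: V_def)
  qed
  have ring: "V z \<ge> 0 \<longleftrightarrow> z \<in> ?S" if z: "z \<noteq> 0" for z
  proof -
    have "V z \<ge> 0 \<longleftrightarrow> inverse (g z) \<in> place_ring ?P"
      using g(1)[OF z] P.val_inverse[of "g z"] by (simp add: V_def P.mem_place_ring_iff)
    also have "\<dots> \<longleftrightarrow> inverse (\<phi> (g z)) \<in> ?S" by (simp add: PS hom_inverse)
    also have "\<dots> \<longleftrightarrow> z ^ M \<in> ?S"
    proof -
      let ?u = "z ^ M * \<phi> (g z)"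
      have u: "?u \<in> ?S" "inverse ?u \<in> ?S" using g(2)[OF z] unfolding R.ring_units_iff by blast+
      have "inverse (\<phi> (g z)) = inverse ?u * z ^ M" "z ^ M = ?u * inverse (\<phi> (g z))"
        using z g(1)[OF z] by simp_all
      then show ?thesis using u R.mult by metis
    qed
    also have "\<dots> \<longleftrightarrow> z \<in> ?S" using R.powerD[OF M] R.power by blast
    finally show ?thesis .
  qed
  have V_mult: "V (x * y) = V x + V y" if "x \<noteq> 0" "y \<noteq> 0" for x y
  proof -
    have "x ^ M * \<phi> (g x) * (y ^ M * \<phi> (g y)) \<in> ?U" using g that U_mult by blast
    also have "x ^ M * \<phi> (g x) * (y ^ M * \<phi> (g y)) = (x * y) ^ M * \<phi> (g x * g y)"
      by (simp add: hom_mult power_mult_distrib)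
    finally have "V (x * y) = - val ?P (g x * g y)" using that g(1) by (intro V) auto
    then show ?thesis using that g(1) by (simp add: V_def P.val_mult)
  qed
  have V_hom: "V (\<phi> z) = int M * val ?P z" if "z \<noteq> 0" for z
  proof -
    have "\<phi> z ^ M * \<phi> (inverse (z ^ M)) = 1" using that by (simp add: hom_inverse hom_power)
    then have "\<phi> z ^ M * \<phi> (inverse (z ^ M)) \<in> ?U" by (simp add: R.ring_units_iff R.one)
    then have "V (\<phi> z) = - val ?P (inverse (z ^ M))" using that by (intro V) auto
    then show ?thesis using that P.val_inverse[of "z ^ M"] by (simp add: P.val_power)
  qed
  obtain t where t: "t \<noteq> 0" "val ?P t = 1" using P.ex_val_1 by blast
  have \<phi>t: "\<phi> t \<noteq> 0" "V (\<phi> t) \<noteq> 0" using t M V_hom by auto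
  obtain d where d: "d > 0" "\<And>z. z \<noteq> 0 \<Longrightarrow> V z = d * val Q z" and Q': "discrete_place Q"
    using discrete_place_of_ring_values[OF Q V_mult ring \<phi>t] by blast
  show "discrete_place Q" by (fact Q')
  define e where "e = val Q (\<phi> t)"
  have Me: "int M = d * e" using V_hom[OF t(1)] d(2)[OF \<phi>t(1)] t by (simp add: e_def)
  then have e: "e > 0" using M d(1) by (metis of_nat_0_less_iff zero_less_mult_pos)
  have "val Q (\<phi> z) = int (nat e) * val ?P z" if z: "z \<noteq> 0" for z
  proof -
    have "d * val Q (\<phi> z) = d * (e * val ?P z)"
      using V_hom[OF z] d(2)[of "\<phi> z"] z Me by simp
    then show ?thesis using d(1) e by simp
  qed
  then show "\<exists>e>0. \<forall>z. z \<noteq> 0 \<longrightarrow> val Q (\<phi> z) = int e * val ?P z"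
    using e by (intro exI[of _ "nat e"]) auto
qed

lemma ramification_index:
  assumes Q: "Q \<in> places_above"
  shows "ramification_index \<phi> Q (\<phi> -` Q) > 0"
    and "z \<noteq> 0 \<Longrightarrow> val Q (\<phi> z) = int (ramification_index \<phi> Q (\<phi> -` Q)) * val (\<phi> -` Q) z"
proof -
  let ?P = "\<phi> -` Q"
  interpret P: discrete_place ?P by (rule discrete[OF restricted_place(1)[OF Q]])
  obtain e where e: "e > 0" "\<forall>z. z \<noteq> 0 \<longrightarrow> val Q (\<phi> z) = int e * val ?P z"
    using place_above(2)[OF Q] by blast
  obtain t where t: "t \<noteq> 0" "val ?P t = 1" using P.ex_val_1 by blast
  have "ramification_index \<phi> Q ?P = e"
    unfolding ramification_index_def
  proof (rule the_equality)
    fix e' assume "\<forall>z. z \<noteq> 0 \<longrightarrow> val Q (\<phi> z) = int e' * val ?P z"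
    then have "int e' * val ?P t = int e * val ?P t" using e t by metis
    then show "e' = e" using t by simp
  qed (rule e)
  then show "ramification_index \<phi> Q ?P > 0"
    "z \<noteq> 0 \<Longrightarrow> val Q (\<phi> z) = int (ramification_index \<phi> Q ?P) * val ?P z" using e by auto
qed

text \<open>An element regular at all places above \<^term>\<open>P\<close> lies in the subring generated over the ring
  of \<^term>\<open>P\<close> by its inverse: otherwise Chevalley's theorem provides a place above
  \<^term>\<open>P\<close> at which it has a pole. Hence it is integral, and its powers are combinations of finitely many
  of them.\<close>

lemma powers_of_regular_element:
  assumes P: "P \<in> places \<iota>"
    and z: "\<And>Q. Q \<in> places_above \<Longrightarrow> \<phi> -` Q = P \<Longrightarrow> z \<in> place_ring Q"
  shows "\<exists>d. \<forall>l. \<exists>r. (\<forall>j. r j \<in> place_ring P) \<and> z ^ l = (\<Sum>j\<le>d. \<phi> (r j) * z ^ j)"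
proof (cases "z = 0")
  case True
  interpret P: valuation_subring "place_ring P" by (rule placesD(2)[OF P])
  have "\<exists>r. (\<forall>j. r j \<in> place_ring P) \<and> z ^ l = (\<Sum>j\<le>0. \<phi> (r j) * z ^ j)" for l
    using True P.one P.zero by (intro exI[of _ "\<lambda>_. if l = 0 then 1 else 0"]) simp
  then show ?thesis by blast
next
  case z0: False
  interpret P: valuation_subring "place_ring P" by (rule placesD(2)[OF P])
  interpret A: subring_of_field "\<phi> ` place_ring P"
    using P.one P.diff P.mult by unfold_locales (auto simp flip: hom_diff hom_mult intro: image_eqI[of 1 \<phi> 1])
  interpret B: subring_of_field "A.adjoin (inverse z)" by (rule A.subring_adjoin)
  have "z \<in> A.adjoin (inverse z)"
  proof (rule ccontr)
    assume "z \<notin> A.adjoin (inverse z)"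
    then obtain S where S: "valuation_subring S" "A.adjoin (inverse z) \<subseteq> S" "z \<notin> S"
      using ex_valuation_subring_avoiding[OF A.subring_adjoin A.mem_adjoin, of "inverse z"] by auto
    have sub: "\<phi> ` place_ring P \<subseteq> S" using A.subset_adjoin S by blast
    have "range \<iota> \<subset> place_ring P" using placesD(1)[OF P] by (simp add: valuation_ring_iff)
    then obtain c where "range \<iota> \<subseteq> place_ring P" "c \<in> place_ring P" "c \<notin> range \<iota>" by blast
    then have "range (\<phi> \<circ> \<iota>) \<subseteq> S" "\<phi> c \<in> S" "\<phi> c \<notin> range (\<phi> \<circ> \<iota>)" using sub by auto
    then have "valuation_ring (\<phi> \<circ> \<iota>) S" using S by (auto simp: valuation_ring_iff)
    moreover define Q where "Q = {z. z = 0 \<or> inverse z \<notin> S}"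
    ultimately have Q: "Q \<in> places_above" "place_ring Q = S"
      using placesI[of "\<phi> \<circ> \<iota>" S Q] by auto
    have "place_ring (\<phi> -` Q) = \<phi> -` S" using restricted_place(2)[OF Q(1)] Q(2) by simp
    then have "place_ring P \<subseteq> place_ring (\<phi> -` Q)" using sub by auto
    then have "place_ring (\<phi> -` Q) = place_ring P"
      using placesD(1)[OF restricted_place(1)[OF Q(1)]]
      by (intro discrete_place.place_ring_maximal[OF discrete[OF P]]) (auto simp: valuation_ring_iff)
    then have "\<phi> -` Q = P" by (rule place_eqI[OF restricted_place(1)[OF Q(1)] P])
    then show False using z[OF Q(1)] Q(2) S by simp
  qed
  then obtain p where p: "z = poly p (inverse z)" "\<forall>i. coeff p i \<in> \<phi> ` place_ring P"
    unfolding A.adjoin_def by blast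
  define d where "d = degree p"
  define h where "h = (\<Sum>i\<le>d. monom (coeff p i) (d - i))"
  have "poly h z = (\<Sum>i\<le>d. coeff p i * z ^ (d - i))" by (simp add: h_def poly_sum poly_monom)
  also have "\<dots> = z ^ d * (\<Sum>i\<le>d. coeff p i * inverse z ^ i)"
    unfolding sum_distrib_left using z0 by (intro sum.cong) (auto simp: power_diff power_inverse field_simps)
  also have "\<dots> = z ^ d * z" using p(1) by (simp add: poly_altdef d_def)
  finally have hz: "poly h z = z ^ Suc d" by simp
  have h_coeff: "coeff h i \<in> \<phi> ` place_ring P" for i
    unfolding h_def coeff_sum using p(2) A.zero by (intro A.sum) auto
  have h_deg: "degree h \<le> d"
    unfolding h_def by (intro degree_sum_le) (auto intro: order_trans[OF degree_monom_le])
  have pow: "\<exists>g. (\<forall>i. coeff g i \<in> \<phi> ` place_ring P) \<and> degree g \<le> d \<and> poly g z = z ^ l" for l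
  proof (induction l)
    case 0
    show ?case using A.one A.zero
      by (intro exI[of _ "[:1:]"]) (auto simp: coeff_pCons split: nat.split)
  next
    case (Suc l)
    then obtain g where g: "\<forall>i. coeff g i \<in> \<phi> ` place_ring P" "degree g \<le> d" "poly g z = z ^ l" by blast
    \<comment> \<open>\<^term>\<open>h\<close> reduces the term of degree \<open>d + 1\<close> of \<open>z * poly g z\<close>\<close>
    define g' where "g' = pCons 0 g - monom (coeff g d) (Suc d) + smult (coeff g d) h"
    have "poly g' z = z ^ Suc l" by (simp add: g'_def g(3) hz poly_monom)
    moreover have "\<forall>i. coeff g' i \<in> \<phi> ` place_ring P"
      unfolding g'_def using g(1) h_coeff A.zero
      by (auto simp: coeff_pCons split: nat.split intro!: A.add A.diff A.mult)
    moreover have "degree g' \<le> d"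
    proof (rule degree_le, intro allI impI)
      fix i assume "d < i"
      then obtain k where k: "i = Suc k" "d \<le> k" by (cases i) auto
      have "coeff h i = 0" "k > d \<Longrightarrow> coeff g k = 0" using h_deg g(2) \<open>d < i\<close> by (auto intro: coeff_eq_0)
      then show "coeff g' i = 0" using k by (auto simp: g'_def)
    qed
    ultimately show ?case by blast
  qed
  have "\<exists>r. (\<forall>j. r j \<in> place_ring P) \<and> z ^ l = (\<Sum>j\<le>d. \<phi> (r j) * z ^ j)" for l
  proof -
    obtain g where g: "\<forall>i. coeff g i \<in> \<phi> ` place_ring P" "degree g \<le> d" "poly g z = z ^ l" using pow by blast
    then have "\<forall>j. \<exists>a. a \<in> place_ring P \<and> coeff g j = \<phi> a" by blast
    from choice[OF this] obtain r where r: "\<forall>j. r j \<in> place_ring P \<and> coeff g j = \<phi> (r j)" ..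
    have "poly g z = (\<Sum>j\<le>d. coeff g j * z ^ j)"
      unfolding poly_altdef using g(2) by (intro sum.mono_neutral_left) (auto intro: coeff_eq_0)
    also have "\<dots> = (\<Sum>j\<le>d. \<phi> (r j) * z ^ j)" using r by (intro sum.cong) simp_all
    finally show ?thesis using r g(3) by (intro exI[of _ r]) simp
  qed
  then show ?thesis by blast
qed

end

section \<open>Totally ramified places\<close>

locale totally_ramified_place = function_field_extension \<phi> b m \<iota>
  for \<phi> :: "'e::field \<Rightarrow> 'f::field" and b m and \<iota> :: "'k::field \<Rightarrow> 'e" +
  fixes P Q
  assumes Q: "Q \<in> places_above" and P: "P = \<phi> -` Q"
    and totally: "ramification_index \<phi> Q P = extension_dim \<phi> UNIV"
    and residue: "\<And>a. a \<in> place_ring P \<Longrightarrow> \<exists>k. a - \<iota> k \<in> P"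
begin

abbreviation N :: nat where "N \<equiv> extension_dim \<phi> UNIV"

sublocale VP: discrete_place P unfolding P by (rule discrete[OF restricted_place(1)[OF Q]])
sublocale VQ: discrete_place Q by (rule place_above(1)[OF Q])

lemma degree_pos: "N > 0"
  using ramification_index(1)[OF Q] totally P by simp

lemma val_hom: "z \<noteq> 0 \<Longrightarrow> val Q (\<phi> z) = int N * val P z"
  using ramification_index(2)[OF Q] totally P by simp

text \<open>The powers of a uniformizer have values in different classes modulo the degree, hence form a
  basis, and the value of a combination is the least value of its terms.\<close>

lemma uniformizer_power_sum:
  assumes \<pi>: "\<pi> \<noteq> 0" "val Q \<pi> = 1"
    and j: "j < N" "a j \<noteq> 0"
  shows "(\<Sum>i<N. \<phi> (a i) * \<pi> ^ i) \<noteq> 0"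
    and "val Q (\<Sum>i<N. \<phi> (a i) * \<pi> ^ i) \<le> int N * val P (a j) + int j"
proof -
  define I where "I = {i. i < N \<and> a i \<noteq> 0}"
  let ?z = "\<lambda>i. \<phi> (a i) * \<pi> ^ i"
  have I: "finite I" "j \<in> I" using j by (auto simp: I_def)
  have nz: "?z i \<noteq> 0" if "i \<in> I" for i using that \<pi> by (simp add: I_def)
  have val: "val Q (?z i) = int N * val P (a i) + int i" if "i \<in> I" for i
    using that \<pi> by (simp add: I_def VQ.val_mult VQ.val_power val_hom)
  have "inj_on (\<lambda>i. val Q (?z i)) I"
  proof (rule inj_onI)
    fix i k assume ik: "i \<in> I" "k \<in> I" "val Q (?z i) = val Q (?z k)"
    then have "(int N * val P (a i) + int i) mod int N = (int N * val P (a k) + int k) mod int N"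
      using val by simp
    then show "i = k" using ik by (simp add: I_def)
  qed
  then have *: "sum ?z I \<noteq> 0" "\<forall>i\<in>I. val Q (sum ?z I) \<le> val Q (?z i)"
    using VQ.val_sum_distinct[of I ?z] I nz by blast+
  have eq: "(\<Sum>i<N. ?z i) = sum ?z I"
    by (intro sum.mono_neutral_right) (auto simp: I_def)
  show "(\<Sum>i<N. ?z i) \<noteq> 0" using * eq by simp
  show "val Q (\<Sum>i<N. ?z i) \<le> int N * val P (a j) + int j" using * eq I(2) val by metis
qed

lemma ex_uniformizer_coords:
  assumes \<pi>: "\<pi> \<noteq> 0" "val Q \<pi> = 1"
  shows "\<exists>a. z = (\<Sum>i<N. \<phi> (a i) * \<pi> ^ i)"
proof (rule independent_family_spans)
  show "independent_family (\<lambda>i. \<pi> ^ i) {..<N}"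
    unfolding independent_family_def using uniformizer_power_sum(1)[OF \<pi>] by blast
qed auto

lemma residue_above:
  assumes z: "z \<in> place_ring Q"
  shows "\<exists>k. z - \<phi> (\<iota> k) \<in> Q"
proof (cases "z = 0")
  case True
  interpret \<iota>: field_hom \<iota> by unfold_locales (rule constants)
  show ?thesis using True VQ.mem_place_iff[of 0] by (intro exI[of _ 0]) simp
next
  case z0: False
  obtain \<pi> where \<pi>: "\<pi> \<noteq> 0" "val Q \<pi> = 1" using VQ.ex_val_1 by blast
  obtain a where a: "z = (\<Sum>i<N. \<phi> (a i) * \<pi> ^ i)" using ex_uniformizer_coords[OF \<pi>] by blast
  have val_a: "val P (a j) \<ge> 0" if "j < N" "a j \<noteq> 0" for j
  proof (rule ccontr)
    assume "\<not> val P (a j) \<ge> 0"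
    then have "int N * val P (a j) \<le> int N * (- 1)" by (intro mult_left_mono) auto
    moreover have "0 \<le> val Q z" using z z0 by (simp add: VQ.mem_place_ring_iff)
    then have "0 \<le> int N * val P (a j) + int j"
      using uniformizer_power_sum(2)[OF \<pi>, of j a] that a by simp
    ultimately show False using that by simp
  qed
  have "a 0 \<in> place_ring P" using val_a[of 0] degree_pos by (auto simp: VP.mem_place_ring_iff)
  then obtain k where k: "a 0 - \<iota> k \<in> P" using residue by blast
  have split: "z - \<phi> (\<iota> k) = \<phi> (a 0 - \<iota> k) + (\<Sum>i\<in>{1..<N}. \<phi> (a i) * \<pi> ^ i)"
    unfolding a lessThan_atLeast0 using degree_pos by (simp add: sum.atLeast_Suc_lessThan hom_diff)
  have "z - \<phi> (\<iota> k) = 0 \<or> 1 \<le> val Q (z - \<phi> (\<iota> k))"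
  proof (cases "z - \<phi> (\<iota> k) = 0")
    case False
    have "1 \<le> val Q (\<phi> (a 0 - \<iota> k) + (\<Sum>i\<in>{1..<N}. \<phi> (a i) * \<pi> ^ i))"
    proof (rule VQ.val_add_ge)
      assume "\<phi> (a 0 - \<iota> k) \<noteq> 0"
      then have nz: "a 0 - \<iota> k \<noteq> 0" by auto
      then have "val P (a 0 - \<iota> k) \<ge> 1" using k by (auto simp: VP.mem_place_iff)
      then show "1 \<le> val Q (\<phi> (a 0 - \<iota> k))"
        unfolding val_hom[OF nz] using degree_pos by (simp add: zero_less_mult_iff int_one_le_iff_zero_less)
    next
      assume "(\<Sum>i\<in>{1..<N}. \<phi> (a i) * \<pi> ^ i) \<noteq> 0"
      then show "1 \<le> val Q (\<Sum>i\<in>{1..<N}. \<phi> (a i) * \<pi> ^ i)"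
      proof (rule VQ.val_sum_ge[rotated 2])
        fix i assume i: "i \<in> {1..<N}" "\<phi> (a i) * \<pi> ^ i \<noteq> 0"
        then have "a i \<noteq> 0" by auto
        then have "val Q (\<phi> (a i) * \<pi> ^ i) = int N * val P (a i) + int i"
          using \<pi> by (simp add: VQ.val_mult VQ.val_power val_hom)
        moreover have "int N * val P (a i) \<ge> 0" using val_a[of i] i \<open>a i \<noteq> 0\<close> by simp
        ultimately show "1 \<le> val Q (\<phi> (a i) * \<pi> ^ i)" using i by simp
      qed simp
    qed (use split False in simp)
    then show ?thesis using split by simp
  qed simp
  then show ?thesis by (intro exI[of _ k]) (auto simp: VQ.mem_place_iff)
qed

text \<open>The ground field is closed for the topology of \<^term>\<open>Q\<close>: subtracting one of its elements changes
  only the constant coordinate, so the other ones bound the value of the difference.\<close>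

lemma mem_ground_field_if_approximable:
  assumes approx: "\<And>n. \<exists>c. z = \<phi> c \<or> n \<le> val Q (z - \<phi> c)"
  shows "z \<in> range \<phi>"
proof (rule ccontr)
  assume z: "z \<notin> range \<phi>"
  obtain \<pi> where \<pi>: "\<pi> \<noteq> 0" "val Q \<pi> = 1" using VQ.ex_val_1 by blast
  obtain a where a: "z = (\<Sum>i<N. \<phi> (a i) * \<pi> ^ i)" using ex_uniformizer_coords[OF \<pi>] by blast
  have split: "(\<Sum>i<N. \<phi> (a' i) * \<pi> ^ i) = \<phi> (a' 0) + (\<Sum>i\<in>{1..<N}. \<phi> (a' i) * \<pi> ^ i)" for a'
    unfolding lessThan_atLeast0 using degree_pos by (simp add: sum.atLeast_Suc_lessThan)
  have "\<exists>j. 0 < j \<and> j < N \<and> a j \<noteq> 0"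
  proof (rule ccontr)
    assume "\<not> ?thesis"
    then have "(\<Sum>i\<in>{1..<N}. \<phi> (a i) * \<pi> ^ i) = 0" by (intro sum.neutral) auto
    then have "z = \<phi> (a 0)" using a split[of a] by simp
    then show False using z by blast
  qed
  then obtain j where j: "0 < j" "j < N" "a j \<noteq> 0" by blast
  obtain c where c: "z = \<phi> c \<or> int N * val P (a j) + int j + 1 \<le> val Q (z - \<phi> c)" using approx by blast
  define a' where "a' i = (if i = 0 then a 0 - c else a i)" for i
  have "z - \<phi> c = (\<Sum>i<N. \<phi> (a' i) * \<pi> ^ i)"
    unfolding split a by (simp add: a'_def hom_diff)
  moreover have "val Q (\<Sum>i<N. \<phi> (a' i) * \<pi> ^ i) \<le> int N * val P (a' j) + int j"
    using j by (intro uniformizer_power_sum(2)[OF \<pi>]) (auto simp: a'_def)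
  moreover have "a' j = a j" using j by (simp add: a'_def)
  ultimately show False using c z by auto
qed

text \<open>If \<open>w\<close> has residue \<open>k\<close>, then \<open>w ^ l\<close> is close to \<open>k ^ l\<close> for \<open>l\<close> a large power of the
  characteristic. For \<open>l\<close> congruent to 1 modulo \<open>g\<close> it is also \<open>w\<close> times an element of the ground
  field. So \<open>w\<close> is a limit of elements of the ground field.\<close>

lemma radical_unit_in_ground_field:
  assumes p: "prime CHAR('f)" "\<not> CHAR('f) dvd n" "g dvd n"
    and w: "w \<noteq> 0" "w ^ g = \<phi> u" and val_w: "val Q w = 0"
  shows "w \<in> range \<phi>"
proof (rule mem_ground_field_if_approximable)
  fix r :: int
  let ?p = "CHAR('f)"
  have g: "coprime ?p g"
    using p prime_imp_coprime dvd_trans by blast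
  have p1: "?p > 1" using p(1) prime_gt_1_nat by blast
  define t where "t = Suc 0 + nat \<bar>r\<bar>"
  define l where "l = ?p ^ (totient g * t)"
  have "g > 0"
  proof (rule ccontr)
    assume "\<not> g > 0"
    then show False using p(2,3) by auto
  qed
  then have "totient g \<ge> 1" by (simp add: Suc_le_eq)
  then have "t \<le> totient g * t" by simp
  also have "\<dots> < l" unfolding l_def using p1 by (intro power_gt_expt) auto
  finally have l: "r \<le> int l" "l > 0" by (auto simp: t_def)
  have "[?p ^ totient g = 1] (mod g)" using g by (rule euler_theorem)
  then have "[(?p ^ totient g) ^ t = 1 ^ t] (mod g)" by (rule cong_pow)
  then have "[l = 1] (mod g)" by (simp add: l_def power_mult)
  then have "g dvd l - 1" using l by (simp add: cong_altdef_nat)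
  then obtain q where q: "l = g * q + 1" using l by (metis Suc_eq_plus1 Suc_pred' dvdE One_nat_def)
  have "u \<noteq> 0"
  proof
    assume "u = 0"
    then show False using w by simp
  qed
  have "w \<in> place_ring Q" using val_w by (simp add: VQ.mem_place_ring_iff)
  then obtain k where k: "w - \<phi> (\<iota> k) \<in> Q" using residue_above by blast
  define c where "c = \<iota> k ^ l / u ^ q"
  have "w ^ l = ((w - \<phi> (\<iota> k)) + \<phi> (\<iota> k)) ^ l" by simp
  also have "\<dots> = (w - \<phi> (\<iota> k)) ^ l + \<phi> (\<iota> k) ^ l"
    by (rule freshmans_dream'[OF p(1)]) (simp add: l_def)
  finally have "w * \<phi> u ^ q = (w - \<phi> (\<iota> k)) ^ l + \<phi> (\<iota> k) ^ l"
    using w by (simp add: q power_add power_mult mult.commute)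
  then have eq: "(w - \<phi> c) * \<phi> u ^ q = (w - \<phi> (\<iota> k)) ^ l"
    using \<open>u \<noteq> 0\<close> by (simp add: c_def hom_divide hom_power left_diff_distrib)
  show "\<exists>c. w = \<phi> c \<or> r \<le> val Q (w - \<phi> c)"
  proof (cases "w = \<phi> c")
    case False
    then have nz: "w - \<phi> (\<iota> k) \<noteq> 0" using eq \<open>u \<noteq> 0\<close> l by (auto simp: zero_power)
    have "val Q (\<phi> u) = 0" using w val_w VQ.val_power[OF w(1), of g] by simp
    then have "val Q (w - \<phi> c) = int l * val Q (w - \<phi> (\<iota> k))"
      using arg_cong[OF eq, of "val Q"] False nz \<open>u \<noteq> 0\<close> by (simp add: VQ.val_mult VQ.val_power)
    moreover have "val Q (w - \<phi> (\<iota> k)) \<ge> 1" using k nz by (auto simp: VQ.mem_place_iff)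
    then have "int l * 1 \<le> int l * val Q (w - \<phi> (\<iota> k))" by (intro mult_left_mono) auto
    ultimately have "r \<le> val Q (w - \<phi> c)" using l by linarith
    then show ?thesis by blast
  qed auto
qed

text \<open>Let \<open>g\<close> be the greatest common divisor. Then \<open>y ^ (n div g)\<close> differs by a power of a uniformizer
  of \<^term>\<open>P\<close> from a unit whose \<open>g\<close>-th power is in the ground field. So the unit is in the ground field
  itself, and \<open>f\<close> is a \<open>g\<close>-th power.\<close>

lemma kummer_gcd_eq_1:
  assumes p: "prime CHAR('f)" "\<not> CHAR('f) dvd n"
    and y: "y ^ n = \<phi> f" "f \<noteq> 0" and n: "n > 0"
    and not_power: "\<And>d h. d dvd n \<Longrightarrow> d \<ge> 2 \<Longrightarrow> f \<noteq> h ^ d"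
  shows "gcd (int n) (val P f) = 1"
proof (rule ccontr)
  define g where "g = nat (gcd (int n) (val P f))"
  assume "gcd (int n) (val P f) \<noteq> 1"
  moreover have gcd_pos: "gcd (int n) (val P f) > 0" using n by simp
  ultimately have g: "g \<ge> 2" unfolding g_def by linarith
  have int_g: "int g = gcd (int n) (val P f)" using gcd_pos by (simp add: g_def)
  then have "int g dvd int n" "int g dvd val P f" by simp_all
  then obtain d e where d: "n = g * d" and e: "val P f = int g * e" unfolding int_dvd_int_iff by (elim dvdE)
  obtain t where t: "t \<noteq> 0" "val P t = 1" using VP.ex_val_1 by blast
  have y0: "y \<noteq> 0" using y n by (auto simp: power_0_left)
  define w where "w = y ^ d * \<phi> (t powi (- e))"
  define u where "u = f * t powi (- (int g * e))"
  have w0: "w \<noteq> 0" using y0 t by (simp add: w_def)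
  have pow: "(t powi k) ^ g = t powi (int g * k)" for k
    by (simp add: power_int_mult mult.commute)
  then have wg: "w ^ g = \<phi> u"
    using y(1) d pow[of "- e"]
    by (simp add: w_def u_def power_mult_distrib hom_mult mult.commute[of g] flip: power_mult hom_power)
  have "u \<noteq> 0" "val P u = 0" using y(2) t e by (simp_all add: u_def VP.val_mult VP.val_powi)
  then have "val Q (w ^ g) = 0" using wg by (simp add: val_hom)
  then have "val Q w = 0" using w0 g by (simp add: VQ.val_power)
  then have "w \<in> range \<phi>" using radical_unit_in_ground_field[OF p _ w0 wg] d by simp
  then obtain v where v: "w = \<phi> v" by blast
  have "\<phi> (v ^ g) = \<phi> u" using wg v by (simp add: hom_power)
  then have "v ^ g = f * t powi (- (int g * e))" by (simp add: u_def)
  then have "f = v ^ g * t powi (int g * e)"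
    using t by (simp add: power_int_minus)
  also have "t powi (int g * e) = (t powi e) ^ g" by (simp add: pow)
  finally have "f = (v * t powi e) ^ g" by (simp add: power_mult_distrib)
  moreover have "g dvd n" using d by simp
  ultimately show False using not_power g by blast
qed

lemma kummer_degree:
  assumes y: "y ^ n = \<phi> f" "f \<noteq> 0" and n: "n > 0" and gcd: "gcd (int n) (val P f) = 1"
  shows "n dvd N" and "int n * val Q y = int N * val P f"
proof -
  have "y \<noteq> 0" using y n by (auto simp: power_0_left)
  then show eq: "int n * val Q y = int N * val P f"
    using arg_cong[OF y(1), of "val Q"] y(2) by (simp add: VQ.val_power val_hom)
  have "int n dvd int N * val P f" unfolding eq[symmetric] by simp
  then have "int n dvd int N"
    using gcd by (simp add: coprime_dvd_mult_left_iff coprime_iff_gcd_eq_1)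
  then show "n dvd N" by simp
qed

end

section \<open>Kummer extensions\<close>

context field_hom
begin

text \<open>The combinations of the powers form a ring, finite-dimensional over the ground field; the lowest
  term of an algebraic relation of a nonzero element yields its inverse. So this ring is a field.\<close>

lemma radical_coords:
  assumes m: "m > 0" and w: "w ^ m = \<phi> a" and gen: "generated_subfield (insert (inverse w) (range \<phi>)) = UNIV"
  shows "\<exists>c. z = (\<Sum>i<m. \<phi> (c i) * w ^ i)"
proof -
  let ?S = "vs.span ((\<lambda>i. w ^ i) ` {..<m})"
  interpret A: subring_of_field "range \<phi>"
  proof
    show "1 \<in> range \<phi>" by (rule range_eqI[of _ _ 1]) simp
    fix x y assume "x \<in> range \<phi>" "y \<in> range \<phi>"
    then obtain c d where "x = \<phi> c" "y = \<phi> d" by blast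
    then show "x - y \<in> range \<phi>" "x * y \<in> range \<phi>" by (simp_all flip: hom_diff hom_mult)
  qed
  let ?W = "A.adjoin w"
  interpret W: subring_of_field ?W by (rule A.subring_adjoin)
  have pow: "w ^ i \<in> ?S" for i
  proof -
    have "w ^ i = w ^ (m * (i div m) + i mod m)" by simp
    also have "\<dots> = \<phi> (a ^ (i div m)) * w ^ (i mod m)"
      by (simp only: power_add power_mult w hom_power)
    also have "\<dots> \<in> ?S" using m by (intro vs.span_scale vs.span_base) auto
    finally show ?thesis .
  qed
  have W_sub: "?W \<subseteq> ?S"
  proof
    fix x assume "x \<in> ?W"
    then obtain p where p: "x = poly p w" "\<forall>i. coeff p i \<in> range \<phi>" unfolding A.adjoin_def by blast
    have "coeff p i * w ^ i \<in> ?S" for i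
    proof -
      obtain c where "coeff p i = \<phi> c" using p(2) by blast
      then show ?thesis using vs.span_scale[OF pow] by simp
    qed
    then show "x \<in> ?S" unfolding p(1) poly_altdef by (intro vs.span_sum)
  qed
  have W_inverse: "inverse x \<in> ?W" if x: "x \<in> ?W" for x
  proof (cases "x = 0")
    case False
    have "\<not> independent_family (\<lambda>i. x ^ i) {..m}"
    proof
      assume "independent_family (\<lambda>i. x ^ i) {..m}"
      then have ind: "inj_on (\<lambda>i. x ^ i) {..m}" "vs.independent ((\<lambda>i. x ^ i) ` {..m})"
        using independent_family_iff[of "{..m}"] by auto
      have "(\<lambda>i. x ^ i) ` {..m} \<subseteq> ?S" using W_sub W.power[OF x] by blast
      then have "card ((\<lambda>i. x ^ i) ` {..m}) \<le> card ((\<lambda>i. w ^ i) ` {..<m})"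
        using vs.independent_span_bound[OF _ ind(2), of "(\<lambda>i. w ^ i) ` {..<m}"] by auto
      also have "\<dots> \<le> m" using card_image_le[of "{..<m}" "\<lambda>i. w ^ i"] by simp
      finally show False using ind(1) by (simp add: card_image)
    qed
    then obtain c where c: "(\<Sum>i\<le>m. \<phi> (c i) * x ^ i) = 0" "\<exists>i\<le>m. c i \<noteq> 0"
      unfolding independent_family_def by auto
    define j where "j = (LEAST i. c i \<noteq> 0)"
    have j: "c j \<noteq> 0" "j \<le> m" and below: "\<And>i. i < j \<Longrightarrow> c i = 0"
    proof -
      obtain i where i: "i \<le> m" "c i \<noteq> 0" using c(2) by blast
      show "c j \<noteq> 0" unfolding j_def using i(2) by (rule LeastI)
      have "j \<le> i" unfolding j_def using i(2) by (rule Least_le)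
      then show "j \<le> m" using i by simp
      show "\<And>i. i < j \<Longrightarrow> c i = 0" unfolding j_def using not_less_Least by blast
    qed
    let ?g = "\<Sum>i\<in>{Suc j..m}. \<phi> (c i / c j) * x ^ (i - Suc j)"
    have "0 = (\<Sum>i\<in>{j..m}. \<phi> (c i) * x ^ i)"
      unfolding c(1)[symmetric] using below by (intro sum.mono_neutral_right) auto
    also have "\<dots> = \<phi> (c j) * x ^ j + (\<Sum>i\<in>{Suc j..m}. \<phi> (c i) * x ^ i)"
      using j by (simp add: sum.atLeast_Suc_atMost)
    also have "(\<Sum>i\<in>{Suc j..m}. \<phi> (c i) * x ^ i) = \<phi> (c j) * x ^ j * (x * ?g)"
      unfolding sum_distrib_left
    proof (rule sum.cong)
      fix i assume "i \<in> {Suc j..m}"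
      then have "x ^ i = x ^ j * (x * x ^ (i - Suc j))"
        by (simp flip: power_Suc power_add)
      moreover have "\<phi> (c i) = \<phi> (c j) * \<phi> (c i / c j)" using j by (simp add: hom_divide)
      ultimately show "\<phi> (c i) * x ^ i = \<phi> (c j) * x ^ j * (x * (\<phi> (c i / c j) * x ^ (i - Suc j)))"
        by (simp add: mult_ac)
    qed simp
    finally have "\<phi> (c j) * x ^ j * (1 + x * ?g) = 0" by (simp add: distrib_left)
    then have "1 + x * ?g = 0" using j False by simp
    then have "x * (- ?g) = 1" by (simp add: add_eq_0_iff)
    then have "inverse x = - ?g" by (rule inverse_unique)
    moreover have "?g \<in> ?W" using x A.subset_adjoin[of w] by (intro W.sum W.mult W.power) auto
    ultimately show ?thesis by (simp add: W.minus)
  qed (simp add: W.zero)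
  have "is_subfield ?W"
    unfolding is_subfield_def using W.one W.diff W.mult W_inverse by blast
  moreover have "insert (inverse w) (range \<phi>) \<subseteq> ?W"
    using W_inverse[OF A.mem_adjoin] A.subset_adjoin[of w] by auto
  ultimately have "generated_subfield (insert (inverse w) (range \<phi>)) \<subseteq> ?W"
    unfolding generated_subfield_def by blast
  then have "z \<in> ?S" using gen W_sub by blast
  then show ?thesis using span_familyE[of "{..<m}" z "\<lambda>i. w ^ i"] by simp
qed

end

locale kummer_extension = function_field_extension \<phi> "\<lambda>i. w ^ i" m \<iota>
  for \<phi> :: "'e::field \<Rightarrow> 'f::field" and w m and \<iota> :: "'k::field \<Rightarrow> 'e" +
  fixes f
  assumes m_pos: "m > 0" and w_power: "w ^ m = \<phi> (inverse f)" and f_nz: "f \<noteq> 0"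
    and independent: "independent_family (\<lambda>i. w ^ i) {..<m}"
    and char: "prime CHAR('f)" "\<not> CHAR('f) dvd m"
begin

lemma w_nz: "w \<noteq> 0"
  using w_power f_nz m_pos by (auto simp: power_0_left)

text \<open>For \<open>l\<close> a power of the characteristic congruent to 1 modulo \<^term>\<open>m\<close>, the coordinates of
  \<open>z ^ l\<close> are the \<open>l\<close>-th powers of those of \<open>z\<close> up to powers of \<^term>\<open>f\<close>. As \<open>z\<close> is integral,
  the coordinates of all its powers have bounded denominators. Letting \<open>l\<close> grow, each term
  \<open>\<phi> (c i) * w ^ i\<close> has nonnegative value, which is the inequality.\<close>

lemma coords_of_regular_element:
  assumes P: "P \<in> places \<iota>"
    and z: "\<And>Q. Q \<in> places_above \<Longrightarrow> \<phi> -` Q = P \<Longrightarrow> z \<in> place_ring Q"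
    and c: "z = (\<Sum>i<m. \<phi> (c i) * w ^ i)" and i: "i < m" "c i \<noteq> 0"
  shows "int m * val P (c i) - int i * val P f \<ge> 0"
proof (rule ccontr)
  interpret P: discrete_place P by (rule discrete[OF P])
  let ?p = "CHAR('f)"
  obtain d where d: "\<And>l. \<exists>r. (\<forall>j. r j \<in> place_ring P) \<and> z ^ l = (\<Sum>j\<le>d. \<phi> (r j) * z ^ j)"
    using powers_of_regular_element[OF P z] by blast
  have "\<forall>j. \<exists>a. z ^ j = (\<Sum>i<m. \<phi> (a i) * w ^ i)" using ex_coords by blast
  from choice[OF this] obtain C where C: "\<And>j. z ^ j = (\<Sum>i<m. \<phi> (C j i) * w ^ i)" by blast
  \<comment> \<open>bounds the denominators of the \<^term>\<open>i\<close>-th coordinates of the first powers of \<^term>\<open>z\<close>, hence of all\<close>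
  define B where "B = (\<Sum>j\<le>d. \<bar>val P (C j i)\<bar>)"
  have B: "- B \<le> val P (C j i)" if "j \<le> d" for j
  proof -
    have "\<bar>val P (C j i)\<bar> \<le> B" unfolding B_def using that by (intro member_le_sum) auto
    then show ?thesis by linarith
  qed
  define x where "x = int m * val P (c i) - int i * val P f"
  assume "\<not> 0 \<le> int m * val P (c i) - int i * val P f"
  then have x: "x \<le> - 1" by (simp add: x_def)
  define k where "k = Suc (nat (\<bar>int i * val P f\<bar> + int m * B))"
  have B0: "B \<ge> 0" by (simp add: B_def sum_nonneg)
  define l where "l = ?p ^ (totient m * k)"
  have p1: "?p > 1" using char(1) prime_gt_1_nat by blast
  have "totient m \<ge> 1" using m_pos by (simp add: Suc_le_eq)
  then have "k \<le> totient m * k" by simp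
  also have "\<dots> < l" unfolding l_def using p1 by (intro power_gt_expt) auto
  finally have l: "int l > \<bar>int i * val P f\<bar> + int m * B" "l > 0" by (auto simp: k_def)
  have "coprime ?p m" using char prime_imp_coprime by blast
  then have "[?p ^ totient m = 1] (mod m)" by (rule euler_theorem)
  then have "[(?p ^ totient m) ^ k = 1 ^ k] (mod m)" by (rule cong_pow)
  then have "[l = 1] (mod m)" by (simp add: l_def power_mult)
  then have "m dvd l - 1" using l by (simp add: cong_altdef_nat)
  then obtain q where q: "l = m * q + 1" using l by (metis Suc_eq_plus1 Suc_pred' dvdE One_nat_def)
  obtain r where r: "\<forall>j. r j \<in> place_ring P" "z ^ l = (\<Sum>j\<le>d. \<phi> (r j) * z ^ j)" using d by blast
  have "z ^ l = (\<Sum>j<m. (\<phi> (c j) * w ^ j) ^ l)"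
    unfolding c by (rule freshmans_dream_sum'[OF char(1)]) (simp add: l_def)
  also have "\<dots> = (\<Sum>j<m. \<phi> (c j ^ l / f ^ (j * q)) * w ^ j)"
  proof (rule sum.cong)
    fix j
    have "w ^ (j * l) = (w ^ m) ^ (j * q) * w ^ j"
      unfolding q by (simp add: algebra_simps flip: power_mult power_add)
    then show "(\<phi> (c j) * w ^ j) ^ l = \<phi> (c j ^ l / f ^ (j * q)) * w ^ j"
      by (simp add: w_power power_mult_distrib hom_mult hom_power hom_inverse divide_inverse power_inverse flip: power_mult)
  qed simp
  finally have zl: "z ^ l = (\<Sum>j<m. \<phi> (c j ^ l / f ^ (j * q)) * w ^ j)" .
  have "z ^ l = (\<Sum>j\<le>d. \<phi> (r j) * (\<Sum>i<m. \<phi> (C j i) * w ^ i))"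
    unfolding C[symmetric] by (rule r(2))
  also have "\<dots> = (\<Sum>j\<le>d. \<Sum>i<m. \<phi> (r j * C j i) * w ^ i)"
    by (simp only: sum_distrib_left hom_mult mult.assoc)
  also have "\<dots> = (\<Sum>i<m. \<phi> (\<Sum>j\<le>d. r j * C j i) * w ^ i)"
    by (subst sum.swap) (simp only: hom_sum sum_distrib_right)
  finally have "c i ^ l / f ^ (i * q) = (\<Sum>j\<le>d. r j * C j i)"
    using zl by (intro independent_family_coords_eq[OF independent _ , of _ _ i]) (use i in auto)
  moreover have "c i ^ l / f ^ (i * q) \<noteq> 0" using i f_nz by simp
  moreover have "- B \<le> val P (\<Sum>j\<le>d. r j * C j i)" if "(\<Sum>j\<le>d. r j * C j i) \<noteq> 0"
  proof (rule P.val_sum_ge[OF _ _ that])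
    fix j assume j: "j \<in> {..d}" "r j * C j i \<noteq> 0"
    then have "val P (r j) \<ge> 0" using r(1) by (auto simp: P.mem_place_ring_iff)
    then show "- B \<le> val P (r j * C j i)" using B[of j] j by (simp add: P.val_mult)
  qed simp
  ultimately have "- B \<le> val P (c i ^ l / f ^ (i * q))" by simp
  also have "\<dots> = int l * val P (c i) - int i * int q * val P f"
    using i f_nz by (simp add: P.val_divide P.val_power)
  finally have "int m * (- B) \<le> int m * (int l * val P (c i) - int i * int q * val P f)"
    by (intro mult_left_mono) auto
  also have "\<dots> = int l * x + int i * val P f"
    unfolding x_def q by (simp add: algebra_simps)
  also have "int l * x \<le> int l * (- 1)" using x by (intro mult_left_mono) auto
  finally show False using l by linarith
qed

lemma val_w:
  assumes Q: "Q \<in> places_above"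
  shows "int m * val Q w = - int (ramification_index \<phi> Q (\<phi> -` Q)) * val (\<phi> -` Q) f"
proof -
  interpret Q: discrete_place Q by (rule place_above(1)[OF Q])
  interpret P: discrete_place "\<phi> -` Q" by (rule discrete[OF restricted_place(1)[OF Q]])
  have "val Q (w ^ m) = val Q (\<phi> (inverse f))" by (simp only: w_power)
  then show ?thesis using w_nz f_nz ramification_index(2)[OF Q, of "inverse f"]
    by (simp add: Q.val_power P.val_inverse)
qed

lemma val_term:
  assumes Q: "Q \<in> places_above" and c: "c \<noteq> 0"
  shows "int m * val Q (\<phi> c * w ^ i) =
    int (ramification_index \<phi> Q (\<phi> -` Q)) * (int m * val (\<phi> -` Q) c - int i * val (\<phi> -` Q) f)"
proof -
  interpret Q: discrete_place Q by (rule place_above(1)[OF Q])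
  let ?e = "int (ramification_index \<phi> Q (\<phi> -` Q))"
  have "val Q (\<phi> c * w ^ i) = ?e * val (\<phi> -` Q) c + int i * val Q w"
    using c w_nz ramification_index(2)[OF Q c] by (simp add: Q.val_mult Q.val_power)
  then have "int m * val Q (\<phi> c * w ^ i) = ?e * (int m * val (\<phi> -` Q) c) + int i * (int m * val Q w)"
    by (simp add: algebra_simps)
  then show ?thesis unfolding val_w[OF Q] by (simp add: algebra_simps)
qed

text \<open>The divisors \<open>\<delta>\<close> above and \<open>a\<close> below correspond to each other at totally ramified places and vanish
  elsewhere. At a totally ramified place the terms of different index have different values, so that each term is
  as regular as the sum; at the other places this is the integrality argument above.\<close>

lemma riemann_roch_coords:
  fixes \<delta> :: "'f set \<Rightarrow> int" and a :: "'e set \<Rightarrow> int"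
  assumes div: "\<And>P. P \<in> places \<iota> \<Longrightarrow>
      (a P = 0 \<and> (\<forall>Q\<in>places_above. \<phi> -` Q = P \<longrightarrow> \<delta> Q = 0)) \<or>
      (\<exists>Q\<in>places_above. \<phi> -` Q = P \<and> (\<forall>Q'\<in>places_above. \<phi> -` Q' = P \<longrightarrow> Q' = Q) \<and>
        ramification_index \<phi> Q P = m \<and> gcd (int m) (val P f) = 1 \<and> \<delta> Q = a P)"
    and c: "z = (\<Sum>i<m. \<phi> (c i) * w ^ i)"
  shows "(\<forall>Q\<in>places_above. z = 0 \<or> val Q z + \<delta> Q \<ge> 0) \<longleftrightarrow>
    (\<forall>i<m. \<forall>P\<in>places \<iota>. c i = 0 \<or> val P (c i) + (a P - int i * val P f) div int m \<ge> 0)"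
    (is "?L \<longleftrightarrow> ?R")
proof -
  have div_iff: "v + x div int m \<ge> 0 \<longleftrightarrow> int m * v + x \<ge> 0" for v x
  proof -
    have eq: "v + x div int m = (int m * v + x) div int m" using m_pos by simp
    show ?thesis unfolding eq by (rule pos_imp_zdiv_nonneg_iff) (use m_pos in simp)
  qed
  show ?thesis
  proof
    assume R: ?R
    show ?L
    proof (intro ballI)
      fix Q assume Q: "Q \<in> places_above"
      interpret Q: discrete_place Q by (rule place_above(1)[OF Q])
      let ?P = "\<phi> -` Q"
      let ?e = "int (ramification_index \<phi> Q ?P)"
      note P = restricted_place(1)[OF Q]
      have \<delta>: "?e * a ?P = int m * \<delta> Q" using div[OF P] Q by auto
      show "z = 0 \<or> val Q z + \<delta> Q \<ge> 0"
      proof (cases "z = 0")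
        case False
        have "- \<delta> Q \<le> val Q (\<Sum>i<m. \<phi> (c i) * w ^ i)"
        proof (rule Q.val_sum_ge)
          fix i assume i: "i \<in> {..<m}" "\<phi> (c i) * w ^ i \<noteq> 0"
          then have ci: "c i \<noteq> 0" by auto
          then have "int m * val ?P (c i) + (a ?P - int i * val ?P f) \<ge> 0" using R i P div_iff by auto
          then have "0 \<le> ?e * (int m * val ?P (c i) + (a ?P - int i * val ?P f))" by simp
          also have "\<dots> = ?e * (int m * val ?P (c i) - int i * val ?P f) + ?e * a ?P"
            by (simp add: algebra_simps)
          also have "\<dots> = int m * (val Q (\<phi> (c i) * w ^ i) + \<delta> Q)"
            unfolding \<delta> val_term[OF Q ci, symmetric] by (simp add: distrib_left)
          finally show "- \<delta> Q \<le> val Q (\<phi> (c i) * w ^ i)" using m_pos by (simp add: zero_le_mult_iff)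
        qed (use False c in auto)
        then show ?thesis using c by simp
      qed simp
    qed
  next
    assume L: ?L
    show ?R
    proof (intro allI impI ballI)
      fix i P assume i: "i < m" and P: "P \<in> places \<iota>"
      show "c i = 0 \<or> val P (c i) + (a P - int i * val P f) div int m \<ge> 0"
      proof (cases "c i = 0")
        case ci: False
        from div[OF P] show ?thesis
        proof
          assume *: "a P = 0 \<and> (\<forall>Q\<in>places_above. \<phi> -` Q = P \<longrightarrow> \<delta> Q = 0)"
          have "z \<in> place_ring Q" if "Q \<in> places_above" "\<phi> -` Q = P" for Q
            using L * that discrete_place.mem_place_ring_iff[OF place_above(1)[OF that(1)]] by fastforce
          then have "int m * val P (c i) - int i * val P f \<ge> 0"
            by (rule coords_of_regular_element[OF P _ c i ci])
          then show ?thesis using * div_iff by simp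
        next
          assume "\<exists>Q\<in>places_above. \<phi> -` Q = P \<and> (\<forall>Q'\<in>places_above. \<phi> -` Q' = P \<longrightarrow> Q' = Q) \<and>
            ramification_index \<phi> Q P = m \<and> gcd (int m) (val P f) = 1 \<and> \<delta> Q = a P"
          then obtain Q where Q: "Q \<in> places_above" "\<phi> -` Q = P" "ramification_index \<phi> Q P = m"
              "gcd (int m) (val P f) = 1" "\<delta> Q = a P" by (elim bexE conjE)
          interpret Q: discrete_place Q by (rule place_above(1)[OF Q(1)])
          define I where "I = {i. i < m \<and> c i \<noteq> 0}"
          let ?z = "\<lambda>i. \<phi> (c i) * w ^ i"
          have val: "val Q (?z j) = int m * val P (c j) - int j * val P f" if "c j \<noteq> 0" for j
            using val_term[OF Q(1) that, of j] Q m_pos by simp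
          have inj: "inj_on (\<lambda>i. val Q (?z i)) I"
          proof (rule inj_onI)
            fix j k assume jk: "j \<in> I" "k \<in> I" "val Q (?z j) = val Q (?z k)"
            then have "int m * val P (c j) - int j * val P f = int m * val P (c k) - int k * val P f"
              using val[of j] val[of k] by (simp add: I_def)
            then have "(int j - int k) * val P f = int m * (val P (c j) - val P (c k))"
              by (simp add: algebra_simps)
            then have "int m dvd (int j - int k) * val P f" by simp
            then have "int m dvd int j - int k"
              using Q(4) by (simp add: coprime_dvd_mult_left_iff coprime_iff_gcd_eq_1)
            then have "int j mod int m = int k mod int m" by (simp add: mod_eq_dvd_iff)
            then show "j = k" using jk by (simp add: I_def)
          qed
          have zI: "z = sum ?z I"
            unfolding c by (intro sum.mono_neutral_right) (auto simp: I_def)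
          have "i \<in> I" "finite I" using i ci by (auto simp: I_def)
          moreover have "?z j \<noteq> 0" if "j \<in> I" for j using that w_nz by (simp add: I_def)
          ultimately have "z \<noteq> 0 \<and> val Q z \<le> val Q (?z i)"
            unfolding zI using Q.val_sum_distinct[of I ?z] inj by blast
          then have "int m * val P (c i) - int i * val P f + a P \<ge> 0"
            using L Q val[OF ci] by force
          then show ?thesis using div_iff by (simp add: algebra_simps)
        qed
      qed simp
    qed
  qed
qed

end

section \<open>Dimension count\<close>

lemma field_hom_rat_const: "field_hom rat_const"
proof
  have "rat_const (a + b) = rat_const a + rat_const b" for a b :: 'a
    unfolding rat_const_def by (simp flip: to_fract_add)
  moreover have "rat_const (a * b) = rat_const a * rat_const b" for a b :: 'a
    unfolding rat_const_def by (simp flip: to_fract_mult)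
  moreover have "rat_const 1 = 1" unfolding rat_const_def by (simp flip: one_pCons)
  ultimately show "field_embedding (rat_const :: 'a \<Rightarrow> _)" by (simp add: field_embedding_def)
qed

lemma range_rat_const: "range (rat_const :: 'k::field \<Rightarrow> _) \<noteq> UNIV"
proof -
  have "ratX \<noteq> rat_const c" for c :: 'k by (simp add: rat_const_def)
  then show ?thesis by (metis UNIV_I image_iff)
qed

lemma prime_CHAR_finite_field: "prime CHAR('a::{field,finite})"
  by (rule prime_CHAR_semidom) (simp add: finite_imp_CHAR_pos)

lemma (in field_hom) CHAR_eq: "CHAR('f) = CHAR('e)"
proof (rule dvd_antisym)
  have nat: "\<phi> (of_nat n) = of_nat n" for n
    by (induction n) (auto simp: hom_add)
  have "of_nat n = (0 :: 'f) \<longleftrightarrow> of_nat n = (0 :: 'e)" for n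
    using hom_eq_0_iff[of "of_nat n"] by (simp only: nat)
  then have "CHAR('f) dvd n \<longleftrightarrow> CHAR('e) dvd n" for n
    by (simp only: of_nat_eq_0_iff_char_dvd)
  from this[of "CHAR('e)"] this[of "CHAR('f)"]
  show "CHAR('f) dvd CHAR('e)" "CHAR('e) dvd CHAR('f)" by simp_all
qed

text \<open>The elements \<open>\<phi> (h i * x ^ j) * v i\<close> with \<open>j \<le> D i\<close> form a basis over the constants.\<close>

lemma extension_dim_poly_coords:
  fixes \<phi> :: "'k::field poly fract \<Rightarrow> 'f::field" and v :: "nat \<Rightarrow> 'f" and D :: "nat \<Rightarrow> int"
  assumes \<phi>: "field_hom \<phi>" and ind: "field_hom.independent_family \<phi> v {..<m}" and h: "\<And>i. h i \<noteq> 0"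
  shows "extension_dim (\<phi> \<circ> rat_const)
      {\<Sum>i<m. \<phi> (c i) * v i | c. \<forall>i<m. \<exists>g. c i = h i * to_fract g \<and> (g = 0 \<or> int (degree g) \<le> D i)} =
    (\<Sum>i<m. nat (D i + 1))"
proof -
  interpret field_hom \<phi> by (fact \<phi>)
  interpret \<rho>: field_hom "rat_const :: 'k \<Rightarrow> _" by (rule field_hom_rat_const)
  interpret \<iota>: field_hom "\<phi> \<circ> (rat_const :: 'k \<Rightarrow> _)"
    by unfold_locales
      (simp add: field_embedding_def hom_add hom_mult \<rho>.hom_add \<rho>.hom_mult)
  let ?n = "\<lambda>i. nat (D i + 1)"
  define I where "I = Sigma {..<m} (\<lambda>i. {..<?n i})"
  define u where "u = (\<lambda>(i, j). \<phi> (h i * to_fract (monom 1 j)) * v i)"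
  define G where "G C i = (\<Sum>j<?n i. monom (C (i, j)) j)" for C :: "nat \<times> nat \<Rightarrow> 'k" and i
  have coeff_G: "coeff (G C i) j = (if j < ?n i then C (i, j) else 0)" for C i j
    unfolding G_def coeff_sum by (simp add: sum.delta)
  have sum_eq: "(\<Sum>x\<in>I. (\<phi> \<circ> rat_const) (C x) * u x) = (\<Sum>i<m. \<phi> (h i * to_fract (G C i)) * v i)" for C
  proof -
    have mon: "rat_const k * to_fract (monom 1 j) = to_fract (monom k j)" for k :: 'k and j
    proof -
      have "[:k:] * monom 1 j = monom k j" by (simp add: smult_monom)
      then show ?thesis unfolding rat_const_def by (metis to_fract_mult)
    qed
    have one: "(\<phi> \<circ> rat_const) (C (i, j)) * u (i, j) = \<phi> (h i * to_fract (monom (C (i, j)) j)) * v i" for i j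
      unfolding mon[of "C (i, j)" j, symmetric] u_def by (simp only: comp_apply prod.case hom_mult mult_ac)
    have "(\<Sum>x\<in>I. (\<phi> \<circ> rat_const) (C x) * u x) =
        (\<Sum>i<m. \<Sum>j<?n i. (\<phi> \<circ> rat_const) (C (i, j)) * u (i, j))"
      unfolding I_def by (subst sum.Sigma) auto
    also have "\<dots> = (\<Sum>i<m. \<phi> (h i * to_fract (G C i)) * v i)"
      unfolding one G_def to_fract_sum sum_distrib_left hom_sum sum_distrib_right ..
    finally show ?thesis .
  qed
  have ind': "\<iota>.independent_family u I"
    unfolding \<iota>.independent_family_def sum_eq
  proof (intro allI impI ballI)
    fix C x assume 0: "(\<Sum>i<m. \<phi> (h i * to_fract (G C i)) * v i) = 0" and x: "x \<in> I"
    obtain i j where ij: "x = (i, j)" "i < m" "j < ?n i" using x by (auto simp: I_def)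
    have "h i * to_fract (G C i) = 0" using independent_familyD[OF ind 0, of i] ij by simp
    then have "G C i = 0" using h by simp
    then show "C x = 0" using coeff_G[of C i j] ij by simp
  qed
  have "{\<Sum>i<m. \<phi> (c i) * v i | c. \<forall>i<m. \<exists>g. c i = h i * to_fract g \<and> (g = 0 \<or> int (degree g) \<le> D i)} =
      {\<Sum>x\<in>I. (\<phi> \<circ> rat_const) (C x) * u x | C. True}" (is "?V = ?V'")
  proof
    show "?V \<subseteq> ?V'"
    proof
      fix z assume "z \<in> ?V"
      then obtain c where c: "z = (\<Sum>i<m. \<phi> (c i) * v i)"
          "\<forall>i<m. \<exists>g. c i = h i * to_fract g \<and> (g = 0 \<or> int (degree g) \<le> D i)" by blast
      then have "\<forall>i. \<exists>g. i < m \<longrightarrow> c i = h i * to_fract g \<and> (g = 0 \<or> int (degree g) \<le> D i)" by blast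
      from choice[OF this] obtain g where
        g: "\<And>i. i < m \<Longrightarrow> c i = h i * to_fract (g i)" "\<And>i. i < m \<Longrightarrow> g i = 0 \<or> int (degree (g i)) \<le> D i"
        by blast
      define C where "C = (\<lambda>(i, j). coeff (g i) j)"
      have "G C i = g i" if "i < m" for i
      proof (rule poly_eqI)
        fix j show "coeff (G C i) j = coeff (g i) j"
        proof (cases "j < ?n i")
          case False
          have "g i = 0 \<or> degree (g i) < j" using False g(2)[OF that] by auto
          then have "coeff (g i) j = 0" by (auto intro: coeff_eq_0)
          then show ?thesis using False by (simp add: coeff_G)
        qed (simp add: coeff_G C_def)
      qed
      then have "z = (\<Sum>i<m. \<phi> (h i * to_fract (G C i)) * v i)"
        unfolding c(1) using g(1) by (intro sum.cong) auto
      then show "z \<in> ?V'" unfolding sum_eq by blast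
    qed
    show "?V' \<subseteq> ?V"
    proof
      fix z assume "z \<in> ?V'"
      then obtain C where z: "z = (\<Sum>i<m. \<phi> (h i * to_fract (G C i)) * v i)" unfolding sum_eq by blast
      have "G C i = 0 \<or> int (degree (G C i)) \<le> D i" for i
      proof (cases "G C i = 0")
        case False
        then have "coeff (G C i) (degree (G C i)) \<noteq> 0" by simp
        then have "degree (G C i) < ?n i" unfolding coeff_G by (auto split: if_splits)
        then have "int (degree (G C i)) < D i + 1" by (simp only: zless_nat_eq_int_zless)
        then show ?thesis by linarith
      qed simp
      then show "z \<in> ?V" unfolding z
        by (intro CollectI exI[of _ "\<lambda>i. h i * to_fract (G C i)"] conjI) blast+
    qed
  qed
  then have "extension_dim (\<phi> \<circ> rat_const) ?V = card I"
    using \<iota>.extension_dim_eq_card[OF _ ind'] by (simp add: I_def)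
  then show ?thesis by (simp add: I_def)
qed

lemma split_poly_zero_place:
  fixes f p :: "'k::field poly"
  assumes split: "\<forall>z. poly (map_poly to_ac f) z = 0 \<longrightarrow> z \<in> range (to_ac :: 'k \<Rightarrow> 'k alg_closure)"
    and p: "irreducible p" and dvd: "p dvd f"
  shows "\<exists>c. finite_place p = linear_place c"
proof -
  interpret ac: field_hom "to_ac :: 'k \<Rightarrow> 'k alg_closure"
    by unfold_locales (simp add: field_embedding_def)
  have mult: "map_poly to_ac (a * b) = map_poly to_ac a * map_poly (to_ac :: 'k \<Rightarrow> 'k alg_closure) b" for a b
    by (intro poly_eqI) (simp add: coeff_map_poly coeff_mult to_ac_sum)
  have eval: "poly (map_poly to_ac a) (to_ac c) = to_ac (poly a c)" for a and c :: 'k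
    by (induction a) (auto simp: map_poly_pCons)
  have "degree (map_poly (to_ac :: 'k \<Rightarrow> 'k alg_closure) p) > 0"
    using irreducible_poly_degree[OF p] by (simp add: degree_map_poly)
  then obtain z where z: "poly (map_poly (to_ac :: 'k \<Rightarrow> 'k alg_closure) p) z = 0"
    using alg_closed_imp_poly_has_root by blast
  then have "poly (map_poly to_ac f) z = 0" using dvd by (auto simp: mult)
  then obtain c where "z = to_ac c" using split by blast
  then have "poly p c = 0" using z by (simp add: eval)
  then have "[:- c, 1:] dvd p" by (simp add: poly_eq_0_iff_dvd)
  then have "finite_place [:- c, 1:] = finite_place p"
    using p by (intro finite_place_eqI irreducible_linear_field_poly) auto
  then show ?thesis by metis
qed

lemma zero_or_pole_of_split_poly:
  fixes f :: "'k::field poly"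
  assumes split: "\<forall>z. poly (map_poly to_ac f) z = 0 \<longrightarrow> z \<in> range (to_ac :: 'k \<Rightarrow> 'k alg_closure)"
    and P: "P \<in> places rat_const" and val: "val P (to_fract f) \<noteq> 0"
  shows "P = infinite_place \<or> P \<in> range linear_place"
proof (cases "P = infinite_place")
  case False
  then obtain p where p: "irreducible p" "P = finite_place p" using rational_function_field_places[OF P] by blast
  then have "p dvd f" using val_finite_place(3)[OF p(1)] val by blast
  then show ?thesis using split_poly_zero_place[OF split p(1)] p(2) by auto
qed simp

text \<open>Here \<open>- ((- x) div m)\<close> is the ceiling of \<open>x / m\<close>; it exceeds the floor by one.\<close>

lemma div_minus_eq:
  fixes x a m :: int
  assumes "m > 0" "\<not> m dvd x"
  shows "(a - x) div m = 1 + (- x) div m + (a - x mod m) div m"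
proof -
  have "a - x = (a - x mod m) + m * (- (x div m))"
    using mult_div_mod_eq[of m x] by (simp add: algebra_simps)
  then have "(a - x) div m = (a - x mod m) div m - x div m"
    using assms(1) by (metis add_uminus_conv_diff div_mult_self2 less_irrefl add.commute)
  moreover have "(- x) div m = - (x div m) - 1"
    using assms by (subst zdiv_zminus1_eq_if) (auto simp: mod_eq_0_iff_dvd)
  ultimately show ?thesis by simp
qed

theorem theorem3p1:
  fixes f :: "'a::{field,finite} poly"
    and m n r :: nat
    and \<phi> :: "'a poly fract \<Rightarrow> 'f::field"
    and y :: 'f
    and P :: "nat \<Rightarrow> 'a poly fract set"
    and Q :: "nat \<Rightarrow> 'f set"
    and lam \<alpha> :: "nat \<Rightarrow> int"
  assumes "m \<ge> 2"
    and "\<not> CHAR('a) dvd m"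
    and "degree f \<ge> 2"
    and "\<forall>z. poly (map_poly to_ac f) z = 0 \<longrightarrow> z \<in> range (to_ac :: 'a \<Rightarrow> 'a alg_closure)"
    and "\<forall>d. d dvd m \<and> d \<ge> 2 \<longrightarrow> \<not> (\<exists>h :: 'a poly fract. to_fract f = h ^ d)"
    and "field_embedding \<phi>"
    and "y ^ m = \<phi> (to_fract f)"
    and "generated_subfield (insert y (range \<phi>)) = UNIV"
    and "genus (\<phi> \<circ> rat_const) \<ge> 1"
    and "bij_betw P {1..r}
           {R \<in> places rat_const. val R (to_fract f) > 0 \<or> val R (to_fract f) < 0}"
    and "\<forall>k\<in>{1..r}. lam k = val (P k) (to_fract f)"
    and "n \<le> r"
    and "\<forall>k\<in>{1..n}. totally_ramified rat_const \<phi> (P k)"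
    and "\<forall>k\<in>{1..n}. Q k \<in> places (\<phi> \<circ> rat_const) \<and> lies_over \<phi> (Q k) (P k)"
    and "inj_on Q {1..n}"
    and "2 \<le> n" and "n \<le> CARD('a)"
  shows "int (ell (\<phi> \<circ> rat_const) (\<Sum>k=1..n. frag_cmul (\<alpha> k) (frag_of (Q k)))) =
           max 0 (1 + (\<Sum>k=1..n. \<lfloor>real_of_int (\<alpha> k) / real m\<rfloor>)) +
           (\<Sum>i=1..m-1. max 0 (int n - kummer_beta m r lam i +
              (\<Sum>k=1..n. \<lfloor>real_of_int (\<alpha> k - kummer_t m lam k i) / real m\<rfloor>)))"
proof -
  interpret field_hom \<phi> by unfold_locales (fact assms(6))
  let ?F = "to_fract f"
  have m: "m > 0" using assms(1) by simp
  have F: "?F \<noteq> 0" using assms(3) by auto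
  \<comment> \<open>negative powers of \<^term>\<open>y\<close>, so that \<open>i\<close> times the order of \<^term>\<open>f\<close> is subtracted from
    \<open>\<alpha> k\<close>, as in the formula\<close>
  define w where "w = inverse y"
  have wm: "w ^ m = \<phi> (inverse ?F)"
    unfolding w_def power_inverse assms(7) hom_inverse ..
  have "\<exists>c. z = (\<Sum>i<m. \<phi> (c i) * w ^ i)" for z
    by (rule radical_coords[OF m wm]) (simp add: w_def assms(8))
  then have finite_ext: "finite_extension \<phi> (\<lambda>i. w ^ i) m" by unfold_locales
  interpret ext: function_field_extension \<phi> "\<lambda>i. w ^ i" m rat_const
    by (intro function_field_extension.intro function_field_extension_axioms.intro finite_ext
        field_hom.field_embedding[OF field_hom_rat_const] range_rat_const
        discrete_place_rational_function_field)
  have CHAR: "CHAR('f) = CHAR('a)"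
    using CHAR_eq field_hom.CHAR_eq[OF field_hom_rat_const] by simp
  have char: "prime CHAR('f)" "\<not> CHAR('f) dvd m"
    unfolding CHAR using assms(2) by (simp_all add: prime_CHAR_finite_field)

  have P: "P k \<in> places rat_const" "val (P k) ?F \<noteq> 0" if "k \<in> {1..r}" for k
  proof -
    have "P k \<in> {R \<in> places rat_const. val R ?F > 0 \<or> val R ?F < 0}"
      using bij_betwE[OF assms(10)] that by blast
    then show "P k \<in> places rat_const" "val (P k) ?F \<noteq> 0" by auto
  qed
  have P_eq: "P k = infinite_place \<or> P k \<in> range linear_place" if "k \<in> {1..r}" for k
    using zero_or_pole_of_split_poly[OF assms(4)] P[OF that] by blast
  have P_image: "P ` {1..r} = {R \<in> places rat_const. val R ?F \<noteq> 0}"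
    using bij_betw_imp_surj_on[OF assms(10)] by auto
  have P_inj: "inj_on P {1..r}" using assms(10) by (rule bij_betw_imp_inj_on)
  have sub: "k \<in> {1..r}" if "k \<in> {1..n}" for k using that assms(12) by auto
  have Q: "Q k \<in> ext.places_above" "\<phi> -` Q k = P k" if "k \<in> {1..n}" for k
    using assms(14) that ext.lies_over_iff[of "Q k" "P k"] P(1)[OF sub[OF that]] by auto
  have Q_unique: "R = Q k" if "k \<in> {1..n}" "R \<in> ext.places_above" "\<phi> -` R = P k" for R k
  proof -
    have "lies_over \<phi> R (P k)" "lies_over \<phi> (Q k) (P k)"
      using that Q(1)[OF that(1)] Q(2)[OF that(1)] by (auto simp: lies_over_def)
    moreover have "\<exists>!Q. Q \<in> ext.places_above \<and> lies_over \<phi> Q (P k)"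
      using assms(13) that(1) by (auto simp: totally_ramified_def)
    ultimately show ?thesis using that(2) Q(1)[OF that(1)] by blast
  qed
  have trp: "totally_ramified_place \<phi> (\<lambda>i. w ^ i) m rat_const (P k) (Q k)" if k: "k \<in> {1..n}" for k
  proof
    show "Q k \<in> ext.places_above" by (rule Q(1)[OF k])
    show "P k = \<phi> -` Q k" by (rule Q(2)[OF k, symmetric])
    show "ramification_index \<phi> (Q k) (P k) = extension_dim \<phi> UNIV"
      using assms(13,14) k unfolding totally_ramified_def by blast
    show "\<exists>c. a - rat_const c \<in> P k" if "a \<in> place_ring (P k)" for a
      using P_eq[OF sub[OF k]] that linear_place_residue infinite_place_residue by auto
  qed
  have gcd: "gcd (int m) (val (P k) ?F) = 1" if k: "k \<in> {1..n}" for k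
    by (rule totally_ramified_place.kummer_gcd_eq_1[OF trp[OF k] char assms(7) F m])
      (use assms(5) in blast)
  have one: "1 \<in> {1..n}" using assms(16) by simp
  have N: "extension_dim \<phi> UNIV = m"
  proof -
    have "m dvd extension_dim \<phi> UNIV"
      by (rule totally_ramified_place.kummer_degree(1)[OF trp[OF one] assms(7) F m gcd[OF one]])
    moreover have "extension_dim \<phi> UNIV > 0" by (rule totally_ramified_place.degree_pos[OF trp[OF one]])
    ultimately show ?thesis using ext.extension_dim_le dvd_imp_le by (simp add: le_antisym)
  qed
  interpret kummer_extension \<phi> w m rat_const ?F
    by unfold_locales (fact m wm F char ext.independent_spanning_family[OF N])+
  have ram: "ramification_index \<phi> (Q k) (P k) = m" if "k \<in> {1..n}" for k
    using assms(13,14) that N unfolding totally_ramified_def by auto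

  define D where "D = (\<Sum>k=1..n. frag_cmul (\<alpha> k) (frag_of (Q k)))"
  have D_lookup: "Poly_Mapping.lookup D R = (\<Sum>k=1..n. if R = Q k then \<alpha> k else 0)" for R
    unfolding D_def lookup_sum by (intro sum.cong) (auto simp: when_def)
  have D_Q: "Poly_Mapping.lookup D (Q k) = \<alpha> k" if k: "k \<in> {1..n}" for k
  proof -
    have "Poly_Mapping.lookup D (Q k) = (\<Sum>j=1..n. if j = k then \<alpha> j else 0)"
      unfolding D_lookup using inj_onD[OF assms(15)] k by (intro sum.cong) auto
    then show ?thesis using k by simp
  qed
  \<comment> \<open>\<^term>\<open>D\<close> as a divisor of the rational function field\<close>
  define a where "a R = (\<Sum>k=1..n. if R = P k then \<alpha> k else 0)" for R
  have a_P: "a (P k) = (if k \<le> n then \<alpha> k else 0)" if k: "k \<in> {1..r}" for k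
  proof -
    have "a (P k) = (\<Sum>j=1..n. if j = k then \<alpha> j else 0)"
      unfolding a_def using inj_onD[OF P_inj _ k] sub by (intro sum.cong) auto
    then show ?thesis using k by auto
  qed
  have a_other: "a R = 0" if "R \<notin> P ` {1..n}" for R
    unfolding a_def using that by (intro sum.neutral) auto
  have coords: "(\<forall>R\<in>ext.places_above. z = 0 \<or> val R z + Poly_Mapping.lookup D R \<ge> 0) \<longleftrightarrow>
      (\<forall>i<m. \<forall>R\<in>places rat_const. c i = 0 \<or> val R (c i) + (a R - int i * val R ?F) div int m \<ge> 0)"
    if z: "z = (\<Sum>i<m. \<phi> (c i) * w ^ i)" for z c
  proof (rule riemann_roch_coords[OF _ z])
    fix R assume R: "R \<in> places (rat_const :: 'a \<Rightarrow> _)"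
    show "(a R = 0 \<and> (\<forall>Q\<in>ext.places_above. \<phi> -` Q = R \<longrightarrow> Poly_Mapping.lookup D Q = 0)) \<or>
      (\<exists>Q\<in>ext.places_above. \<phi> -` Q = R \<and> (\<forall>Q'\<in>ext.places_above. \<phi> -` Q' = R \<longrightarrow> Q' = Q) \<and>
        ramification_index \<phi> Q R = m \<and> gcd (int m) (val R ?F) = 1 \<and> Poly_Mapping.lookup D Q = a R)"
    proof (cases "R \<in> P ` {1..n}")
      case True
      then obtain k where k: "k \<in> {1..n}" "R = P k" by (elim imageE)
      have "a R = \<alpha> k" using a_P[OF sub[OF k(1)]] k by simp
      show ?thesis
      proof (intro disjI2 bexI[of _ "Q k"] conjI ballI impI)
        show "R' = Q k" if "R' \<in> ext.places_above" "\<phi> -` R' = R" for R'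
          using that k Q_unique by blast
      qed (use k Q[OF k(1)] ram[OF k(1)] gcd[OF k(1)] D_Q[OF k(1)] \<open>a R = \<alpha> k\<close> in simp_all)
    next
      case False
      have "Poly_Mapping.lookup D S = 0" if "\<phi> -` S = R" for S
      proof -
        have "S \<noteq> Q k" if "k \<in> {1..n}" for k
          using Q(2)[OF that] \<open>\<phi> -` S = R\<close> False that by auto
        then show ?thesis unfolding D_lookup by (intro sum.neutral) auto
      qed
      then show ?thesis using a_other[OF False] by simp
    qed
  qed

  \<comment> \<open>the divisor of the rational function field whose Riemann--Roch space contains the coordinate of
    index \<open>i\<close>; its degree is \<open>d i\<close>\<close>
  define E where "E i R = (a R - int i * val R ?F) div int m" for i and R :: "'a poly fract set"
  define C where "C = {c. linear_place c \<in> P ` {1..r}}"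
  define d where "d i = E i infinite_place + (\<Sum>c\<in>C. E i (linear_place c))" for i
  have P_linear: "R = infinite_place \<or> R \<in> linear_place ` C" if R: "R \<in> P ` {1..r}" for R
  proof -
    obtain k where k: "R = P k" "k \<in> {1..r}" using R by (elim imageE)
    have "R = infinite_place \<or> R \<in> range linear_place" using P_eq[OF k(2)] k(1) by simp
    then show ?thesis using R by (auto simp only: C_def)
  qed
  have E_other: "E i R = 0" if R: "R \<in> places rat_const" "R \<noteq> infinite_place" "R \<notin> linear_place ` C" for i R
  proof -
    have "R \<notin> P ` {1..r}" using P_linear R(2,3) by blast
    then have "val R ?F = 0" using P_image R by auto
    moreover have "R \<notin> P ` {1..n}" using \<open>R \<notin> P ` {1..r}\<close> sub by blast
    ultimately show ?thesis using a_other by (simp add: E_def)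
  qed
  have "\<exists>h. h \<noteq> 0 \<and> (\<forall>z. (\<forall>R\<in>places rat_const. z = 0 \<or> val R z + E i R \<ge> 0) \<longleftrightarrow>
      (\<exists>g. z = h * to_fract g \<and> (g = 0 \<or> int (degree g) \<le> d i)))" for i
    unfolding d_def using E_other by (intro riemann_roch_rational_function_field) auto
  then have "\<forall>i. \<exists>h. h \<noteq> 0 \<and> (\<forall>z. (\<forall>R\<in>places rat_const. z = 0 \<or> val R z + E i R \<ge> 0) \<longleftrightarrow>
      (\<exists>g. z = h * to_fract g \<and> (g = 0 \<or> int (degree g) \<le> d i)))" ..
  from choice[OF this] obtain h where h': "\<forall>i. h i \<noteq> 0 \<and> (\<forall>z. (\<forall>R\<in>places rat_const. z = 0 \<or> val R z + E i R \<ge> 0) \<longleftrightarrow>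
      (\<exists>g. z = h i * to_fract g \<and> (g = 0 \<or> int (degree g) \<le> d i)))" ..
  then have h: "h i \<noteq> 0" "(\<forall>R\<in>places rat_const. z = 0 \<or> val R z + E i R \<ge> 0) \<longleftrightarrow>
      (\<exists>g. z = h i * to_fract g \<and> (g = 0 \<or> int (degree g) \<le> d i))" for i z by blast+
  have space: "riemann_roch_space (\<phi> \<circ> rat_const) D =
      {\<Sum>i<m. \<phi> (c i) * w ^ i | c. \<forall>i<m. \<exists>g. c i = h i * to_fract g \<and> (g = 0 \<or> int (degree g) \<le> d i)}"
    (is "_ = ?V")
  proof -
    have rr: "z \<in> riemann_roch_space (\<phi> \<circ> rat_const) D \<longleftrightarrow>
        (\<forall>R\<in>ext.places_above. z = 0 \<or> val R z + Poly_Mapping.lookup D R \<ge> 0)" for z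
      unfolding riemann_roch_space_def by auto
    have iff: "(\<Sum>i<m. \<phi> (c i) * w ^ i) \<in> riemann_roch_space (\<phi> \<circ> rat_const) D \<longleftrightarrow>
        (\<forall>i<m. \<exists>g. c i = h i * to_fract g \<and> (g = 0 \<or> int (degree g) \<le> d i))" for c
      unfolding rr coords[OF refl] h(2)[symmetric] E_def ..
    have "z \<in> riemann_roch_space (\<phi> \<circ> rat_const) D \<longleftrightarrow> z \<in> ?V" for z
    proof
      assume z: "z \<in> riemann_roch_space (\<phi> \<circ> rat_const) D"
      obtain c where c: "z = (\<Sum>i<m. \<phi> (c i) * w ^ i)" using ext.ex_coords by blast
      show "z \<in> ?V" using z unfolding c iff by blast
    next
      assume "z \<in> ?V"
      then show "z \<in> riemann_roch_space (\<phi> \<circ> rat_const) D" using iff by blast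
    qed
    then show ?thesis by blast
  qed
  have ell: "ell (\<phi> \<circ> rat_const) D = (\<Sum>i<m. nat (d i + 1))"
    unfolding ell_def space
    by (rule extension_dim_poly_coords[OF field_hom_axioms independent h(1)])

  have d: "d i = (\<Sum>k=1..r. E i (P k))" for i
  proof -
    have inf: "infinite_place \<notin> linear_place ` C"
    proof
      assume "infinite_place \<in> linear_place ` C"
      then obtain c :: 'a where c: "infinite_place = linear_place c" by blast
      have "val infinite_place (to_fract [:- c, 1:]) = - 1" by (subst val_infinite_place(2)) auto
      then show False unfolding c val_linear_place by simp
    qed
    have inj: "inj_on linear_place C"
    proof (rule inj_onI)
      fix c c' :: 'a assume eq: "linear_place c = linear_place c'"
      have "val (linear_place c) (to_fract [:- c', 1:]) = 1" unfolding eq val_linear_place by simp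
      then show "c = c'" unfolding val_linear_place by (simp split: if_splits)
    qed
    have "infinite_place \<in> P ` {1..r}"
      unfolding P_image using assms(3) F infinite_place(1) val_infinite_place(2)[of f] by auto
    then have "insert infinite_place (linear_place ` C) \<subseteq> P ` {1..r}" unfolding C_def by blast
    moreover have "P ` {1..r} \<subseteq> insert infinite_place (linear_place ` C)" using P_linear by blast
    ultimately have image: "P ` {1..r} = insert infinite_place (linear_place ` C)" by (rule antisym[rotated])
    have "(\<Sum>k=1..r. E i (P k)) = (\<Sum>R\<in>P ` {1..r}. E i R)"
      by (simp only: sum.reindex[OF P_inj] comp_def)
    also have "\<dots> = (\<Sum>R\<in>insert infinite_place (linear_place ` C). E i R)" by (simp only: image)
    also have "\<dots> = d i" using inf inj by (simp add: d_def sum.reindex)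
    finally show ?thesis ..
  qed
  have floor: "\<lfloor>real_of_int x / real m\<rfloor> = x div int m" for x
    by (metis floor_divide_of_int_eq of_int_of_nat_eq)
  have split_r: "{1..r} = {1..n} \<union> {n+1..r}" "{1..n} \<inter> {n+1..r} = {}" using assms(12) by auto
  \<comment> \<open>at the places not below the support of \<^term>\<open>D\<close> the divisor \<^term>\<open>E 0\<close> vanishes\<close>
  have d_0: "d 0 = (\<Sum>k=1..n. \<lfloor>real_of_int (\<alpha> k) / real m\<rfloor>)"
  proof -
    have "d 0 = (\<Sum>k=1..n. E 0 (P k)) + (\<Sum>k=n+1..r. E 0 (P k))"
      unfolding d split_r(1) using split_r(2) by (intro sum.union_disjoint) auto
    also have "(\<Sum>k=n+1..r. E 0 (P k)) = 0"
      using a_P by (intro sum.neutral) (auto simp: E_def)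
    also have "(\<Sum>k=1..n. E 0 (P k)) = (\<Sum>k=1..n. \<lfloor>real_of_int (\<alpha> k) / real m\<rfloor>)"
      using a_P sub by (intro sum.cong) (auto simp: E_def floor)
    finally show ?thesis by simp
  qed
  have d_pos: "1 + d i = int n - kummer_beta m r lam i +
      (\<Sum>k=1..n. \<lfloor>real_of_int (\<alpha> k - kummer_t m lam k i) / real m\<rfloor>)" if i: "i \<in> {1..m-1}" for i
  proof -
    have ceil: "\<lceil>real_of_int (int i * lam k) / real m\<rceil> = - ((- (int i * lam k)) div int m)" for k
      using floor[of "- (int i * lam k)"] by (simp add: ceiling_def)
    have lam: "val (P k) ?F = lam k" if "k \<in> {1..r}" for k using assms(11) that by simp
    have E_ramified: "E i (P k) = 1 + (- (int i * lam k)) div int m +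
        \<lfloor>real_of_int (\<alpha> k - kummer_t m lam k i) / real m\<rfloor>" if k: "k \<in> {1..n}" for k
    proof -
      have "coprime (int m) (lam k)" using gcd[OF k] lam[OF sub[OF k]] by (simp add: coprime_iff_gcd_eq_1)
      moreover have "\<not> int m dvd int i" using i by (auto dest: dvd_imp_le)
      ultimately have ndvd: "\<not> int m dvd int i * lam k" by (simp add: coprime_dvd_mult_left_iff)
      have "E i (P k) = (\<alpha> k - int i * lam k) div int m"
        using a_P[OF sub[OF k]] lam[OF sub[OF k]] k by (simp add: E_def)
      also have "\<dots> = 1 + (- (int i * lam k)) div int m + (\<alpha> k - (int i * lam k) mod int m) div int m"
        using m ndvd by (intro div_minus_eq) auto
      also have "(\<alpha> k - (int i * lam k) mod int m) div int m =
          \<lfloor>real_of_int (\<alpha> k - kummer_t m lam k i) / real m\<rfloor>"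
        unfolding floor kummer_t_def ..
      finally show ?thesis .
    qed
    have "d i = (\<Sum>k=1..n. E i (P k)) + (\<Sum>k=n+1..r. E i (P k))"
      unfolding d split_r(1) using split_r(2) by (intro sum.union_disjoint) auto
    also have "(\<Sum>k=n+1..r. E i (P k)) = (\<Sum>k=n+1..r. (- (int i * lam k)) div int m)"
      using a_P lam by (intro sum.cong) (auto simp: E_def)
    also have "(\<Sum>k=1..n. E i (P k)) = int n + (\<Sum>k=1..n. (- (int i * lam k)) div int m) +
        (\<Sum>k=1..n. \<lfloor>real_of_int (\<alpha> k - kummer_t m lam k i) / real m\<rfloor>)"
      using E_ramified by (simp add: sum.distrib)
    finally have "d i = int n + (\<Sum>k=1..n. \<lfloor>real_of_int (\<alpha> k - kummer_t m lam k i) / real m\<rfloor>) +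
        ((\<Sum>k=1..n. (- (int i * lam k)) div int m) + (\<Sum>k=n+1..r. (- (int i * lam k)) div int m))"
      by simp
    also have "(\<Sum>k=1..n. (- (int i * lam k)) div int m) + (\<Sum>k=n+1..r. (- (int i * lam k)) div int m) =
        (\<Sum>k=1..r. (- (int i * lam k)) div int m)"
      unfolding split_r(1) using split_r(2) by (intro sum.union_disjoint[symmetric]) auto
    also have "\<dots> = - (kummer_beta m r lam i + 1)"
      unfolding kummer_beta_def ceil by (simp add: sum_negf)
    finally show ?thesis by simp
  qed
  have "int (ell (\<phi> \<circ> rat_const) D) = (\<Sum>i<m. max 0 (1 + d i))"
    unfolding ell by (simp add: max_def add.commute cong: sum.cong)
  also have "{..<m} = insert 0 {1..m-1}" using m by auto
  also have "(\<Sum>i\<in>insert 0 {1..m-1}. max 0 (1 + d i)) = max 0 (1 + d 0) + (\<Sum>i=1..m-1. max 0 (1 + d i))"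
    by (rule sum.insert) auto
  also have "(\<Sum>i=1..m-1. max 0 (1 + d i)) = (\<Sum>i=1..m-1. max 0 (int n - kummer_beta m r lam i +
      (\<Sum>k=1..n. \<lfloor>real_of_int (\<alpha> k - kummer_t m lam k i) / real m\<rfloor>)))"
    using d_pos by (intro sum.cong) simp_all
  finally show ?thesis unfolding D_def d_0 .
qed

end
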